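(* Let $X_{t,n}$ be the $\mathbb{R}^d$-valued multiscale moving average array of the context, with kernels satisfying conditions (i)–(iii) there, and let $S_n(f)=\frac1n\sum_{t=1}^n\left[f(X_{t,n})-\mathbb{E}f(X_{t,n})\right]$. Suppose that $\delta^\star=\max(2\delta_0,\delta_1\beta_1,\ldots,\delta_{q_2}\beta_{q_2})<-2$ and that the sequences $a_{n,i}$ and $b_{n,j}$ are bounded. Then there exists a constant $C\in(0,\infty)$ such that for all $n$ and all $f\in\mathfrak{F}_0$, $$\operatorname{Var}(S_n(f))\le \frac{C}{n}\left[\sum_{i=1}^{q_1}a_{n,i}^4+\sum_{j=1}^{q_2}b_{n,j}^{\beta_j}\right].$$ If $\eta>0$, then for any $\lambda\in(0,1)$ there exists a constant $C\in(0,\infty)$ such that for all $n$ and all $f\in\mathfrak{F}^0_\eta$, $$\operatorname{Var}(S_n(f))\le \frac{C}{n}\left[\left(\sum_{i=1}^{q_1}a_{n,i}^2\right)\exp\left(-\frac{\eta^2\lambda^2}{2d\sigma^2\sum_{i=1}^{q_1}a_{n,i}^2}\right)+\sum_{j=1}^{q_2}b_{n,j}^{\beta_j}\right].$$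
   Context: Multiscale array: for $t\in\mathbb{N}$, $$X_{t,n}=\sum_{i=1}^{q_1}a_{n,i}\int_{-\infty}^t h_i(s-t)\,dB^i_s+\sum_{j=1}^{q_2}b_{n,j}\int_{-\infty}^t g_j(s-t)\,dZ^j_s,$$ where $a_{n,i},b_{n,j}\ge 0$ are real sequences in $n$; $B^1,\ldots,B^{q_1}$ are independent standard (two-sided, real) Brownian motions; $Z^1,\ldots,Z^{q_2}$ are independent real symmetric $\beta_j$-stable Lévy motions, $\beta_j\in(0,2)$, with $\mathbb{E}\exp(i\lambda Z^j_1)=\exp(-|\lambda|^{\beta_j})$; the $B^i$ and $Z^j$ are mutually independent; and the kernels $h_i,g_j:\mathbb{R}\to\mathbb{R}^d$ satisfy, for some constant $C$: (i) $h_i(x)=g_j(x)=0$ for $x\ge0$; (ii) $h_i\in L_2(\mathbb{R})$ with $\|h_i(x)\|\le C|x|^{\delta_0}$, and each coordinate $h_i^l$, $l=1,\ldots,d$, satisfies $\|h_i^l\|_{L_2}\le\sigma<\infty$; (iii) $g_j\in L_{\beta_j}(\mathbb{R})$ and $\|g_j(x)\|\le C|x|^{\delta_j}$ for some $\delta_j<-1/\beta_j$. Function classes: for $\eta\ge0$, $\mathfrak{F}_\eta$ is the class of all $f:\mathbb{R}^d\to\mathbb{R}$ such that (F1) $f\in C^5(\mathbb{R}^d;\mathbb{R})$ and $\|D^jf\|_\infty\le1$ for $j=0,\ldots,5$; (F2) $f$ is even and $f(0)=0$; (F3) $D^2f(x)=D^2f(0)$ for $\|x\|<\eta$. The class $\mathfrak{F}^0_\eta\subset\mathfrak{F}_\eta$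 consists of those $f$ which additionally satisfy (F4) $f(x)=0$ for $\|x\|<\eta$. In particular $\mathfrak{F}_0=\mathfrak{F}_0^0$. *)

theory Defs
  imports "HOL-Probability.Probability"
begin

section \<open>Driving processes\<close>

definition independent_increments :: "'w measure \<Rightarrow> (real \<Rightarrow> 'w \<Rightarrow> real) \<Rightarrow> bool" where
  "independent_increments M Z \<longleftrightarrow>
     (\<forall>m (u :: nat \<Rightarrow> real). strict_mono_on {..m} u \<longrightarrow>
        prob_space.indep_vars M (\<lambda>_. borel) (\<lambda>k \<omega>. Z (u (Suc k)) \<omega> - Z (u k) \<omega>) {..<m})"

definition brownian_motion :: "'w measure \<Rightarrow> (real \<Rightarrow> 'w \<Rightarrow> real) \<Rightarrow> bool" where
  "brownian_motion M B \<longleftrightarrow>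
     (\<forall>t. B t \<in> borel_measurable M) \<and>
     (AE \<omega> in M. B 0 \<omega> = 0) \<and>
     independent_increments M B \<and>
     (\<forall>s t. s < t \<longrightarrow>
        distributed M lborel (\<lambda>\<omega>. B t \<omega> - B s \<omega>) (normal_density 0 (sqrt (t - s)))) \<and>
     (AE \<omega> in M. continuous_on UNIV (\<lambda>t. B t \<omega>))"

text \<open>With \<open>s = 0\<close>, \<open>t = 1\<close> the condition on the characteristic function is the normalisation
  \<open>E exp (i \<theta> Z\<^sub>1) = exp (- |\<theta>|\<^sup>\<beta>)\<close>.\<close>

definition symmetric_stable_motion ::
  "'w measure \<Rightarrow> real \<Rightarrow> (real \<Rightarrow> 'w \<Rightarrow> real) \<Rightarrow> bool" where
  "symmetric_stable_motion M \<beta> Z \<longleftrightarrow>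
     (\<forall>t. Z t \<in> borel_measurable M) \<and>
     (AE \<omega> in M. Z 0 \<omega> = 0) \<and>
     independent_increments M Z \<and>
     (\<forall>s t. s < t \<longrightarrow> (\<forall>\<theta>.
        char (distr M borel (\<lambda>\<omega>. Z t \<omega> - Z s \<omega>)) \<theta>
          = complex_of_real (exp (- ((t - s) * \<bar>\<theta>\<bar> powr \<beta>))))) \<and>
     (AE \<omega> in M. \<forall>t. continuous (at_right t) (\<lambda>s. Z s \<omega>) \<and>
        (\<exists>l. ((\<lambda>s. Z s \<omega>) \<longlongrightarrow> l) (at_left t)))"

text \<open>Independence of two families of processes, all taken together, each process being viewed as
  a random element of the product space of real functions on the line (so that it generates the
  sigma-algebra of all its marginals).\<close>

definition independent_processes ::
  "'w measure \<Rightarrow> 'i set \<Rightarrow> ('i \<Rightarrow> real \<Rightarrow> 'w \<Rightarrow> real) \<Rightarrow>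
   'j set \<Rightarrow> ('j \<Rightarrow> real \<Rightarrow> 'w \<Rightarrow> real) \<Rightarrow> bool" where
  "independent_processes M I B J Z \<longleftrightarrow>
     prob_space.indep_vars M (\<lambda>_. \<Pi>\<^sub>M t\<in>(UNIV :: real set). (borel :: real measure))
       (case_sum (\<lambda>i \<omega> t. B i t \<omega>) (\<lambda>j \<omega> t. Z j t \<omega>)) (I <+> J)"


section \<open>Stochastic integrals of deterministic kernels\<close>

definition in_L :: "real \<Rightarrow> (real \<Rightarrow> 'b::euclidean_space) \<Rightarrow> bool" where
  "in_L p k \<longleftrightarrow> k \<in> borel_measurable lebesgue \<and> integrable lebesgue (\<lambda>x. norm (k x) powr p)"

text \<open>A list of triples \<open>(u, v, c)\<close> encodes the step function with summands
  \<open>c\<close> times the indicator of \<open>(u, v]\<close>; the intervals may overlap.\<close>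

definition step_function :: "(real \<times> real \<times> 'b::real_vector) list \<Rightarrow> real \<Rightarrow> 'b" where
  "step_function \<xi> s = (\<Sum>(u, v, c) \<leftarrow> \<xi>. indicator {u<..v} s *\<^sub>R c)"

definition step_integral ::
  "(real \<Rightarrow> 'w \<Rightarrow> real) \<Rightarrow> (real \<times> real \<times> 'b::real_vector) list \<Rightarrow> 'w \<Rightarrow> 'b" where
  "step_integral Z \<xi> \<omega> = (\<Sum>(u, v, c) \<leftarrow> \<xi>. (Z v \<omega> - Z u \<omega>) *\<^sub>R c)"

definition tendsto_in_probability ::
  "'w measure \<Rightarrow> (nat \<Rightarrow> 'w \<Rightarrow> 'b::real_normed_vector) \<Rightarrow> ('w \<Rightarrow> 'b) \<Rightarrow> bool" where
  "tendsto_in_probability M Y\<^sub>s Y \<longleftrightarrow>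
     (\<forall>\<epsilon>>0. (\<lambda>m. measure M {\<omega> \<in> space M. norm (Y\<^sub>s m \<omega> - Y \<omega>) > \<epsilon>}) \<longlonglongrightarrow> 0)"

text \<open>\<open>Y\<close> is a version of the integral over \<open>S\<close> of \<open>k\<close> against \<open>Z\<close>. Here \<open>p\<close> is the stability
  index of \<open>Z\<close>, with \<open>p = 2\<close> for Brownian motion, in which case this is the Wiener integral
  (integrals of step functions converging in \<open>L\<^sub>2\<close> converge in quadratic mean, hence also in
  probability). The limit is almost surely independent of the approximating step functions.\<close>

definition has_stochastic_integral ::
  "'w measure \<Rightarrow> real \<Rightarrow> (real \<Rightarrow> 'w \<Rightarrow> real) \<Rightarrow> real set \<Rightarrow>
   (real \<Rightarrow> 'b::euclidean_space) \<Rightarrow> ('w \<Rightarrow> 'b) \<Rightarrow> bool" where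
  "has_stochastic_integral M p Z S k Y \<longleftrightarrow>
     Y \<in> borel_measurable M \<and>
     (\<exists>\<xi> :: nat \<Rightarrow> (real \<times> real \<times> 'b) list.
        (\<forall>m. \<forall>(u, v, c) \<in> set (\<xi> m). u < v) \<and>
        ((\<lambda>m. \<integral>\<^sup>+ s. ennreal (norm (step_function (\<xi> m) s - indicator S s *\<^sub>R k s) powr p) \<partial>lebesgue)
           \<longlonglongrightarrow> 0) \<and>
        tendsto_in_probability M (\<lambda>m. step_integral Z (\<xi> m)) Y)"


section \<open>Function classes\<close>

text \<open>\<open>deriv_along f [v\<^sub>1, \<dots>, v\<^sub>j] x\<close> is the value \<open>D\<^sup>j f(x)[v\<^sub>1, \<dots>, v\<^sub>j]\<close> of the \<open>j\<close>-th derivative as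
  a multilinear form.\<close>

primrec deriv_along :: "('a::real_normed_vector \<Rightarrow> real) \<Rightarrow> 'a list \<Rightarrow> 'a \<Rightarrow> real" where
  "deriv_along f [] = f"
| "deriv_along f (v # vs) = (\<lambda>x. frechet_derivative (deriv_along f vs) (at x) v)"

definition C_class :: "nat \<Rightarrow> ('a::euclidean_space \<Rightarrow> real) \<Rightarrow> bool" where
  "C_class k f \<longleftrightarrow>
     (\<forall>vs. length vs < k \<longrightarrow> deriv_along f vs differentiable_on UNIV) \<and>
     (\<forall>vs. length vs \<le> k \<longrightarrow> continuous_on UNIV (deriv_along f vs))"

text \<open>The second condition bounds the operator norm of the multilinear forms
  \<open>D\<^sup>j f(x)\<close>, uniformly in \<open>x\<close>, for \<open>j \<le> 5\<close>.\<close>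

definition F_class :: "real \<Rightarrow> ('a::euclidean_space \<Rightarrow> real) set" where
  "F_class \<eta> = {f.
     C_class 5 f \<and>
     (\<forall>vs x. length vs \<le> 5 \<longrightarrow> \<bar>deriv_along f vs x\<bar> \<le> (\<Prod>v \<leftarrow> vs. norm v)) \<and>
     (\<forall>x. f (- x) = f x) \<and> f 0 = 0 \<and>
     (\<forall>x. norm x < \<eta> \<longrightarrow> (\<forall>u v. deriv_along f [u, v] x = deriv_along f [u, v] 0))}"

definition F0_class :: "real \<Rightarrow> ('a::euclidean_space \<Rightarrow> real) set" where
  "F0_class \<eta> = {f \<in> F_class \<eta>. \<forall>x. norm x < \<eta> \<longrightarrow> f x = 0}"


section \<open>The statistic\<close>

definition centered_mean ::
  "'w measure \<Rightarrow> (nat \<Rightarrow> nat \<Rightarrow> 'w \<Rightarrow> 'a) \<Rightarrow> nat \<Rightarrow> ('a \<Rightarrow> real) \<Rightarrow> 'w \<Rightarrow> real" where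
  "centered_mean M X n f \<omega> =
     (1 / real n) * (\<Sum>t = 1..n. f (X t n \<omega>) - (\<integral>\<omega>'. f (X t n \<omega>') \<partial>M))"

end

theory Submission
  imports Defs
begin

text \<open>Replace the stochastic integrals by integrals of step functions, so that \<open>X\<^sub>s\<close> and \<open>X\<^sub>t\<close> with \<open>s < t\<close>
  become linear combinations of independent symmetric increments, and write \<open>X\<^sub>t = U + V\<close> with \<open>U\<close>
  the contribution of the increments up to time \<open>s\<close>. Since \<open>f\<close> is even and \<open>V\<close> is symmetric and
  independent of the past, \<open>f (U + V)\<close> may be replaced by \<open>(f (U + V) + f (U - V)) / 2\<close> in the
  covariance, and this differs from \<open>f V\<close> by a second difference, at most \<open>2 min 1 |U|\<^sup>2\<close>. Hence the
  covariance is controlled by \<open>E |f (X\<^sub>s)| min 1 |U|\<^sup>2\<close>, and the decay of the kernels gives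
  \<open>E min 1 |U|\<^sup>2 \<le> C (t - s)\<^sup>\<delta>\<^sup>*\<^sup>+\<^sup>1 (\<Sum> a\<^sup>2 + \<Sum> b\<^sup>\<beta>)\<close>, which is summable in \<open>t - s\<close>
  because \<open>\<delta>\<^sup>* < -2\<close>. The factor \<open>|f (X\<^sub>s)|\<close> is bounded by \<open>|X\<^sub>s|\<^sup>2\<close>, which upgrades
  \<open>a\<^sup>2\<close> to \<open>a\<^sup>4\<close>, or, if \<open>f\<close> vanishes near \<open>0\<close>, by the indicator of a large deviation of the Gaussian
  part plus a term in the stable part.\<close>

section \<open>Second differences and step functions on a grid\<close>

text \<open>Stable variables of index below 2 have infinite variance, and the stochastic integrals
  are given only as limits in probability. So all estimates concern finite sums of independent
  increments, with constants independent of the grid, and only expectations of bounded Lipschitz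
  functions pass to the limit. For the stable part, second moments are replaced by E min 1 |L|^2,
  which a characteristic function argument bounds by a multiple of the scale sum; this is the origin
  of \<open>b powr \<beta>\<close>. A step function approximating a kernel on {..s} may extend
  beyond s; that piece is split off as an error e tending to 0. In the second claim the exponent
  suffers three losses: the threshold for the Gaussian part drops from \<eta> to r < \<eta>; the
  factor \<sigma>^2 grows to some v > \<sigma>^2, since step functions satisfy the bound by \<sigma>
  only approximately; and separating the tail event from |U|^2 costs a factor 1 - 1/m. The margin
  \<mu> < 1 is spent on these three. \<open>admissible\<close> collects the properties of f,
  obtained from its derivatives, on which the argument rests.\<close>

definition admissible :: "('a::euclidean_space \<Rightarrow> real) \<Rightarrow> bool" where
  "admissible f \<longleftrightarrow> (\<forall>x. \<bar>f x\<bar> \<le> 1) \<and> (\<forall>x. f (- x) = f x) \<and> f 0 = 0 \<and>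
     (\<forall>x y. \<bar>f x - f y\<bar> \<le> norm (x - y)) \<and>
     (\<forall>v u. \<bar>(f (v + u) + f (v - u)) / 2 - f v\<bar> \<le> (norm u)\<^sup>2)"

section \<open>Second differences of smooth functions\<close>

lemma has_real_derivative_along_line:
  fixes g :: "'a::real_normed_vector \<Rightarrow> real"
  assumes "g differentiable_on UNIV"
  shows "((\<lambda>r. g (x + r *\<^sub>R w)) has_real_derivative frechet_derivative g (at (x + r *\<^sub>R w)) w) (at r)"
proof -
  have d: "(g has_derivative frechet_derivative g (at (x + r *\<^sub>R w))) (at (x + r *\<^sub>R w))"
    using assms by (simp add: differentiable_on_def frechet_derivative_works)
  have l: "((\<lambda>r. x + r *\<^sub>R w) has_derivative (\<lambda>s. s *\<^sub>R w)) (at r)"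
    by (auto intro!: derivative_eq_intros)
  have "((\<lambda>r. g (x + r *\<^sub>R w)) has_derivative (\<lambda>s. frechet_derivative g (at (x + r *\<^sub>R w)) (s *\<^sub>R w))) (at r)"
    using has_derivative_compose[OF l d] by simp
  moreover have "(\<lambda>s. frechet_derivative g (at (x + r *\<^sub>R w)) (s *\<^sub>R w)) = (*) (frechet_derivative g (at (x + r *\<^sub>R w)) w)"
    using linear_scale[OF has_derivative_linear[OF d]] by (auto simp: fun_eq_iff)
  ultimately show ?thesis by (simp add: has_field_derivative_def)
qed

lemma diff_le_of_directional_derivative_le:
  fixes g :: "'a::real_normed_vector \<Rightarrow> real"
  assumes "g differentiable_on UNIV" and "\<And>x. \<bar>frechet_derivative g (at x) w\<bar> \<le> c"
  shows "\<bar>g (x + w) - g x\<bar> \<le> c"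
proof -
  obtain z where "g (x + 1 *\<^sub>R w) - g (x + 0 *\<^sub>R w) = (1 - 0) * frechet_derivative g (at (x + z *\<^sub>R w)) w"
    using MVT2[of 0 1 "\<lambda>r. g (x + r *\<^sub>R w)" "\<lambda>r. frechet_derivative g (at (x + r *\<^sub>R w)) w"]
      has_real_derivative_along_line[OF assms(1)] by auto
  then show ?thesis using assms(2) by simp
qed

text \<open>The mean value theorem, applied twice. The derivative of r -> f (v + r u) + f (v - r u)
  at z is a difference of Df(.)[u] between two points that are 2 z u apart, hence at most 2 z |u|^2.
  Division by 2 absorbs 2 z < 2.\<close>

lemma second_difference_le:
  fixes f :: "'a::real_normed_vector \<Rightarrow> real"
  assumes f: "f differentiable_on UNIV"
    and f': "(\<lambda>x. frechet_derivative f (at x) u) differentiable_on UNIV"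
    and f'': "\<And>x w. \<bar>frechet_derivative (\<lambda>x. frechet_derivative f (at x) u) (at x) w\<bar> \<le> norm w * norm u"
  shows "\<bar>(f (v + u) + f (v - u)) / 2 - f v\<bar> \<le> (norm u)\<^sup>2"
proof -
  let ?D = "\<lambda>x. frechet_derivative f (at x) u"
  have d: "((\<lambda>r. f (v + r *\<^sub>R u) + f (v + (- r) *\<^sub>R u)) has_real_derivative
      ?D (v + r *\<^sub>R u) - ?D (v + (- r) *\<^sub>R u)) (at r)" for r
  proof -
    have "((\<lambda>r. f (v + (- r) *\<^sub>R u)) has_real_derivative - ?D (v + (- r) *\<^sub>R u)) (at r)"
      using DERIV_chain2[where f = "\<lambda>r. f (v + r *\<^sub>R u)" and g = uminus and Db = "- 1"
            and x = r and s = UNIV, OF has_real_derivative_along_line[OF f, of v u "- r"]]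
      by (simp add: DERIV_ident[THEN DERIV_minus])
    from DERIV_add[OF has_real_derivative_along_line[OF f, of v u r] this] show ?thesis by simp
  qed
  obtain z where z: "0 < z" "z < 1" and eq: "(f (v + 1 *\<^sub>R u) + f (v + (- 1) *\<^sub>R u)) - (f (v + 0 *\<^sub>R u) + f (v + (- 0) *\<^sub>R u))
      = (1 - 0) * (?D (v + z *\<^sub>R u) - ?D (v + (- z) *\<^sub>R u))"
    using MVT2[of 0 1 "\<lambda>r. f (v + r *\<^sub>R u) + f (v + (- r) *\<^sub>R u)" "\<lambda>r. ?D (v + r *\<^sub>R u) - ?D (v + (- r) *\<^sub>R u)"] d
    by auto
  have "\<bar>?D ((v + (- z) *\<^sub>R u) + (2 * z) *\<^sub>R u) - ?D (v + (- z) *\<^sub>R u)\<bar> \<le> norm ((2 * z) *\<^sub>R u) * norm u"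
    by (intro diff_le_of_directional_derivative_le f' f'')
  also have "(v + (- z) *\<^sub>R u) + (2 * z) *\<^sub>R u = v + z *\<^sub>R u"
    by (simp add: algebra_simps flip: scaleR_add_left)
  also have "norm ((2 * z) *\<^sub>R u) * norm u \<le> 2 * (norm u)\<^sup>2"
    using z by (simp add: power2_eq_square mult_right_mono mult_left_le_one_le)
  finally show ?thesis using eq by (simp add: field_simps abs_le_iff)
qed

lemma F_class_admissible:
  fixes f :: "'a::euclidean_space \<Rightarrow> real"
  assumes "f \<in> F_class \<eta>"
  shows "admissible f"
proof -
  have C: "C_class 5 f" and b: "\<And>vs x. length vs \<le> 5 \<Longrightarrow> \<bar>deriv_along f vs x\<bar> \<le> (\<Prod>v \<leftarrow> vs. norm v)"
    and s: "\<And>x. f (- x) = f x" "f 0 = 0"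
    using assms by (auto simp: F_class_def)
  have dv: "\<And>vs. length vs < 5 \<Longrightarrow> deriv_along f vs differentiable_on UNIV"
    using C by (simp add: C_class_def)
  have d0: "f differentiable_on UNIV" using dv[of "[]"] by simp
  have d1: "(\<lambda>x. frechet_derivative f (at x) u) differentiable_on UNIV" for u
    using dv[of "[u]"] by simp
  have lip: "\<bar>f x - f y\<bar> \<le> norm (x - y)" for x y
    using diff_le_of_directional_derivative_le[OF d0, of "x - y" "norm (x - y)" y] b[of "[x - y]"] by simp
  have sd: "\<bar>(f (v + u) + f (v - u)) / 2 - f v\<bar> \<le> (norm u)\<^sup>2" for u v
    using b[of "[_, u]"] by (intro second_difference_le d0 d1) simp
  show ?thesis using b[of "[]"] s lip sd by (simp add: admissible_def)
qed

text \<open>The second difference at v = 0: by evenness the average of f x and f (- x) is f x, and f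
  0 = 0.\<close>

lemma admissible_le_norm_sq: "admissible f \<Longrightarrow> \<bar>f x\<bar> \<le> (norm x)\<^sup>2"
  unfolding admissible_def by (metis add_0 diff_0 diff_zero field_sum_of_halves mult_2 nonzero_mult_div_cancel_left zero_neq_numeral)

lemma admissible_measurable: 
  assumes "admissible f" shows "f \<in> borel_measurable borel"
proof -
  have "1-lipschitz_on UNIV f"
    using assms by (intro lipschitz_onI) (auto simp: dist_norm admissible_def)
  then show ?thesis
    by (intro borel_measurable_continuous_onI lipschitz_on_continuous_on)
qed

section \<open>Step functions and their integrals on a finite grid\<close>

lemma finite_set_grid:
  assumes "finite P" "P \<noteq> {}"
  obtains u :: "nat \<Rightarrow> real" and m where "strict_mono_on {..m} u" "P = u ` {..m}"
proof -
  let ?l = "sorted_list_of_set P"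
  have len: "length ?l = card P" "card P > 0" using assms by (auto simp: card_gt_0_iff)
  have "strict_mono_on {..card P - 1} (nth ?l)"
    using sorted_wrt_nth_less[OF strict_sorted_list_of_set[of P]] len
    by (auto intro!: strict_mono_onI)
  moreover have "P = nth ?l ` {..card P - 1}"
  proof -
    have "P = set ?l" using assms by simp
    also have "\<dots> = nth ?l ` {..<card P}" using len by (auto simp: in_set_conv_nth)
    also have "{..<card P} = {..card P - 1}" using len by auto
    finally show ?thesis .
  qed
  ultimately show thesis using that by blast
qed

text \<open>Telescoping. A cell (u k, u (Suc k)] lies inside (u i, u j] exactly when its right
  endpoint does, which is why the indicator is evaluated at \<open>u (Suc k)\<close>.\<close>

lemma increment_eq_sum_grid:
  fixes w :: "real \<Rightarrow> real" and u :: "nat \<Rightarrow> real"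
  assumes u: "strict_mono_on {..m} u" and ij: "i < j" "j \<le> m"
  shows "w (u j) - w (u i) = (\<Sum>k<m. (w (u (Suc k)) - w (u k)) * indicator {u i<..u j} (u (Suc k)))"
proof -
  have ind: "u (Suc k) \<in> {u i<..u j} \<longleftrightarrow> i \<le> k \<and> k < j" if "k < m" for k
  proof -
    have "u i < u (Suc k) \<longleftrightarrow> i < Suc k"
      using strict_mono_on_less[OF u, of i "Suc k"] that ij by auto
    moreover have "u (Suc k) \<le> u j \<longleftrightarrow> Suc k \<le> j"
      using strict_mono_on_less_eq[OF u, of "Suc k" j] that ij by auto
    ultimately show ?thesis by auto
  qed
  have "(\<Sum>k<m. (w (u (Suc k)) - w (u k)) * indicator {u i<..u j} (u (Suc k)))
      = (\<Sum>k<m. if k \<in> {i..<j} then w (u (Suc k)) - w (u k) else 0)"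
    using ind by (intro sum.cong) (auto simp: indicator_def)
  also have "\<dots> = (\<Sum>k\<in>{..<m} \<inter> {i..<j}. w (u (Suc k)) - w (u k))"
    by (rule sum.inter_restrict[symmetric]) simp
  also have "{..<m} \<inter> {i..<j} = {i..<j}" using ij by auto
  also have "(\<Sum>k\<in>{i..<j}. w (u (Suc k)) - w (u k)) = w (u j) - w (u i)"
    using ij by (intro sum_Suc_diff') auto
  finally show ?thesis ..
qed

text \<open>The intervals in \<xi> may overlap, so the increments attached to them are dependent.
  Rewritten over the cells of a grid, the integral becomes a linear combination of increments over
  disjoint intervals.\<close>

lemma step_integral_grid:
  fixes \<xi> :: "(real \<times> real \<times> 'b::real_vector) list"
  assumes u: "strict_mono_on {..m} u"
    and \<xi>: "\<forall>(a, b, c) \<in> set \<xi>. a < b \<and> a \<in> u ` {..m} \<and> b \<in> u ` {..m}"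
  shows "step_integral W \<xi> w = (\<Sum>k<m. (W (u (Suc k)) w - W (u k) w) *\<^sub>R step_function \<xi> (u (Suc k)))"
  using \<xi>
proof (induction \<xi>)
  case Nil then show ?case by (simp add: step_integral_def step_function_def)
next
  case (Cons x \<xi>)
  obtain a b c where x: "x = (a, b, c)" by (cases x)
  with Cons obtain i j where ij: "a = u i" "b = u j" "i \<le> m" "j \<le> m" "a < b" by auto
  then have "i < j" using strict_mono_on_less[OF u, of i j] by auto
  note inc = increment_eq_sum_grid[OF u this \<open>j \<le> m\<close>, of "\<lambda>t. W t w"]
  have "step_integral W (x # \<xi>) w = (W b w - W a w) *\<^sub>R c + step_integral W \<xi> w"
    by (simp add: step_integral_def x)
  also have "(W b w - W a w) *\<^sub>R c
      = (\<Sum>k<m. (W (u (Suc k)) w - W (u k) w) *\<^sub>R (indicator {a<..b} (u (Suc k)) *\<^sub>R c))"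
    by (simp only: ij inc scaleR_sum_left scaleR_scaleR)
  also have "step_integral W \<xi> w
      = (\<Sum>k<m. (W (u (Suc k)) w - W (u k) w) *\<^sub>R step_function \<xi> (u (Suc k)))"
    using Cons by simp
  also have "(\<Sum>k<m. (W (u (Suc k)) w - W (u k) w) *\<^sub>R (indicator {a<..b} (u (Suc k)) *\<^sub>R c)) + \<dots>
      = (\<Sum>k<m. (W (u (Suc k)) w - W (u k) w) *\<^sub>R step_function (x # \<xi>) (u (Suc k)))"
    by (simp only: x step_function_def list.map sum_list.Cons prod.case scaleR_add_right sum.distrib)
  finally show ?case .
qed

lemma step_function_grid:
  fixes \<xi> :: "(real \<times> real \<times> 'b::real_vector) list"
  assumes u: "strict_mono_on {..m} u"
    and \<xi>: "\<forall>(a, b, c) \<in> set \<xi>. a \<in> u ` {..m} \<and> b \<in> u ` {..m}"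
    and x: "k < m" "u k < x" "x \<le> u (Suc k)"
  shows "step_function \<xi> x = step_function \<xi> (u (Suc k))"
  using \<xi>
proof (induction \<xi>)
  case (Cons y \<xi>)
  obtain a b c where y: "y = (a, b, c)" by (cases y)
  with Cons obtain i j where ij: "a = u i" "b = u j" "i \<le> m" "j \<le> m" by auto
  have less: "u l < x \<longleftrightarrow> u l < u (Suc k)" if "l \<le> m" for l
  proof
    assume "u l < u (Suc k)"
    then have "l \<le> k" using strict_mono_on_less[OF u, of l "Suc k"] that x by auto
    then show "u l < x" using strict_mono_on_less_eq[OF u, of l k] that x by auto
  qed (use x in auto)
  have "x \<in> {a<..b} \<longleftrightarrow> u (Suc k) \<in> {a<..b}"
    using less[of i] less[of j] ij by auto
  with Cons show ?case by (simp add: step_function_def y indicator_def)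
qed (simp add: step_function_def)

text \<open>Turns the variance and scale sums of the coefficients into integrals of the step
  function, where the approximation of the kernel is available. F will be the square of a coordinate
  or a power of the norm.\<close>

lemma sum_grid_le_nn_integral:
  fixes \<xi> :: "(real \<times> real \<times> 'b::real_vector) list" and F :: "'b \<Rightarrow> real"
  assumes u: "strict_mono_on {..m} u"
    and \<xi>: "\<forall>(a, b, c) \<in> set \<xi>. a \<in> u ` {..m} \<and> b \<in> u ` {..m}"
    and F: "\<And>y. 0 \<le> F y"
    and K: "K \<subseteq> {..<m}" "\<And>k. k \<in> K \<Longrightarrow> {u k<..u (Suc k)} \<subseteq> S"
  shows "ennreal (\<Sum>k\<in>K. (u (Suc k) - u k) * F (step_function \<xi> (u (Suc k))))
    \<le> (\<integral>\<^sup>+x. ennreal (F (step_function \<xi> x)) * indicator S x \<partial>lebesgue)"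
proof -
  let ?I = "\<lambda>k. {u k<..u (Suc k)}"
  have fin: "finite K" using K(1) finite_subset by auto
  have mono: "u k < u (Suc k)" if "k \<in> K" for k
    using strict_mono_onD[OF u, of k "Suc k"] K(1) that by auto
  have disj: "disjoint_family_on ?I K"
    unfolding disjoint_family_on_def
  proof safe
    fix k l x assume kl: "k \<in> K" "l \<in> K" "k \<noteq> l" and x: "x \<in> ?I k" "x \<in> ?I l"
    have "k < l \<or> l < k" using kl by auto
    then show "x \<in> {}"
    proof
      assume "k < l"
      then have "u (Suc k) \<le> u l" using strict_mono_on_less_eq[OF u, of "Suc k" l] kl K(1) by auto
      then show ?thesis using x by auto
    next
      assume "l < k"
      then have "u (Suc l) \<le> u k" using strict_mono_on_less_eq[OF u, of "Suc l" k] kl K(1) by auto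
      then show ?thesis using x by auto
    qed
  qed
  have "ennreal (\<Sum>k\<in>K. (u (Suc k) - u k) * F (step_function \<xi> (u (Suc k))))
      = (\<Sum>k\<in>K. ennreal (F (step_function \<xi> (u (Suc k)))) * emeasure lebesgue (?I k))"
    using mono F by (subst sum_ennreal[symmetric])
      (auto intro!: sum.cong simp: ennreal_mult' mult.commute less_imp_le)
  also have "\<dots> = (\<Sum>k\<in>K. \<integral>\<^sup>+x. ennreal (F (step_function \<xi> (u (Suc k)))) * indicator (?I k) x \<partial>lebesgue)"
    by (intro sum.cong refl nn_integral_cmult_indicator[symmetric]) auto
  also have "\<dots> = (\<integral>\<^sup>+x. (\<Sum>k\<in>K. ennreal (F (step_function \<xi> (u (Suc k)))) * indicator (?I k) x) \<partial>lebesgue)"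
    by (intro nn_integral_sum[symmetric] borel_measurable_times_ennreal borel_measurable_const
        borel_measurable_indicator) auto
  also have "\<dots> \<le> (\<integral>\<^sup>+x. ennreal (F (step_function \<xi> x)) * indicator S x \<partial>lebesgue)"
  proof (intro nn_integral_mono)
    fix x
    show "(\<Sum>k\<in>K. ennreal (F (step_function \<xi> (u (Suc k)))) * indicator (?I k) x)
        \<le> ennreal (F (step_function \<xi> x)) * indicator S x"
    proof (cases "\<exists>k\<in>K. x \<in> ?I k")
      case True
      then obtain k where k: "k \<in> K" "x \<in> ?I k" by auto
      have "(\<Sum>l\<in>K. ennreal (F (step_function \<xi> (u (Suc l)))) * indicator (?I l) x)
          = ennreal (F (step_function \<xi> (u (Suc k)))) * indicator (?I k) x"
      proof -
        have "x \<notin> ?I l" if "l \<in> K - {k}" for l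
          using disjoint_family_onD[OF disj, of l k] that k by blast
        then show ?thesis
          using fin k by (subst sum.remove[of K k]) (auto intro!: sum.neutral simp del: greaterThanAtMost_iff)
      qed
      moreover have "step_function \<xi> x = step_function \<xi> (u (Suc k))"
        using step_function_grid[OF u \<xi>, of k x] k K by auto
      moreover have "x \<in> S" using k K by blast
      ultimately show ?thesis using k by simp
    next
      case False
      then have "(\<Sum>k\<in>K. ennreal (F (step_function \<xi> (u (Suc k)))) * indicator (?I k) x) = 0"
        by (intro sum.neutral) (auto simp: indicator_def)
      then show ?thesis by simp
    qed
  qed
  finally show ?thesis .
qed

section \<open>Sums of independent Gaussian and stable increments\<close>

lemma (in prob_space) indep_var_nn_integral:
  assumes "indep_var S X T Y" and [measurable]: "f \<in> borel_measurable S" "g \<in> borel_measurable T"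
  shows "(\<integral>\<^sup>+w. f (X w) * g (Y w) \<partial>M) = (\<integral>\<^sup>+w. f (X w) \<partial>M) * (\<integral>\<^sup>+w. g (Y w) \<partial>M)"
proof -
  have [measurable]: "X \<in> measurable M S" "Y \<in> measurable M T"
    and eq: "distr M S X \<Otimes>\<^sub>M distr M T Y = distr M (S \<Otimes>\<^sub>M T) (\<lambda>w. (X w, Y w))"
    using assms(1) by (auto simp: indep_var_distribution_eq)
  interpret Y: prob_space "distr M T Y" by (rule prob_space_distr) measurable
  have "(\<integral>\<^sup>+w. f (X w) * g (Y w) \<partial>M) = (\<integral>\<^sup>+z. f (fst z) * g (snd z) \<partial>distr M (S \<Otimes>\<^sub>M T) (\<lambda>w. (X w, Y w)))"
    by (subst nn_integral_distr) auto
  also have "\<dots> = (\<integral>\<^sup>+x. \<integral>\<^sup>+y. f x * g y \<partial>distr M T Y \<partial>distr M S X)"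
    by (subst eq[symmetric], subst Y.nn_integral_fst[symmetric]) auto
  also have "\<dots> = (\<integral>\<^sup>+w. f (X w) \<partial>M) * (\<integral>\<^sup>+w. g (Y w) \<partial>M)"
    by (simp add: nn_integral_cmult nn_integral_multc nn_integral_distr)
  finally show ?thesis .
qed

lemma (in prob_space) nn_integral_exp_normal:
  assumes X: "distributed M lborel X (normal_density 0 s)" and s: "0 < s"
  shows "(\<integral>\<^sup>+w. ennreal (exp (\<theta> * X w)) \<partial>M) = ennreal (exp (\<theta>\<^sup>2 * s\<^sup>2 / 2))"
proof -
  have "(\<integral>\<^sup>+w. ennreal (exp (\<theta> * X w)) \<partial>M)
      = (\<integral>\<^sup>+x. ennreal (normal_density 0 s x) * ennreal (exp (\<theta> * x)) \<partial>lborel)"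
    by (rule distributed_nn_integral[OF X, symmetric]) simp
  also have "\<dots> = (\<integral>\<^sup>+x. ennreal (exp (\<theta>\<^sup>2 * s\<^sup>2 / 2)) * ennreal (normal_density (\<theta> * s\<^sup>2) s x) \<partial>lborel)"
  proof (intro nn_integral_cong)
    fix x :: real
    \<comment> \<open>Completing the square: tilting the centred normal density by exp (\<theta> x)
      shifts its mean to \<theta> s^2.\<close>
    have "- x\<^sup>2 / (2 * s\<^sup>2) + \<theta> * x = \<theta>\<^sup>2 * s\<^sup>2 / 2 - (x - \<theta> * s\<^sup>2)\<^sup>2 / (2 * s\<^sup>2)"
      using s by (simp add: field_simps power2_eq_square)
    then have "exp (- x\<^sup>2 / (2 * s\<^sup>2)) * exp (\<theta> * x)
        = exp (\<theta>\<^sup>2 * s\<^sup>2 / 2) * exp (- (x - \<theta> * s\<^sup>2)\<^sup>2 / (2 * s\<^sup>2))"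
      by (simp flip: exp_add)
    then show "ennreal (normal_density 0 s x) * ennreal (exp (\<theta> * x))
        = ennreal (exp (\<theta>\<^sup>2 * s\<^sup>2 / 2)) * ennreal (normal_density (\<theta> * s\<^sup>2) s x)"
      by (simp add: normal_density_def flip: ennreal_mult)
  qed
  also have "\<dots> = ennreal (exp (\<theta>\<^sup>2 * s\<^sup>2 / 2)) * (\<integral>\<^sup>+x. ennreal (normal_density (\<theta> * s\<^sup>2) s x) \<partial>lborel)"
    by (intro nn_integral_cmult) simp
  also have "(\<integral>\<^sup>+x. ennreal (normal_density (\<theta> * s\<^sup>2) s x) \<partial>lborel) = 1"
    using s by (simp add: nn_integral_eq_integral normal_density_nonneg)
  finally show ?thesis by simp
qed

lemma (in prob_space) nn_integral_one_minus_cos: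
  assumes [measurable]: "X \<in> borel_measurable M"
  shows "(\<integral>\<^sup>+w. ennreal (1 - cos (t * X w)) \<partial>M) = ennreal (1 - Re (char (distr M borel X) t))"
proof -
  have int: "integrable M (\<lambda>w. cos (t * X w))"
    by (intro integrable_const_bound[where B=1]) auto
  have inti: "integrable M (\<lambda>w. iexp (t * X w))"
    by (intro integrable_iexp) auto
  have "Re (char (distr M borel X) t) = Re (\<integral>w. iexp (t * X w) \<partial>M)"
    by (simp add: char_def integral_distr)
  also have "\<dots> = (\<integral>w. Re (iexp (t * X w)) \<partial>M)"
    using inti by (rule integral_Re[symmetric])
  also have "\<dots> = (\<integral>w. cos (t * X w) \<partial>M)"
    by (intro Bochner_Integration.integral_cong) (auto simp: Re_exp)
  finally have "1 - Re (char (distr M borel X) t) = (\<integral>w. 1 - cos (t * X w) \<partial>M)"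
    using int by (simp add: prob_space)
  moreover have "(\<integral>\<^sup>+w. ennreal (1 - cos (t * X w)) \<partial>M) = ennreal (\<integral>w. 1 - cos (t * X w) \<partial>M)"
    using int by (intro nn_integral_eq_integral) auto
  ultimately show ?thesis by simp
qed

lemma real_distribution_distr_id: "real_distribution M \<Longrightarrow> distr M borel (\<lambda>x. x) = M"
  by (metis distr_id2 real_distribution.events_eq_borel)

text \<open>The right side is 4 times the average of 1 - cos (\<theta> y) over a standard normal
  \<theta>, so that expectations of truncated squares can be read off a characteristic function.
  With z = y^2 / 2, both sides are compared with z / (1 + z).\<close>

lemma min_sq_le_exp: "min 1 (y\<^sup>2) \<le> 4 * (1 - exp (- (y\<^sup>2) / 2))" for y :: real
proof -
  define z where "z = y\<^sup>2 / 2"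
  have z: "0 \<le> z" by (simp add: z_def)
  have "(1 + z) * exp (- z) \<le> 1"
    using exp_ge_add_one_self[of z] by (simp add: exp_minus field_simps)
  then have "z \<le> (1 + z) * (1 - exp (- z))" by (simp add: algebra_simps)
  then have *: "z / (1 + z) \<le> 1 - exp (- z)" using z by (simp add: field_simps)
  have "min 1 (2 * z) \<le> 4 * (z / (1 + z))"
  proof (cases "2 * z \<le> 1")
    case True
    then have "2 * z * (1 + z) \<le> 4 * z" using z mult_left_mono[of "2 * z" 1 z] by (simp add: algebra_simps)
    then show ?thesis using z True by (simp add: field_simps)
  qed (use z in \<open>simp add: field_simps\<close>)
  with * show ?thesis by (simp add: z_def)
qed

text \<open>A single term of the exponential series of |y|. It converts exponential moments into
  moments of every order.\<close>

lemma abs_power_le_exp_sum: "\<bar>y\<bar> ^ k \<le> fact k * (exp y + exp (- y))" for y :: real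
proof -
  have "\<bar>y\<bar> ^ k / fact k = (\<Sum>n\<in>{k}. \<bar>y\<bar> ^ n /\<^sub>R fact n)" by (simp add: divide_inverse mult.commute)
  also have "\<dots> \<le> (\<Sum>n. \<bar>y\<bar> ^ n /\<^sub>R fact n)"
    by (intro sum_le_suminf summable_exp_generic) auto
  also have "\<dots> = exp \<bar>y\<bar>" by (simp add: exp_def)
  also have "\<dots> \<le> exp y + exp (- y)" by (simp add: abs_if)
  finally show ?thesis by (simp add: field_simps)
qed

text \<open>The characteristic function of - X is the conjugate of that of X, and characteristic
  functions determine laws.\<close>

lemma char_real_symmetric:
  assumes "prob_space M" and [measurable]: "X \<in> borel_measurable M"
    and "\<And>t. Im (char (distr M borel X) t) = 0"
  shows "distr M borel (\<lambda>w. - X w) = distr M borel X"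
proof -
  interpret prob_space M by fact
  have "char (distr M borel (\<lambda>w. - X w)) t = char (distr M borel X) t" for t
  proof -
    have "char (distr M borel (\<lambda>w. - X w)) t = (\<integral>w. cnj (iexp (t * X w)) \<partial>M)"
      by (simp add: char_def integral_distr exp_cnj)
    also have "\<dots> = cnj (char (distr M borel X) t)"
      by (simp add: char_def integral_distr flip: integral_cnj)
    also have "\<dots> = char (distr M borel X) t"
      using assms(3)[of t] by (simp add: complex_eq_iff)
    finally show ?thesis .
  qed
  then show ?thesis
    by (intro Levy_uniqueness real_distribution_distr) (auto simp: fun_eq_iff)
qed

text \<open>A finite model of the driving processes: n stands for one process on one grid cell, D n
  for the increment and \<tau> n for the length of the cell. The length is the variance of a
  Gaussian increment and the scale in the exponent of a stable one.\<close>

locale noise = prob_space M for M :: "'w measure" +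
  fixes IG IL :: "'k set" and D :: "'k \<Rightarrow> 'w \<Rightarrow> real" and \<tau> \<beta> :: "'k \<Rightarrow> real"
  assumes finite: "finite IG" "finite IL" and disjoint: "IG \<inter> IL = {}"
    and indep: "indep_vars (\<lambda>_. borel) D (IG \<union> IL)"
    and \<tau>_pos: "\<And>n. n \<in> IG \<union> IL \<Longrightarrow> 0 < \<tau> n"
    and gaussian: "\<And>n. n \<in> IG \<Longrightarrow> distributed M lborel (D n) (normal_density 0 (sqrt (\<tau> n)))"
    and stable: "\<And>n \<theta>. n \<in> IL \<Longrightarrow> char (distr M borel (D n)) \<theta> = complex_of_real (exp (- (\<tau> n * \<bar>\<theta>\<bar> powr \<beta> n)))"
    and \<beta>: "\<And>n. n \<in> IL \<Longrightarrow> 0 < \<beta> n \<and> \<beta> n < 2"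
begin

definition lin :: "'k set \<Rightarrow> ('k \<Rightarrow> 'b::real_vector) \<Rightarrow> 'w \<Rightarrow> 'b" where
  "lin A c w = (\<Sum>n\<in>A. D n w *\<^sub>R c n)"

abbreviation "G \<equiv> lin IG"
abbreviation "L \<equiv> lin IL"
abbreviation "S \<equiv> lin (IG \<union> IL)"

lemma D_measurable [measurable]: "n \<in> IG \<union> IL \<Longrightarrow> D n \<in> borel_measurable M"
  using indep by (auto simp: indep_vars_def)

lemma lin_measurable [measurable]:
  fixes c :: "'k \<Rightarrow> 'b::euclidean_space"
  shows "A \<subseteq> IG \<union> IL \<Longrightarrow> lin A c \<in> borel_measurable M"
  unfolding lin_def[abs_def]
  by (intro borel_measurable_sum borel_measurable_scaleR D_measurable borel_measurable_const) auto

lemma G_measurable [measurable]: "G (c :: 'k \<Rightarrow> 'b::euclidean_space) \<in> borel_measurable M"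
  and L_measurable [measurable]: "L (c :: 'k \<Rightarrow> 'b::euclidean_space) \<in> borel_measurable M"
  and S_measurable [measurable]: "S (c :: 'k \<Rightarrow> 'b::euclidean_space) \<in> borel_measurable M"
  by (intro lin_measurable; simp)+

lemma S_eq: "S c w = G c w + L c w"
  unfolding lin_def using finite disjoint by (rule sum.union_disjoint)

lemma symmetric: "n \<in> IG \<union> IL \<Longrightarrow> distr M borel (\<lambda>w. - D n w) = distr M borel (D n)"
proof -
  assume n: "n \<in> IG \<union> IL"
  note [measurable] = D_measurable[OF n]
  show ?thesis
  proof (cases "n \<in> IG")
    case True
    have "distributed M lborel (\<lambda>w. 0 + (- 1) * D n w) (normal_density (0 + (- 1) * 0) (\<bar>- 1\<bar> * sqrt (\<tau> n)))"
      using gaussian[OF True] \<tau>_pos[OF n] by (intro normal_density_affine) auto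
    then have "distr M lborel (\<lambda>w. - D n w) = distr M lborel (D n)"
      using gaussian[OF True] by (simp add: distributed_def)
    then show ?thesis by (metis distr_cong sets_lborel)
  next
    case False
    then have "n \<in> IL" using n by auto
    then show ?thesis
      by (intro char_real_symmetric prob_space_axioms) (auto simp: stable)
  qed
qed

lemma nn_integral_exp_G:
  fixes c :: "'k \<Rightarrow> real"
  shows "(\<integral>\<^sup>+w. ennreal (exp (\<theta> * G c w)) \<partial>M) = ennreal (exp (\<theta>\<^sup>2 * (\<Sum>n\<in>IG. \<tau> n * (c n)\<^sup>2) / 2))"
proof -
  have ind: "indep_vars (\<lambda>_. borel) D IG" using indep by (rule indep_vars_subset) auto
  have "(\<integral>\<^sup>+w. ennreal (exp (\<theta> * G c w)) \<partial>M) = (\<integral>\<^sup>+w. (\<Prod>n\<in>IG. ennreal (exp ((\<theta> * c n) * D n w))) \<partial>M)"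
    using finite by (simp add: lin_def sum_distrib_left exp_sum prod_ennreal mult_ac)
  also have "\<dots> = (\<Prod>n\<in>IG. \<integral>\<^sup>+w. ennreal (exp ((\<theta> * c n) * D n w)) \<partial>M)"
    by (intro indep_vars_nn_integral indep_vars_compose2[OF ind] finite) auto
  also have "\<dots> = (\<Prod>n\<in>IG. ennreal (exp ((\<theta> * c n)\<^sup>2 * (sqrt (\<tau> n))\<^sup>2 / 2)))"
    using \<tau>_pos by (intro prod.cong refl nn_integral_exp_normal gaussian) auto
  also have "\<dots> = ennreal (\<Prod>n\<in>IG. exp ((\<theta> * c n)\<^sup>2 * (sqrt (\<tau> n))\<^sup>2 / 2))"
    by (simp add: prod_ennreal)
  also have "(\<Prod>n\<in>IG. exp ((\<theta> * c n)\<^sup>2 * (sqrt (\<tau> n))\<^sup>2 / 2)) = exp (\<Sum>n\<in>IG. \<theta>\<^sup>2 * (\<tau> n * (c n)\<^sup>2) / 2)"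
    using finite \<tau>_pos by (auto simp: exp_sum power_mult_distrib less_imp_le mult_ac intro!: prod.cong)
  also have "(\<Sum>n\<in>IG. \<theta>\<^sup>2 * (\<tau> n * (c n)\<^sup>2) / 2) = \<theta>\<^sup>2 * (\<Sum>n\<in>IG. \<tau> n * (c n)\<^sup>2) / 2"
    by (simp add: sum_distrib_left sum_divide_distrib)
  finally show ?thesis .
qed

lemma nn_integral_exp_G_le:
  fixes c :: "'k \<Rightarrow> real"
  assumes "(\<Sum>n\<in>IG. \<tau> n * (c n)\<^sup>2) \<le> v"
  shows "(\<integral>\<^sup>+w. ennreal (exp (\<theta> * G c w) + exp (- (\<theta> * G c w))) \<partial>M) \<le> ennreal (2 * exp (\<theta>\<^sup>2 * v / 2))"
proof -
  have b: "(\<integral>\<^sup>+w. ennreal (exp (t * G c w)) \<partial>M) \<le> ennreal (exp (\<theta>\<^sup>2 * v / 2))" if "t\<^sup>2 = \<theta>\<^sup>2" for t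
    unfolding nn_integral_exp_G using assms that by (auto intro!: mult_left_mono)
  have "(\<integral>\<^sup>+w. ennreal (exp (\<theta> * G c w) + exp (- (\<theta> * G c w))) \<partial>M)
      = (\<integral>\<^sup>+w. ennreal (exp (\<theta> * G c w)) \<partial>M) + (\<integral>\<^sup>+w. ennreal (exp ((- \<theta>) * G c w)) \<partial>M)"
    by (subst nn_integral_add[symmetric]) auto
  also have "\<dots> \<le> ennreal (exp (\<theta>\<^sup>2 * v / 2)) + ennreal (exp (\<theta>\<^sup>2 * v / 2))"
    by (intro add_mono b) auto
  finally show ?thesis by (simp flip: ennreal_plus)
qed

text \<open>The degenerate case, kept apart because \<open>gaussian_moment_le\<close> rescales by 1
  / sqrt v.\<close>

lemma G_eq_0:
  fixes c :: "'k \<Rightarrow> real"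
  assumes "(\<Sum>n\<in>IG. \<tau> n * (c n)\<^sup>2) \<le> 0"
  shows "G c w = 0"
proof -
  have "\<forall>n\<in>IG. \<tau> n * (c n)\<^sup>2 = 0"
  proof (subst sum_nonneg_eq_0_iff[symmetric])
    have "0 \<le> (\<Sum>n\<in>IG. \<tau> n * (c n)\<^sup>2)" using \<tau>_pos by (intro sum_nonneg) (auto simp: less_imp_le)
    with assms show "(\<Sum>n\<in>IG. \<tau> n * (c n)\<^sup>2) = 0" by simp
  qed (use finite \<tau>_pos in \<open>auto simp: less_imp_le\<close>)
  then have "\<forall>n\<in>IG. c n = 0" using \<tau>_pos by fastforce
  then show ?thesis by (simp add: lin_def)
qed

lemma gaussian_moment_le:
  fixes c :: "'k \<Rightarrow> real"
  assumes v: "(\<Sum>n\<in>IG. \<tau> n * (c n)\<^sup>2) \<le> v" "0 \<le> v" and m: "0 < m"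
  shows "(\<integral>\<^sup>+w. ennreal ((G c w) ^ (2 * m)) \<partial>M) \<le> ennreal (4 * fact (2 * m) * v ^ m)"
proof (cases "v = 0")
  case True
  then show ?thesis using G_eq_0[of c] v m by (simp add: power_0_left)
next
  case False
  then have v0: "0 < v" using v by simp
  \<comment> \<open>Normalises the variance bound to 1: the exponential moment is then at most 2 exp
    (1/2) <= 4, and v ^ m carries the scaling.\<close>
  define \<theta> where "\<theta> = 1 / sqrt v"
  have \<theta>: "\<theta>\<^sup>2 * v = 1" using v0 by (simp add: \<theta>_def power_divide)
  have pw: "y ^ (2 * m) = v ^ m * \<bar>\<theta> * y\<bar> ^ (2 * m)" for y
  proof -
    have "\<bar>\<theta> * y\<bar> ^ (2 * m) = (\<theta>\<^sup>2) ^ m * (y\<^sup>2) ^ m"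
      by (simp add: power_mult power_mult_distrib)
    then have "v ^ m * \<bar>\<theta> * y\<bar> ^ (2 * m) = (\<theta>\<^sup>2 * v) ^ m * (y\<^sup>2) ^ m" by (simp add: power_mult_distrib)
    then show ?thesis by (simp add: \<theta> power_mult)
  qed
  have "(\<integral>\<^sup>+w. ennreal ((G c w) ^ (2 * m)) \<partial>M)
      \<le> (\<integral>\<^sup>+w. ennreal (v ^ m * fact (2 * m)) * ennreal (exp (\<theta> * G c w) + exp (- (\<theta> * G c w))) \<partial>M)"
  proof (intro nn_integral_mono)
    fix w
    have "(G c w) ^ (2 * m) \<le> v ^ m * (fact (2 * m) * (exp (\<theta> * G c w) + exp (- (\<theta> * G c w))))"
      unfolding pw[of "G c w"] using v0 by (intro mult_left_mono abs_power_le_exp_sum) auto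
    then show "ennreal ((G c w) ^ (2 * m))
        \<le> ennreal (v ^ m * fact (2 * m)) * ennreal (exp (\<theta> * G c w) + exp (- (\<theta> * G c w)))"
      using v0 by (subst ennreal_mult[symmetric]) (auto simp: mult.assoc add_nonneg_nonneg intro!: ennreal_leI)
  qed
  also have "\<dots> = ennreal (v ^ m * fact (2 * m)) * (\<integral>\<^sup>+w. ennreal (exp (\<theta> * G c w) + exp (- (\<theta> * G c w))) \<partial>M)"
    by (intro nn_integral_cmult) simp
  also have "\<dots> \<le> ennreal (v ^ m * fact (2 * m)) * ennreal (2 * exp (\<theta>\<^sup>2 * v / 2))"
    by (intro mult_left_mono nn_integral_exp_G_le v) auto
  also have "\<dots> = ennreal (v ^ m * fact (2 * m) * (2 * exp (1 / 2)))"
    using v0 by (simp add: \<theta> flip: ennreal_mult)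
  also have "\<dots> \<le> ennreal (v ^ m * fact (2 * m) * 4)"
  proof -
    have "exp (1 / 2) \<le> (2 :: real)"
      using exp_bound_half[of "1/2::real"] by simp
    then show ?thesis using v0 by (intro ennreal_leI mult_left_mono) auto
  qed
  finally show ?thesis by (simp add: mult_ac)
qed

lemma gaussian_tail_le:
  fixes c :: "'k \<Rightarrow> real"
  assumes v: "(\<Sum>n\<in>IG. \<tau> n * (c n)\<^sup>2) \<le> v" "0 < v" and r: "0 \<le> r"
  shows "emeasure M {w \<in> space M. r \<le> \<bar>G c w\<bar>} \<le> ennreal (2 * exp (- (r\<^sup>2 / (2 * v))))"
proof -
  \<comment> \<open>Chernoff bound; this \<theta> minimises - \<theta> r + \<theta>^2 v / 2.\<close>
  define \<theta> where "\<theta> = r / v"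
  have "emeasure M {w \<in> space M. r \<le> \<bar>G c w\<bar>} = (\<integral>\<^sup>+w. indicator {w \<in> space M. r \<le> \<bar>G c w\<bar>} w \<partial>M)"
    by (intro nn_integral_indicator[symmetric]) measurable
  also have "\<dots> \<le> (\<integral>\<^sup>+w. ennreal (exp (- \<theta> * r)) * ennreal (exp (\<theta> * G c w) + exp (- (\<theta> * G c w))) \<partial>M)"
  proof (intro nn_integral_mono)
    fix w
    have "1 \<le> exp (- \<theta> * r) * (exp (\<theta> * G c w) + exp (- (\<theta> * G c w)))" if "r \<le> \<bar>G c w\<bar>"
    proof -
      have "\<theta> * r \<le> \<theta> * \<bar>G c w\<bar>" using that v r by (intro mult_left_mono) (auto simp: \<theta>_def)
      then have "exp (\<theta> * r) \<le> exp (\<theta> * \<bar>G c w\<bar>)" by simp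
      also have "\<dots> \<le> exp (\<theta> * G c w) + exp (- (\<theta> * G c w))" by (cases "0 \<le> G c w") auto
      finally show ?thesis by (simp add: exp_minus field_simps)
    qed
    then show "indicator {w \<in> space M. r \<le> \<bar>G c w\<bar>} w
        \<le> ennreal (exp (- \<theta> * r)) * ennreal (exp (\<theta> * G c w) + exp (- (\<theta> * G c w)))"
      by (auto simp: indicator_def add_nonneg_nonneg simp flip: ennreal_mult simp del: ennreal_plus)
  qed
  also have "\<dots> = ennreal (exp (- \<theta> * r)) * (\<integral>\<^sup>+w. ennreal (exp (\<theta> * G c w) + exp (- (\<theta> * G c w))) \<partial>M)"
    by (intro nn_integral_cmult) simp
  also have "\<dots> \<le> ennreal (exp (- \<theta> * r)) * ennreal (2 * exp (\<theta>\<^sup>2 * v / 2))"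
    by (intro mult_left_mono nn_integral_exp_G_le v) auto
  also have "\<dots> = ennreal (2 * exp (- \<theta> * r + \<theta>\<^sup>2 * v / 2))"
    by (simp flip: ennreal_mult add: mult_exp_exp)
  also have "- \<theta> * r + \<theta>\<^sup>2 * v / 2 = - (r\<^sup>2 / (2 * v))"
    using v by (simp add: \<theta>_def field_simps power2_eq_square)
  finally show ?thesis .
qed

text \<open>By \<open>min_sq_le_exp\<close> and Fubini it suffices to bound E (1 - cos (\<theta> L))
  for fixed \<theta> and to average over a standard normal \<theta>. The inner expectation is 1
  minus a characteristic function exp (- q), hence at most its exponent q. The constant 8 is 4 from
  \<open>min_sq_le_exp\<close> times E (1 + \<theta>^2) = 2.\<close>

lemma stable_le:
  fixes c :: "'k \<Rightarrow> real"
  shows "(\<integral>\<^sup>+w. ennreal (min 1 ((L c w)\<^sup>2)) \<partial>M) \<le> ennreal (8 * (\<Sum>n\<in>IL. \<tau> n * \<bar>c n\<bar> powr \<beta> n))"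
proof -
  let ?N = "std_normal_distribution"
  let ?b = "\<Sum>n\<in>IL. \<tau> n * \<bar>c n\<bar> powr \<beta> n"
  interpret N: real_distribution ?N by (rule real_dist_normal_dist)
  interpret P: pair_sigma_finite M ?N ..
  have b0: "0 \<le> ?b" using \<tau>_pos by (intro sum_nonneg) (auto simp: less_imp_le)
  have ind: "indep_vars (\<lambda>_. borel) D IL" using indep by (rule indep_vars_subset) auto
  have char_L: "char (distr M borel (L c)) \<theta> = complex_of_real (exp (- (\<Sum>n\<in>IL. \<tau> n * \<bar>\<theta> * c n\<bar> powr \<beta> n)))" for \<theta>
  proof -
    have "char (distr M borel (L c)) \<theta> = (\<Prod>n\<in>IL. char (distr M borel (\<lambda>w. D n w * c n)) \<theta>)"
      unfolding lin_def[abs_def] real_scaleR_def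
      by (intro char_distr_sum indep_vars_compose2[OF ind]) auto
    also have "\<dots> = (\<Prod>n\<in>IL. char (distr M borel (D n)) (\<theta> * c n))"
      by (intro prod.cong refl) (auto simp: char_def integral_distr mult_ac)
    also have "\<dots> = complex_of_real (\<Prod>n\<in>IL. exp (- (\<tau> n * \<bar>\<theta> * c n\<bar> powr \<beta> n)))"
      by (simp add: stable)
    also have "(\<Prod>n\<in>IL. exp (- (\<tau> n * \<bar>\<theta> * c n\<bar> powr \<beta> n))) = exp (\<Sum>n\<in>IL. - (\<tau> n * \<bar>\<theta> * c n\<bar> powr \<beta> n))"
      using finite by (simp add: exp_sum)
    finally show ?thesis by (simp add: sum_negf)
  qed
  have inner: "(\<integral>\<^sup>+w. ennreal (1 - cos (\<theta> * L c w)) \<partial>M) \<le> ennreal ?b * ennreal (1 + \<theta>\<^sup>2)" for \<theta>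
  proof -
    have "1 - exp (- (\<Sum>n\<in>IL. \<tau> n * \<bar>\<theta> * c n\<bar> powr \<beta> n)) \<le> (\<Sum>n\<in>IL. \<tau> n * \<bar>\<theta> * c n\<bar> powr \<beta> n)"
      using exp_ge_add_one_self[of "- (\<Sum>n\<in>IL. \<tau> n * \<bar>\<theta> * c n\<bar> powr \<beta> n)"] by simp
    also have "\<dots> \<le> (\<Sum>n\<in>IL. \<tau> n * \<bar>c n\<bar> powr \<beta> n * (1 + \<theta>\<^sup>2))"
    proof (intro sum_mono)
      fix n assume n: "n \<in> IL"
      \<comment> \<open>A majorant common to all indices in (0,2) and integrable against the normal
        law, so processes of different index are summed with one constant.\<close>
      have "\<bar>\<theta>\<bar> powr \<beta> n \<le> 1 + \<theta>\<^sup>2"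
      proof (cases "\<bar>\<theta>\<bar> \<le> 1")
        case True
        then have "\<bar>\<theta>\<bar> powr \<beta> n \<le> 1" using \<beta>[OF n] by (intro powr_le1) auto
        then show ?thesis by (smt (verit) zero_le_power2)
      next
        case False
        then have "\<bar>\<theta>\<bar> powr \<beta> n \<le> \<bar>\<theta>\<bar> powr 2" using \<beta>[OF n] by (intro powr_mono) auto
        then show ?thesis using False by simp
      qed
      then show "\<tau> n * \<bar>\<theta> * c n\<bar> powr \<beta> n \<le> \<tau> n * \<bar>c n\<bar> powr \<beta> n * (1 + \<theta>\<^sup>2)"
        using \<tau>_pos[of n] n mult_left_mono[of "\<bar>\<theta>\<bar> powr \<beta> n" "1 + \<theta>\<^sup>2" "\<tau> n * \<bar>c n\<bar> powr \<beta> n"]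
        by (simp add: abs_mult powr_mult mult_ac)
    qed
    finally have "1 - exp (- (\<Sum>n\<in>IL. \<tau> n * \<bar>\<theta> * c n\<bar> powr \<beta> n)) \<le> ?b * (1 + \<theta>\<^sup>2)"
      by (simp add: sum_distrib_right)
    then show ?thesis
      using b0 by (subst nn_integral_one_minus_cos) (auto simp: char_L simp flip: ennreal_mult intro!: ennreal_leI simp del: ennreal_plus)
  qed
  have "(\<integral>\<^sup>+w. ennreal (min 1 ((L c w)\<^sup>2)) \<partial>M) \<le> (\<integral>\<^sup>+w. 4 * ennreal (1 - exp (- ((L c w)\<^sup>2) / 2)) \<partial>M)"
  proof (intro nn_integral_mono)
    fix w
    have "ennreal (min 1 ((L c w)\<^sup>2)) \<le> ennreal (4 * (1 - exp (- ((L c w)\<^sup>2) / 2)))"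
      by (intro ennreal_leI min_sq_le_exp)
    also have "\<dots> = 4 * ennreal (1 - exp (- ((L c w)\<^sup>2) / 2))"
      by (subst ennreal_mult) auto
    finally show "ennreal (min 1 ((L c w)\<^sup>2)) \<le> 4 * ennreal (1 - exp (- ((L c w)\<^sup>2) / 2))" .
  qed
  also have "\<dots> = 4 * (\<integral>\<^sup>+w. ennreal (1 - exp (- ((L c w)\<^sup>2) / 2)) \<partial>M)"
    by (intro nn_integral_cmult) simp
  also have "(\<integral>\<^sup>+w. ennreal (1 - exp (- ((L c w)\<^sup>2) / 2)) \<partial>M) = (\<integral>\<^sup>+w. \<integral>\<^sup>+\<theta>. ennreal (1 - cos (\<theta> * L c w)) \<partial>?N \<partial>M)"
  proof (intro nn_integral_cong)
    fix w
    have "(\<integral>\<^sup>+\<theta>. ennreal (1 - cos (L c w * \<theta>)) \<partial>?N) = ennreal (1 - Re (char (distr ?N borel (\<lambda>x. x)) (L c w)))"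
      by (intro N.nn_integral_one_minus_cos) auto
    then show "ennreal (1 - exp (- ((L c w)\<^sup>2) / 2)) = (\<integral>\<^sup>+\<theta>. ennreal (1 - cos (\<theta> * L c w)) \<partial>?N)"
      by (simp only: real_distribution_distr_id[OF real_dist_normal_dist] char_std_normal_distribution Re_complex_of_real)
        (simp add: mult.commute)
  qed
  also have "\<dots> = (\<integral>\<^sup>+\<theta>. \<integral>\<^sup>+w. ennreal (1 - cos (\<theta> * L c w)) \<partial>M \<partial>?N)"
    by (rule P.Fubini'[symmetric]) simp
  also have "\<dots> \<le> (\<integral>\<^sup>+\<theta>. ennreal ?b * ennreal (1 + \<theta>\<^sup>2) \<partial>?N)"
    by (intro nn_integral_mono inner)
  also have "\<dots> = ennreal ?b * (\<integral>\<^sup>+\<theta>. ennreal (1 + \<theta>\<^sup>2) \<partial>?N)"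
    by (intro nn_integral_cmult) simp
  also have "(\<integral>\<^sup>+\<theta>. ennreal (1 + \<theta>\<^sup>2) \<partial>?N) = 2"
  proof -
    have "(\<integral>\<^sup>+\<theta>. ennreal (\<theta>\<^sup>2) \<partial>?N) = (\<integral>\<^sup>+\<theta>. ennreal (std_normal_density \<theta> * \<theta>\<^sup>2) \<partial>lborel)"
      by (subst nn_integral_density) (auto simp: ennreal_mult' intro!: nn_integral_cong)
    also have "\<dots> = ennreal (\<integral>\<theta>. std_normal_density \<theta> * \<theta> ^ (2 * 1) \<partial>lborel)"
      using integrable_std_normal_moment[of 2]
      by (subst nn_integral_eq_integral) auto
    also have "\<dots> = 1" by (subst integral_std_normal_moment_even) simp
    finally have "(\<integral>\<^sup>+\<theta>. ennreal (\<theta>\<^sup>2) \<partial>?N) = 1" .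
    moreover have "(\<integral>\<^sup>+\<theta>. ennreal (1 + \<theta>\<^sup>2) \<partial>?N) = (\<integral>\<^sup>+\<theta>. 1 \<partial>?N) + (\<integral>\<^sup>+\<theta>. ennreal (\<theta>\<^sup>2) \<partial>?N)"
      by (subst nn_integral_add[symmetric]) auto
    ultimately show ?thesis using N.emeasure_space_1 by simp
  qed
  finally have "(\<integral>\<^sup>+w. ennreal (min 1 ((L c w)\<^sup>2)) \<partial>M) \<le> 4 * (ennreal ?b * 2)" 
    by (simp add: mult_left_mono)
  also have "\<dots> = ennreal (8 * ?b)" using b0 
    by (simp flip: ennreal_numeral ennreal_mult)
  finally show ?thesis .
qed

end

section \<open>Elementary inequalities for norms and truncated squares\<close>

lemma norm_power_le_sum_component:
  fixes y :: "real ^ 'd"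
  shows "norm y ^ (2 * m) \<le> real CARD('d) ^ m * (\<Sum>l\<in>UNIV. (y $ l) ^ (2 * m))"
proof -
  have "Max (range (\<lambda>l. (y $ l)\<^sup>2)) \<in> range (\<lambda>l. (y $ l)\<^sup>2)" by (intro Max_in) auto
  then obtain k where "Max (range (\<lambda>l. (y $ l)\<^sup>2)) = (y $ k)\<^sup>2" by (rule imageE)
  then have k: "\<And>l. (y $ l)\<^sup>2 \<le> (y $ k)\<^sup>2" by (metis Max_ge finite finite_imageI rangeI)
  have "norm y ^ (2 * m) = (\<Sum>l\<in>UNIV. (y $ l)\<^sup>2) ^ m"
    by (simp add: power_mult norm_vec_def L2_set_def sum_nonneg)
  also have "\<dots> \<le> (real CARD('d) * (y $ k)\<^sup>2) ^ m"
    using sum_bounded_above[of UNIV "\<lambda>l. (y $ l)\<^sup>2" "(y $ k)\<^sup>2"] k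
    by (intro power_mono sum_nonneg) auto
  also have "\<dots> = real CARD('d) ^ m * (y $ k) ^ (2 * m)"
    by (simp add: power_mult power_mult_distrib)
  also have "\<dots> \<le> real CARD('d) ^ m * (\<Sum>l\<in>UNIV. (y $ l) ^ (2 * m))"
    by (intro mult_left_mono member_le_sum) (auto simp: power_mult)
  finally show ?thesis .
qed

lemma min_one_sum_le: "finite A \<Longrightarrow> (\<And>a. a \<in> A \<Longrightarrow> 0 \<le> z a) \<Longrightarrow> min 1 (\<Sum>a\<in>A. z a) \<le> (\<Sum>a\<in>A. min 1 (z a))"
  for z :: "'a \<Rightarrow> real"
proof (induction A rule: finite_induct)
  case (insert a A)
  then have "0 \<le> sum z A" by (intro sum_nonneg) auto
  moreover have "0 \<le> z a" using insert by simp
  moreover have "0 \<le> p \<Longrightarrow> 0 \<le> q \<Longrightarrow> min 1 (p + q) \<le> min 1 p + min 1 q" for p q :: real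
    by (auto simp: min_def)
  ultimately have "min 1 (z a + sum z A) \<le> min 1 (z a) + min 1 (sum z A)" by simp
  also have "min 1 (sum z A) \<le> (\<Sum>a\<in>A. min 1 (z a))" using insert by blast
  finally show ?case using insert by simp
qed simp

text \<open>Meant for a Gaussian and b stable: the Gaussian part has all moments, so the truncation
  is kept only where it is indispensable.\<close>

lemma min_one_norm_add_le: "min 1 ((norm (a + b))\<^sup>2) \<le> 2 * (norm a)\<^sup>2 + 2 * min 1 ((norm b)\<^sup>2)"
  for a b :: "'a::real_normed_vector"
proof -
  have "(norm (a + b))\<^sup>2 \<le> (norm a + norm b)\<^sup>2" by (intro power_mono norm_triangle_ineq) auto
  also have "\<dots> \<le> 2 * (norm a)\<^sup>2 + 2 * (norm b)\<^sup>2"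
    using sum_squares_bound[of "norm a" "norm b"] by (simp add: power2_sum)
  finally have "(norm (a + b))\<^sup>2 \<le> 2 * (norm a)\<^sup>2 + 2 * (norm b)\<^sup>2" .
  moreover have "0 \<le> p \<Longrightarrow> n \<le> 2 * p + 2 * q \<Longrightarrow> min 1 n \<le> 2 * p + 2 * min 1 q" for n p q :: real
    by (auto simp: min_def)
  ultimately show ?thesis by simp
qed

text \<open>Trades a first power for a truncated square: when the truncated square has expectation
  of order e^2, the right side has expectation of order e.\<close>

lemma min_two_le: "0 < e \<Longrightarrow> 0 \<le> r \<Longrightarrow> e \<le> 1 \<Longrightarrow> min 2 r \<le> 2 * (e + min 1 (r\<^sup>2) / e)" for e r :: real
proof -
  assume e: "0 < e" "0 \<le> r" "e \<le> 1"
  show ?thesis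
  proof (cases "r \<le> 1")
    case True
    then have "r\<^sup>2 \<le> 1" using e by (simp add: power_le_one)
    moreover have "r * e \<le> e * e + r * r"
    proof -
      have "0 \<le> r * e" using e by simp
      moreover have "2 * (r * e) \<le> r * r + e * e"
        using sum_squares_bound[of r e] by (simp add: power2_eq_square)
      ultimately show ?thesis by linarith
    qed
    ultimately have "r \<le> e + min 1 (r\<^sup>2) / e" using e by (simp add: field_simps power2_eq_square)
    moreover have "0 \<le> e + min 1 (r\<^sup>2) / e" using e by simp
    moreover have "0 \<le> q \<Longrightarrow> r \<le> q \<Longrightarrow> min 2 r \<le> 2 * q" for q by linarith
    ultimately show ?thesis by blast
  next
    case False
    then have "1 \<le> r\<^sup>2" using e by (simp add: one_le_power)
    moreover have "1 \<le> 1 / e" using e by simp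
    ultimately have "1 \<le> min 1 (r\<^sup>2) / e" by simp
    then have "1 \<le> e + min 1 (r\<^sup>2) / e" using e by (intro add_increasing) auto
    moreover have "min 2 r \<le> 2" by simp
    ultimately show ?thesis by argo
  qed
qed

lemma ennreal_product_expand:
  fixes a b c g u v :: ennreal
  shows "(a + c * b) * (v * g + v * u) = v * (a * g) + v * (a * u) + v * c * (g * b) + v * c * (b * u)"
  by (simp add: distrib_left distrib_right mult_ac add_ac)

text \<open>A factor d ^ m comes from \<open>norm_power_le_sum_component\<close>, one more d from
  the number of coordinates, and 4 (2m)! from \<open>gaussian_moment_le\<close>.\<close>

definition moment_const :: "real \<Rightarrow> nat \<Rightarrow> real" where
  "moment_const d m = d ^ Suc m * (4 * fact (2 * m))"

lemma moment_const_nonneg: "0 \<le> d \<Longrightarrow> 0 \<le> moment_const d m"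
  by (simp add: moment_const_def)

text \<open>The first four summands belong to the products Gaussian-Gaussian, Gaussian-stable,
  stable-Gaussian and stable-stable in the expansion of E |f (X)| min 1 |U|^2. The fifth is the
  Gaussian-Gaussian term of the product of the two expectations.\<close>

definition product_const :: "real \<Rightarrow> real \<Rightarrow> real \<Rightarrow> real \<Rightarrow> real \<Rightarrow> real" where
  "product_const d c C0 C1 R = 2 * C1 + 16 * d * c * C1 + 16 * C0 * d * c * c * moment_const d 1 * R
     + 16 * C0 * d * c + 2 * moment_const d 1 * c * C1"

section \<open>Vector-valued linear combinations, the product estimate and the covariance with the
  past\<close>

context noise
begin

text \<open>Stated coordinatewise because the bound by \<sigma> on the kernels is coordinatewise;
  passing to the norm in \<open>tail_G_le\<close> produces the d in the exponent.\<close>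

definition gauss_var_le :: "('k \<Rightarrow> real ^ 'd) \<Rightarrow> real \<Rightarrow> bool" where
  "gauss_var_le c v \<longleftrightarrow> (\<forall>l. (\<Sum>n\<in>IG. \<tau> n * (c n $ l)\<^sup>2) \<le> v)"

definition stable_scale_le :: "('k \<Rightarrow> real ^ 'd) \<Rightarrow> real \<Rightarrow> bool" where
  "stable_scale_le c b \<longleftrightarrow> (\<Sum>n\<in>IL. \<tau> n * norm (c n) powr \<beta> n) \<le> b"

lemma lin_component: "lin A c w $ l = lin A (\<lambda>n. c n $ l) w" for c :: "'k \<Rightarrow> real ^ 'd"
  by (simp add: lin_def)

lemma gauss_var_le_nonneg:
  assumes "gauss_var_le c v" shows "0 \<le> v"
proof -
  fix l
  have "0 \<le> (\<Sum>n\<in>IG. \<tau> n * (c n $ l)\<^sup>2)"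
    using \<tau>_pos by (intro sum_nonneg) (auto simp: less_imp_le)
  also have "\<dots> \<le> v" using assms by (simp add: gauss_var_le_def)
  finally show ?thesis .
qed

lemma stable_scale_le_nonneg:
  assumes "stable_scale_le c b" shows "0 \<le> b"
proof -
  have "0 \<le> (\<Sum>n\<in>IL. \<tau> n * norm (c n) powr \<beta> n)"
    using \<tau>_pos by (intro sum_nonneg) (auto simp: less_imp_le)
  also have "\<dots> \<le> b" using assms by (simp add: stable_scale_le_def)
  finally show ?thesis .
qed

lemma gauss_var_le_mono: "gauss_var_le c v \<Longrightarrow> v \<le> v' \<Longrightarrow> gauss_var_le c v'"
  unfolding gauss_var_le_def using order_trans by blast

lemma stable_scale_le_mono: "stable_scale_le c b \<Longrightarrow> b \<le> b' \<Longrightarrow> stable_scale_le c b'"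
  unfolding stable_scale_le_def by (rule order_trans)

lemma moment_G_le:
  fixes c :: "'k \<Rightarrow> real ^ 'd"
  assumes c: "gauss_var_le c v" and m: "0 < m"
  shows "(\<integral>\<^sup>+w. ennreal (norm (G c w) ^ (2 * m)) \<partial>M) \<le> ennreal (moment_const (real CARD('d)) m * v ^ m)"
proof -
  let ?d = "real CARD('d)"
  have v: "0 \<le> v" using gauss_var_le_nonneg[OF c] .
  have "(\<integral>\<^sup>+w. ennreal (norm (G c w) ^ (2 * m)) \<partial>M)
      \<le> (\<integral>\<^sup>+w. ennreal (?d ^ m) * (\<Sum>l\<in>UNIV. ennreal ((G (\<lambda>n. c n $ l) w) ^ (2 * m))) \<partial>M)"
  proof (intro nn_integral_mono)
    fix w
    have "ennreal (norm (G c w) ^ (2 * m)) \<le> ennreal (?d ^ m * (\<Sum>l\<in>UNIV. (G c w $ l) ^ (2 * m)))"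
      by (intro ennreal_leI norm_power_le_sum_component)
    also have "\<dots> = ennreal (?d ^ m) * (\<Sum>l\<in>UNIV. ennreal ((G (\<lambda>n. c n $ l) w) ^ (2 * m)))"
      by (subst ennreal_mult) (auto simp: lin_component power_mult intro!: sum_nonneg)
    finally show "ennreal (norm (G c w) ^ (2 * m)) \<le> \<dots>" .
  qed
  also have "\<dots> = ennreal (?d ^ m) * (\<Sum>l\<in>UNIV. \<integral>\<^sup>+w. ennreal ((G (\<lambda>n. c n $ l) w) ^ (2 * m)) \<partial>M)"
    by (subst nn_integral_cmult, measurable, subst nn_integral_sum) auto
  also have "\<dots> \<le> ennreal (?d ^ m) * (\<Sum>l\<in>(UNIV :: 'd set). ennreal (4 * fact (2 * m) * v ^ m))"
    using c v m by (intro mult_left_mono sum_mono gaussian_moment_le) (auto simp: gauss_var_le_def)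
  also have "\<dots> = ennreal (moment_const ?d m * v ^ m)"
    using v by (subst sum_ennreal) (simp_all add: moment_const_def mult_ac flip: ennreal_mult)
  finally show ?thesis .
qed

lemma tail_G_le:
  fixes c :: "'k \<Rightarrow> real ^ 'd"
  assumes c: "gauss_var_le c v" and r: "0 \<le> r"
  shows "emeasure M {w \<in> space M. r \<le> norm (G c w)}
    \<le> ennreal (2 * real CARD('d) * exp (- (r\<^sup>2 / (2 * real CARD('d) * v))))"
proof (cases "v = 0")
  \<comment> \<open>For v = 0 the quotient in the exponent is 0 by the convention on division, so
    the claim reduces to 1 <= 2 d.\<close>
  case True
  have "emeasure M {w \<in> space M. r \<le> norm (G c w)} \<le> ennreal 1"
    by (simp add: emeasure_le_1)
  also have "\<dots> \<le> ennreal (2 * real CARD('d))"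
    using zero_less_card_finite[where 'a='d] by (intro ennreal_leI) linarith
  finally show ?thesis using True by simp
next
  case False
  let ?d = "real CARD('d)"
  have v: "0 < v" using gauss_var_le_nonneg[OF c] False by simp
  \<comment> \<open>A vector of norm at least r has a coordinate of modulus at least r / sqrt d. The
    union bound over coordinates gives the prefactor 2 d.\<close>
  define q where "q = r / sqrt ?d"
  have q: "0 \<le> q" "q\<^sup>2 = r\<^sup>2 / ?d" using r by (auto simp: q_def power_divide)
  have sub: "{w \<in> space M. r \<le> norm (G c w)} \<subseteq> (\<Union>l. {w \<in> space M. q \<le> \<bar>G (\<lambda>n. c n $ l) w\<bar>})"
  proof safe
    fix w assume w: "w \<in> space M" "r \<le> norm (G c w)"
    have "\<exists>l. q \<le> \<bar>G c w $ l\<bar>"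
    proof (rule ccontr)
      assume "\<nexists>l. q \<le> \<bar>G c w $ l\<bar>"
      then have "\<And>l. (G c w $ l)\<^sup>2 < q\<^sup>2"
        by (metis abs_ge_zero not_le power2_abs power_strict_mono zero_less_numeral)
      then have "(\<Sum>l\<in>UNIV. (G c w $ l)\<^sup>2) < (\<Sum>l\<in>(UNIV :: 'd set). q\<^sup>2)" by (intro sum_strict_mono) auto
      then have "(norm (G c w))\<^sup>2 < r\<^sup>2"
        by (simp add: norm_vec_def L2_set_def sum_nonneg q)
      then show False using w r by (simp add: power2_less_imp_less not_less[symmetric])
    qed
    then show "w \<in> (\<Union>l. {w \<in> space M. q \<le> \<bar>G (\<lambda>n. c n $ l) w\<bar>})"
      using w by (simp add: lin_component)
  qed
  have "emeasure M {w \<in> space M. r \<le> norm (G c w)} \<le> emeasure M (\<Union>l. {w \<in> space M. q \<le> \<bar>G (\<lambda>n. c n $ l) w\<bar>})"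
    by (intro emeasure_mono sub) measurable
  also have "\<dots> \<le> (\<Sum>l\<in>UNIV. emeasure M {w \<in> space M. q \<le> \<bar>G (\<lambda>n. c n $ l) w\<bar>})"
    by (intro emeasure_subadditive_finite) auto
  also have "\<dots> \<le> (\<Sum>l\<in>(UNIV :: 'd set). ennreal (2 * exp (- (q\<^sup>2 / (2 * v)))))"
    using c v q by (intro sum_mono gaussian_tail_le) (auto simp: gauss_var_le_def)
  also have "\<dots> = ennreal (2 * ?d * exp (- (r\<^sup>2 / (2 * ?d * v))))"
    by (subst sum_ennreal) (simp_all add: q mult_ac)
  finally show ?thesis .
qed

lemma min_L_le:
  fixes c :: "'k \<Rightarrow> real ^ 'd"
  assumes c: "stable_scale_le c b"
  shows "(\<integral>\<^sup>+w. ennreal (min 1 ((norm (L c w))\<^sup>2)) \<partial>M) \<le> ennreal (8 * real CARD('d) * b)"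
proof -
  have b: "0 \<le> b" using stable_scale_le_nonneg[OF c] .
  have "(\<integral>\<^sup>+w. ennreal (min 1 ((norm (L c w))\<^sup>2)) \<partial>M)
      \<le> (\<integral>\<^sup>+w. (\<Sum>l\<in>UNIV. ennreal (min 1 ((L (\<lambda>n. c n $ l) w)\<^sup>2))) \<partial>M)"
  proof (intro nn_integral_mono)
    fix w
    have "min 1 ((norm (L c w))\<^sup>2) = min 1 (\<Sum>l\<in>UNIV. (L c w $ l)\<^sup>2)"
      by (simp add: norm_vec_def L2_set_def sum_nonneg)
    also have "\<dots> \<le> (\<Sum>l\<in>UNIV. min 1 ((L c w $ l)\<^sup>2))"
      by (intro min_one_sum_le) auto
    finally show "ennreal (min 1 ((norm (L c w))\<^sup>2)) \<le> (\<Sum>l\<in>UNIV. ennreal (min 1 ((L (\<lambda>n. c n $ l) w)\<^sup>2)))"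
      by (simp add: lin_component ennreal_leI)
  qed
  also have "\<dots> = (\<Sum>l\<in>UNIV. \<integral>\<^sup>+w. ennreal (min 1 ((L (\<lambda>n. c n $ l) w)\<^sup>2)) \<partial>M)"
    by (subst nn_integral_sum) auto
  also have "\<dots> \<le> (\<Sum>l\<in>(UNIV :: 'd set). ennreal (8 * b))"
  proof (intro sum_mono order_trans[OF stable_le] ennreal_leI mult_left_mono)
    fix l
    have "(\<Sum>n\<in>IL. \<tau> n * \<bar>c n $ l\<bar> powr \<beta> n) \<le> (\<Sum>n\<in>IL. \<tau> n * norm (c n) powr \<beta> n)"
      using \<tau>_pos \<beta>
      by (intro sum_mono mult_left_mono powr_mono2 component_le_norm_cart) (auto simp: less_imp_le)
    then show "(\<Sum>n\<in>IL. \<tau> n * \<bar>c n $ l\<bar> powr \<beta> n) \<le> b" using c by (simp add: stable_scale_le_def)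
  qed simp
  also have "\<dots> = ennreal (8 * real CARD('d) * b)"
    using b by (subst sum_ennreal) (simp_all add: mult_ac)
  finally show ?thesis .
qed

lemma min_S_le:
  fixes c :: "'k \<Rightarrow> real ^ 'd"
  assumes "gauss_var_le c v" "stable_scale_le c b"
  shows "(\<integral>\<^sup>+w. ennreal (min 1 ((norm (S c w))\<^sup>2)) \<partial>M)
    \<le> ennreal (2 * moment_const (real CARD('d)) 1 * v + 16 * real CARD('d) * b)"
proof -
  have v: "0 \<le> v" using assms gauss_var_le_nonneg by blast
  have b: "0 \<le> b" using assms stable_scale_le_nonneg by blast
  have "(\<integral>\<^sup>+w. ennreal (min 1 ((norm (S c w))\<^sup>2)) \<partial>M)
      \<le> (\<integral>\<^sup>+w. ennreal 2 * ennreal (norm (G c w) ^ (2 * 1)) + ennreal 2 * ennreal (min 1 ((norm (L c w))\<^sup>2)) \<partial>M)"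
    by (intro nn_integral_mono)
      (auto simp: S_eq min_one_norm_add_le intro!: ennreal_leI simp flip: ennreal_mult ennreal_plus simp del: ennreal_numeral)
  also have "\<dots> = ennreal 2 * (\<integral>\<^sup>+w. ennreal (norm (G c w) ^ (2 * 1)) \<partial>M)
      + ennreal 2 * (\<integral>\<^sup>+w. ennreal (min 1 ((norm (L c w))\<^sup>2)) \<partial>M)"
    by (simp add: nn_integral_add nn_integral_cmult)
  also have "\<dots> \<le> ennreal 2 * ennreal (moment_const (real CARD('d)) 1 * v ^ 1) + ennreal 2 * ennreal (8 * real CARD('d) * b)"
    by (intro add_mono mult_left_mono moment_G_le min_L_le assms) auto
  also have "\<dots> = ennreal (2 * moment_const (real CARD('d)) 1 * v + 16 * real CARD('d) * b)"
    using v b moment_const_nonneg[of "real CARD('d)" 1]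
    by (simp add: mult.assoc flip: ennreal_mult ennreal_plus del: ennreal_numeral)
  finally show ?thesis .
qed

lemma indep_var_lin:
  fixes x y :: "'k \<Rightarrow> 'b::euclidean_space"
  assumes "A \<inter> B = {}" "A \<subseteq> IG \<union> IL" "B \<subseteq> IG \<union> IL"
  shows "indep_var borel (lin A x) borel (lin B y)"
proof -
  have meas: "(\<lambda>w. \<Sum>n\<in>C. w n *\<^sub>R z n) \<in> borel_measurable (Pi\<^sub>M C (\<lambda>_. borel :: real measure))" for C and z :: "'k \<Rightarrow> 'b"
    by (intro borel_measurable_sum borel_measurable_scaleR) auto
  have "indep_var borel ((\<lambda>w. \<Sum>n\<in>A. w n *\<^sub>R x n) \<circ> (\<lambda>w. restrict (\<lambda>n. D n w) A))
      borel ((\<lambda>w. \<Sum>n\<in>B. w n *\<^sub>R y n) \<circ> (\<lambda>w. restrict (\<lambda>n. D n w) B))"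
    by (intro indep_var_compose[OF indep_var_restrict[OF indep]] assms meas)
  moreover have "(\<lambda>w. \<Sum>n\<in>C. w n *\<^sub>R z n) \<circ> (\<lambda>w. restrict (\<lambda>n. D n w) C) = lin C z" for C and z :: "'k \<Rightarrow> 'b"
    by (auto simp: lin_def fun_eq_iff)
  ultimately show ?thesis by simp
qed

lemma nn_integral_G_L:
  fixes x y :: "'k \<Rightarrow> 'b::euclidean_space"
  assumes "f \<in> borel_measurable borel" "g \<in> borel_measurable borel"
  shows "(\<integral>\<^sup>+w. f (G x w) * g (L y w) \<partial>M) = (\<integral>\<^sup>+w. f (G x w) \<partial>M) * (\<integral>\<^sup>+w. g (L y w) \<partial>M)"
  using disjoint assms by (intro indep_var_nn_integral[OF indep_var_lin]) auto

text \<open>S x and S u are built from the same noise, so the expectation does not factor. Both are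
  split into Gaussian and stable parts. The Gaussian-Gaussian term is left to the hypothesis I1,
  where the choice of \<Phi> decides what T is; the mixed terms factor because G and L are
  independent. Here \<kappa> measures how small u is relative to x, and each term must retain
  exactly one factor \<kappa>.\<close>

lemma product_estimate:
  fixes x u :: "'k \<Rightarrow> real ^ 'd" and f \<Phi> :: "real ^ 'd \<Rightarrow> real"
  assumes [measurable]: "f \<in> borel_measurable borel" "\<Phi> \<in> borel_measurable borel"
    and \<Phi>: "\<And>y. 0 \<le> \<Phi> y" and C0: "0 \<le> C0"
    and split: "\<And>y z. \<bar>f (y + z)\<bar> \<le> \<Phi> y + C0 * min 1 ((norm z)\<^sup>2)"
    and bounds: "gauss_var_le u (c * \<kappa> * A)" "stable_scale_le x (c * B)" "stable_scale_le u (c * \<kappa> * B)"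
    and nonneg: "0 \<le> A" "A \<le> R" "0 \<le> B" "0 \<le> c" "0 \<le> \<kappa>" "0 \<le> T"
    and I1: "(\<integral>\<^sup>+w. ennreal (\<Phi> (G x w) * (norm (G u w))\<^sup>2) \<partial>M) \<le> ennreal (C1 * \<kappa> * T)"
    and I2: "(\<integral>\<^sup>+w. ennreal (\<Phi> (G x w)) \<partial>M) \<le> ennreal p" "0 \<le> p" "p \<le> C1" "p * A \<le> C1 * T"
  defines "Q \<equiv> product_const (real CARD('d)) c C0 C1 R"
  shows "(\<integral>\<^sup>+w. ennreal (\<bar>f (S x w)\<bar> * min 1 ((norm (S u w))\<^sup>2)) \<partial>M) \<le> ennreal (Q * \<kappa> * (T + B))"
    and "(\<integral>\<^sup>+w. ennreal \<bar>f (S x w)\<bar> \<partial>M) * (\<integral>\<^sup>+w. ennreal (min 1 ((norm (S u w))\<^sup>2)) \<partial>M)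
      \<le> ennreal (Q * \<kappa> * (T + B))"
proof -
  let ?d = "real CARD('d)"
  let ?K = "moment_const ?d 1"
  let ?\<Phi> = "\<lambda>w. ennreal (\<Phi> (G x w))" and ?g = "\<lambda>w. ennreal ((norm (G u w))\<^sup>2)"
    and ?x = "\<lambda>w. ennreal (min 1 ((norm (L x w))\<^sup>2))" and ?u = "\<lambda>w. ennreal (min 1 ((norm (L u w))\<^sup>2))"
  have K: "0 \<le> ?K" by (simp add: moment_const_nonneg)
  have C1: "0 \<le> C1" using I2 by simp
  have R: "0 \<le> R" using nonneg by simp
  have eg: "(\<integral>\<^sup>+w. ?g w \<partial>M) \<le> ennreal (?K * (c * \<kappa> * A))"
    using moment_G_le[OF bounds(1), of 1] by simp
  have ex: "(\<integral>\<^sup>+w. ?x w \<partial>M) \<le> ennreal (8 * ?d * (c * B))" by (rule min_L_le) fact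
  have ex1: "(\<integral>\<^sup>+w. ?x w \<partial>M) \<le> ennreal 1"
  proof -
    have "(\<integral>\<^sup>+w. ?x w \<partial>M) \<le> (\<integral>\<^sup>+w. 1 \<partial>M)" by (intro nn_integral_mono) simp
    then show ?thesis by (simp add: emeasure_space_1)
  qed
  have eu: "(\<integral>\<^sup>+w. ?u w \<partial>M) \<le> ennreal (8 * ?d * (c * \<kappa> * B))" by (rule min_L_le) fact
  have \<Phi>u: "(\<integral>\<^sup>+w. ?\<Phi> w * ?u w \<partial>M) = (\<integral>\<^sup>+w. ?\<Phi> w \<partial>M) * (\<integral>\<^sup>+w. ?u w \<partial>M)"
    by (rule nn_integral_G_L[of "\<lambda>y. ennreal (\<Phi> y)" "\<lambda>y. ennreal (min 1 ((norm y)\<^sup>2))"]) auto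
  have gx: "(\<integral>\<^sup>+w. ?g w * ?x w \<partial>M) = (\<integral>\<^sup>+w. ?g w \<partial>M) * (\<integral>\<^sup>+w. ?x w \<partial>M)"
    by (rule nn_integral_G_L[of "\<lambda>y. ennreal ((norm y)\<^sup>2)" "\<lambda>y. ennreal (min 1 ((norm y)\<^sup>2))"]) auto
  have fx: "\<bar>f (S x w)\<bar> \<le> \<Phi> (G x w) + C0 * min 1 ((norm (L x w))\<^sup>2)" for w
    unfolding S_eq by (rule split)
  have su: "min 1 ((norm (S u w))\<^sup>2) \<le> 2 * (norm (G u w))\<^sup>2 + 2 * min 1 ((norm (L u w))\<^sup>2)" for w
    unfolding S_eq by (rule min_one_norm_add_le)

  have "(\<integral>\<^sup>+w. ennreal (\<bar>f (S x w)\<bar> * min 1 ((norm (S u w))\<^sup>2)) \<partial>M)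
      \<le> (\<integral>\<^sup>+w. ennreal 2 * ennreal (\<Phi> (G x w) * (norm (G u w))\<^sup>2) + ennreal 2 * (?\<Phi> w * ?u w)
          + ennreal (2 * C0) * (?g w * ?x w) + ennreal (2 * C0) * ?u w \<partial>M)"
  proof (intro nn_integral_mono)
    fix w
    let ?p = "\<Phi> (G x w)" and ?q = "(norm (G u w))\<^sup>2" and ?r = "min 1 ((norm (L x w))\<^sup>2)" and ?s = "min 1 ((norm (L u w))\<^sup>2)"
    have "\<bar>f (S x w)\<bar> * min 1 ((norm (S u w))\<^sup>2) \<le> (?p + C0 * ?r) * (2 * ?q + 2 * ?s)"
      using fx su \<Phi> C0 by (intro mult_mono) auto
    also have "\<dots> = 2 * (?p * ?q) + 2 * (?p * ?s) + (2 * C0) * (?q * ?r) + (2 * C0) * (?r * ?s)"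
      by (simp only: algebra_simps)
    \<comment> \<open>L x and L u are dependent, so in the stable-stable term the truncated square
      of L x is replaced by 1. The remaining factor already supplies \<kappa> B.\<close>
    also have "\<dots> \<le> 2 * (?p * ?q) + 2 * (?p * ?s) + (2 * C0) * (?q * ?r) + (2 * C0) * ?s"
      using C0 by (intro add_left_mono mult_left_mono mult_left_le_one_le) auto
    finally have "ennreal (\<bar>f (S x w)\<bar> * min 1 ((norm (S u w))\<^sup>2)) \<le> ennreal \<dots>" by (rule ennreal_leI)
    also have "\<dots> = ennreal 2 * ennreal (?p * ?q) + ennreal 2 * (ennreal ?p * ennreal ?s)
        + ennreal (2 * C0) * (ennreal ?q * ennreal ?r) + ennreal (2 * C0) * ennreal ?s"
      using \<Phi>[of "G x w"] C0
      by (simp only: ennreal_plus[symmetric] ennreal_mult[symmetric] mult_nonneg_nonneg add_nonneg_nonneg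
          zero_le_numeral zero_le_power2 min.boundedI zero_le_one)
    finally show "ennreal (\<bar>f (S x w)\<bar> * min 1 ((norm (S u w))\<^sup>2)) \<le> \<dots>" .
  qed
  also have "\<dots> = ennreal 2 * (\<integral>\<^sup>+w. ennreal (\<Phi> (G x w) * (norm (G u w))\<^sup>2) \<partial>M)
      + ennreal 2 * ((\<integral>\<^sup>+w. ?\<Phi> w \<partial>M) * (\<integral>\<^sup>+w. ?u w \<partial>M))
      + ennreal (2 * C0) * ((\<integral>\<^sup>+w. ?g w \<partial>M) * (\<integral>\<^sup>+w. ?x w \<partial>M)) + ennreal (2 * C0) * (\<integral>\<^sup>+w. ?u w \<partial>M)"
    by (simp add: nn_integral_add nn_integral_cmult \<Phi>u gx del: ennreal_numeral)
  also have "\<dots> \<le> ennreal 2 * ennreal (C1 * \<kappa> * T) + ennreal 2 * (ennreal p * ennreal (8 * ?d * (c * \<kappa> * B)))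
      + ennreal (2 * C0) * (ennreal (?K * (c * \<kappa> * A)) * ennreal (8 * ?d * (c * B))) + ennreal (2 * C0) * ennreal (8 * ?d * (c * \<kappa> * B))"
    by (intro add_mono mult_mono I1 I2 eu ex eg order_refl) auto
  also have "\<dots> = ennreal (2 * (C1 * \<kappa> * T) + 2 * (p * (8 * ?d * (c * \<kappa> * B)))
      + (2 * C0) * ((?K * (c * \<kappa> * A)) * (8 * ?d * (c * B))) + (2 * C0) * (8 * ?d * (c * \<kappa> * B)))"
    using C0 C1 K I2 nonneg
    by (simp only: ennreal_plus[symmetric] ennreal_mult[symmetric] mult_nonneg_nonneg add_nonneg_nonneg
        zero_le_numeral of_nat_0_le_iff)
  also have "\<dots> \<le> ennreal (Q * \<kappa> * (T + B))"
  proof (intro ennreal_leI)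
    have p1: "p * (16 * ?d * c * \<kappa> * B) \<le> C1 * (16 * ?d * c * \<kappa> * B)" using nonneg I2 by (intro mult_right_mono) auto
    have p2: "A * (16 * C0 * ?K * c * \<kappa> * ?d * c * B) \<le> R * (16 * C0 * ?K * c * \<kappa> * ?d * c * B)"
      using nonneg C0 K by (intro mult_right_mono) auto
    have "0 \<le> 2 * (C1 * \<kappa> * B)" "0 \<le> 16 * ?d * c * C1 * \<kappa> * T" "0 \<le> 16 * C0 * ?d * c * c * ?K * R * \<kappa> * T"
      "0 \<le> 16 * C0 * ?d * c * \<kappa> * T" "0 \<le> 2 * ?K * c * C1 * \<kappa> * (T + B)"
      using nonneg C0 C1 K R by auto
    with p1 p2 show "2 * (C1 * \<kappa> * T) + 2 * (p * (8 * ?d * (c * \<kappa> * B)))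
      + (2 * C0) * ((?K * (c * \<kappa> * A)) * (8 * ?d * (c * B))) + (2 * C0) * (8 * ?d * (c * \<kappa> * B)) \<le> Q * \<kappa> * (T + B)"
      unfolding Q_def product_const_def by (simp add: algebra_simps)
  qed
  finally show "(\<integral>\<^sup>+w. ennreal (\<bar>f (S x w)\<bar> * min 1 ((norm (S u w))\<^sup>2)) \<partial>M) \<le> ennreal (Q * \<kappa> * (T + B))" .

  have "(\<integral>\<^sup>+w. ennreal \<bar>f (S x w)\<bar> \<partial>M) \<le> (\<integral>\<^sup>+w. ?\<Phi> w + ennreal C0 * ?x w \<partial>M)"
    using \<Phi> C0 fx by (intro nn_integral_mono)
      (simp add: ennreal_leI flip: ennreal_plus ennreal_mult)
  also have "\<dots> = (\<integral>\<^sup>+w. ?\<Phi> w \<partial>M) + ennreal C0 * (\<integral>\<^sup>+w. ?x w \<partial>M)"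
    by (simp add: nn_integral_add nn_integral_cmult)
  finally have efx: "(\<integral>\<^sup>+w. ennreal \<bar>f (S x w)\<bar> \<partial>M) \<le> \<dots>" .
  have "(\<integral>\<^sup>+w. ennreal (min 1 ((norm (S u w))\<^sup>2)) \<partial>M) \<le> (\<integral>\<^sup>+w. ennreal 2 * ?g w + ennreal 2 * ?u w \<partial>M)"
    using su by (intro nn_integral_mono)
      (simp add: ennreal_leI flip: ennreal_plus ennreal_mult del: ennreal_numeral)
  also have "\<dots> = ennreal 2 * (\<integral>\<^sup>+w. ?g w \<partial>M) + ennreal 2 * (\<integral>\<^sup>+w. ?u w \<partial>M)"
    by (simp add: nn_integral_add nn_integral_cmult del: ennreal_numeral)
  finally have "(\<integral>\<^sup>+w. ennreal \<bar>f (S x w)\<bar> \<partial>M) * (\<integral>\<^sup>+w. ennreal (min 1 ((norm (S u w))\<^sup>2)) \<partial>M)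
    \<le> ((\<integral>\<^sup>+w. ?\<Phi> w \<partial>M) + ennreal C0 * (\<integral>\<^sup>+w. ?x w \<partial>M)) * (ennreal 2 * (\<integral>\<^sup>+w. ?g w \<partial>M) + ennreal 2 * (\<integral>\<^sup>+w. ?u w \<partial>M))"
    using efx by (intro mult_mono) auto
  also have "\<dots> = ennreal 2 * ((\<integral>\<^sup>+w. ?\<Phi> w \<partial>M) * (\<integral>\<^sup>+w. ?g w \<partial>M)) + ennreal 2 * ((\<integral>\<^sup>+w. ?\<Phi> w \<partial>M) * (\<integral>\<^sup>+w. ?u w \<partial>M))
      + ennreal 2 * ennreal C0 * ((\<integral>\<^sup>+w. ?g w \<partial>M) * (\<integral>\<^sup>+w. ?x w \<partial>M)) + ennreal 2 * ennreal C0 * ((\<integral>\<^sup>+w. ?x w \<partial>M) * (\<integral>\<^sup>+w. ?u w \<partial>M))"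
    by (rule ennreal_product_expand)
  also have "\<dots> \<le> ennreal 2 * (ennreal p * ennreal (?K * (c * \<kappa> * A))) + ennreal 2 * (ennreal p * ennreal (8 * ?d * (c * \<kappa> * B)))
      + ennreal 2 * ennreal C0 * (ennreal (?K * (c * \<kappa> * A)) * ennreal (8 * ?d * (c * B))) + ennreal 2 * ennreal C0 * (ennreal 1 * ennreal (8 * ?d * (c * \<kappa> * B)))"
    by (intro add_mono mult_mono I2 eu ex ex1 eg order_refl) auto
  also have "\<dots> = ennreal (2 * (p * (?K * (c * \<kappa> * A))) + 2 * (p * (8 * ?d * (c * \<kappa> * B)))
      + 2 * C0 * ((?K * (c * \<kappa> * A)) * (8 * ?d * (c * B))) + 2 * C0 * (1 * (8 * ?d * (c * \<kappa> * B))))"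
    using C0 C1 K I2 nonneg
    by (simp only: ennreal_plus[symmetric] ennreal_mult[symmetric] mult_nonneg_nonneg add_nonneg_nonneg
        zero_le_numeral of_nat_0_le_iff zero_le_one)
  also have "\<dots> \<le> ennreal (Q * \<kappa> * (T + B))"
  proof (intro ennreal_leI)
    have p1: "p * (16 * ?d * c * \<kappa> * B) \<le> C1 * (16 * ?d * c * \<kappa> * B)" using nonneg I2 by (intro mult_right_mono) auto
    have p2: "A * (16 * C0 * ?K * c * \<kappa> * ?d * c * B) \<le> R * (16 * C0 * ?K * c * \<kappa> * ?d * c * B)"
      using nonneg C0 K by (intro mult_right_mono) auto
    have p3: "(2 * ?K * c * \<kappa>) * (p * A) \<le> (2 * ?K * c * \<kappa>) * (C1 * T)"
      using nonneg I2 K by (intro mult_left_mono) auto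
    have "0 \<le> 2 * (C1 * \<kappa> * (B + T))" "0 \<le> 16 * ?d * c * C1 * \<kappa> * T" "0 \<le> 16 * C0 * ?d * c * c * ?K * R * \<kappa> * T"
      "0 \<le> 16 * C0 * ?d * c * \<kappa> * T" "0 \<le> 2 * ?K * c * C1 * \<kappa> * B"
      using nonneg C0 C1 K R by auto
    with p1 p2 p3 show "2 * (p * (?K * (c * \<kappa> * A))) + 2 * (p * (8 * ?d * (c * \<kappa> * B)))
      + 2 * C0 * ((?K * (c * \<kappa> * A)) * (8 * ?d * (c * B))) + 2 * C0 * (1 * (8 * ?d * (c * \<kappa> * B))) \<le> Q * \<kappa> * (T + B)"
      unfolding Q_def product_const_def by (simp add: algebra_simps)
  qed
  finally show "(\<integral>\<^sup>+w. ennreal \<bar>f (S x w)\<bar> \<partial>M) * (\<integral>\<^sup>+w. ennreal (min 1 ((norm (S u w))\<^sup>2)) \<partial>M)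
      \<le> ennreal (Q * \<kappa> * (T + B))" .
qed

text \<open>By independence the joint law is the product of the marginals, and each marginal is
  symmetric; so the signs of any subfamily can be flipped.\<close>

lemma sign_flip_invariance:
  fixes H :: "('k \<Rightarrow> real) \<Rightarrow> real"
  assumes H: "H \<in> borel_measurable (Pi\<^sub>M (IG \<union> IL) (\<lambda>_. borel))"
  shows "(\<integral>w. H (\<lambda>n\<in>IG \<union> IL. D n w) \<partial>M) = (\<integral>w. H (\<lambda>n\<in>IG \<union> IL. if n \<in> P then D n w else - D n w) \<partial>M)"
proof (cases "IG \<union> IL = {}")
  case False
  let ?D' = "\<lambda>n w. if n \<in> P then D n w else - D n w"
  have ind: "indep_vars (\<lambda>_. borel) ?D' (IG \<union> IL)"
    using indep_vars_compose2[OF indep, of "\<lambda>n x. if n \<in> P then x else - x" "\<lambda>_. borel"] by simp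
  have rv: "\<And>n. n \<in> IG \<union> IL \<Longrightarrow> ?D' n \<in> borel_measurable M"
    using ind by (auto simp: indep_vars_def)
  have same: "distr M borel (?D' n) = distr M borel (D n)" if "n \<in> IG \<union> IL" for n
    using symmetric[OF that] by (cases "n \<in> P") auto
  have eq: "distr M (Pi\<^sub>M (IG \<union> IL) (\<lambda>_. borel)) (\<lambda>w. \<lambda>n\<in>IG \<union> IL. D n w)
      = distr M (Pi\<^sub>M (IG \<union> IL) (\<lambda>_. borel)) (\<lambda>w. \<lambda>n\<in>IG \<union> IL. ?D' n w)" (is "?l = ?r")
  proof -
    have "?l = (\<Pi>\<^sub>M n\<in>IG \<union> IL. distr M borel (D n))"
      using indep_vars_iff_distr_eq_PiM'[OF False, where M' = "\<lambda>_. borel" and X = D] indep by auto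
    also have "\<dots> = (\<Pi>\<^sub>M n\<in>IG \<union> IL. distr M borel (?D' n))"
      using same by (intro PiM_cong) auto
    also have "\<dots> = ?r"
      using indep_vars_iff_distr_eq_PiM'[OF False, where M' = "\<lambda>_. borel" and X = ?D'] rv ind by auto
    finally show ?thesis .
  qed
  have "(\<integral>w. H (\<lambda>n\<in>IG \<union> IL. D n w) \<partial>M) = (\<integral>w. H w \<partial>?l)"
    by (intro integral_distr[symmetric] H measurable_restrict) auto
  also have "\<dots> = (\<integral>w. H (\<lambda>n\<in>IG \<union> IL. ?D' n w) \<partial>M)"
    unfolding eq by (intro integral_distr H measurable_restrict rv) auto
  finally show ?thesis .
qed (simp add: restrict_def)

definition past :: "'k set \<Rightarrow> ('k \<Rightarrow> 'b::real_vector) \<Rightarrow> 'k \<Rightarrow> 'b" where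
  "past P c n = (if n \<in> P then c n else 0)"

lemma S_past: "S (past P c) w = lin ((IG \<union> IL) \<inter> P) c w"
  unfolding lin_def past_def using finite by (intro sum.mono_neutral_cong_right) auto

lemma S_past_Compl: "S c w = S (past P c) w + S (past (- P) c) w"
  unfolding lin_def past_def by (subst sum.distrib[symmetric]) (auto intro!: sum.cong)

text \<open>Flipping the signs of the increments outside \<open>P\<close> replaces \<open>f (U + V)\<close> by
  \<open>(f (U + V) + f (U - V)) / 2\<close>, which for even \<open>f\<close> differs from the independent quantity \<open>f V\<close> by
  a second difference of \<open>f\<close> with step \<open>U\<close>.\<close>

lemma covariance_past_le:
  fixes x y :: "'k \<Rightarrow> 'b::euclidean_space" and P :: "'k set"
  assumes f: "admissible f"
  defines "X \<equiv> S (past P x)" and "U \<equiv> S (past P y)"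
  shows "\<bar>(\<integral>w. f (X w) * f (S y w) \<partial>M) - (\<integral>w. f (X w) \<partial>M) * (\<integral>w. f (S y w) \<partial>M)\<bar>
    \<le> 2 * (\<integral>w. \<bar>f (X w)\<bar> * min 1 ((norm (U w))\<^sup>2) \<partial>M)
      + 2 * ((\<integral>w. \<bar>f (X w)\<bar> \<partial>M) * (\<integral>w. min 1 ((norm (U w))\<^sup>2) \<partial>M))"
proof -
  have [measurable]: "f \<in> borel_measurable borel" using f by (rule admissible_measurable)
  define V where "V = S (past (- P) y)"
  have [measurable]: "X \<in> borel_measurable M" "U \<in> borel_measurable M" "V \<in> borel_measurable M"
    by (simp_all add: X_def U_def V_def)
  have fb: "\<bar>f v\<bar> \<le> 1" for v using f by (simp add: admissible_def)
  have fe: "f (- v) = f v" for v using f by (simp add: admissible_def)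
  have int: "integrable M g" if "g \<in> borel_measurable M" "\<And>w. \<bar>g w\<bar> \<le> 1" for g :: "'w \<Rightarrow> real"
    using that by (intro integrable_const_bound[where B=1]) auto
  have prod1: "\<bar>p * q\<bar> \<le> 1" if "\<bar>p\<bar> \<le> 1" "\<bar>q\<bar> \<le> 1" for p q :: real
    using mult_mono[OF that] by (simp add: abs_mult)
  have Sy: "S y w = U w + V w" for w unfolding U_def V_def by (rule S_past_Compl)
  define R where "R w = (f (V w + U w) + f (V w - U w)) / 2 - f (V w)" for w
  have [measurable]: "R \<in> borel_measurable M" unfolding R_def[abs_def] by measurable
  have R: "\<bar>R w\<bar> \<le> 2 * min 1 ((norm (U w))\<^sup>2)" for w
  proof -
    have "\<bar>R w\<bar> \<le> (norm (U w))\<^sup>2" using f by (simp add: admissible_def R_def)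
    moreover have "\<bar>R w\<bar> \<le> 2"
    proof -
      have "\<bar>(a + b) / 2 - c\<bar> \<le> 2" if "\<bar>a\<bar> \<le> 1" "\<bar>b\<bar> \<le> 1" "\<bar>c\<bar> \<le> 1" for a b c :: real
        using that by (simp add: abs_le_iff field_simps)
      then show ?thesis unfolding R_def using fb by blast
    qed
    ultimately show ?thesis by (auto simp: min_def)
  qed
  have intR: "integrable M (\<lambda>w. g w * R w)" if "g \<in> borel_measurable M" "\<And>w. \<bar>g w\<bar> \<le> 1" for g
  proof (rule integrable_const_bound[where B=2])
    show "AE w in M. norm (g w * R w) \<le> 2"
    proof (rule AE_I2)
      fix w
      have "\<bar>R w\<bar> \<le> 2" using R[of w] by simp
      then show "norm (g w * R w) \<le> 2" using mult_mono[OF that(2) \<open>\<bar>R w\<bar> \<le> 2\<close>] by (simp add: abs_mult)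
    qed
  qed (use that in measurable)
  have flip: "(\<integral>w. g (X w) * f (U w + V w) \<partial>M) = (\<integral>w. g (X w) * f (U w - V w) \<partial>M)"
    if [measurable]: "g \<in> borel_measurable borel" for g
  proof -
    define H where "H w = g (\<Sum>n\<in>IG \<union> IL. w n *\<^sub>R past P x n) * f (\<Sum>n\<in>IG \<union> IL. w n *\<^sub>R y n)" for w
    have meas: "(\<lambda>w. \<Sum>n\<in>IG \<union> IL. w n *\<^sub>R z n) \<in> borel_measurable (Pi\<^sub>M (IG \<union> IL) (\<lambda>_. borel :: real measure))" for z :: "'k \<Rightarrow> 'b"
      by (intro borel_measurable_sum borel_measurable_scaleR) auto
    note [measurable] = meas
    have "H \<in> borel_measurable (Pi\<^sub>M (IG \<union> IL) (\<lambda>_. borel))"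
      unfolding H_def[abs_def] by measurable
    from sign_flip_invariance[OF this, of P]
    have "(\<integral>w. H (\<lambda>n\<in>IG \<union> IL. D n w) \<partial>M) = (\<integral>w. H (\<lambda>n\<in>IG \<union> IL. if n \<in> P then D n w else - D n w) \<partial>M)" .
    moreover have "H (\<lambda>n\<in>IG \<union> IL. D n w) = g (X w) * f (U w + V w)" for w
      by (simp add: H_def Sy[symmetric] X_def lin_def)
    moreover have "H (\<lambda>n\<in>IG \<union> IL. if n \<in> P then D n w else - D n w) = g (X w) * f (U w - V w)" for w
    proof -
      have "(\<Sum>n\<in>IG \<union> IL. (if n \<in> P then D n w else - D n w) *\<^sub>R past P x n) = X w"
        unfolding X_def lin_def past_def by (intro sum.cong) auto
      moreover have "(\<Sum>n\<in>IG \<union> IL. (if n \<in> P then D n w else - D n w) *\<^sub>R y n) = U w - V w"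
        unfolding U_def V_def lin_def past_def by (subst sum_subtractf[symmetric]) (auto intro!: sum.cong)
      ultimately show ?thesis by (simp add: H_def)
    qed
    ultimately show ?thesis by simp
  qed
  \<comment> \<open>Used with g = f and with g = 1. In the covariance the terms containing E f (V)
    cancel, and only those with the second difference R survive.\<close>
  have key: "(\<integral>w. g (X w) * f (S y w) \<partial>M) = (\<integral>w. g (X w) * R w \<partial>M) + (\<integral>w. g (X w) \<partial>M) * (\<integral>w. f (V w) \<partial>M)"
    if g [measurable]: "g \<in> borel_measurable borel" and gb: "\<And>v. \<bar>g v\<bar> \<le> 1" for g
  proof -
    have "indep_var borel (lin ((IG \<union> IL) \<inter> P) x) borel (lin ((IG \<union> IL) \<inter> - P) y)"
      by (intro indep_var_lin) auto
    moreover have "lin ((IG \<union> IL) \<inter> P) x = X" "lin ((IG \<union> IL) \<inter> - P) y = V"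
      unfolding X_def V_def by (auto simp: S_past fun_eq_iff)
    ultimately have "indep_var borel (g \<circ> X) borel (f \<circ> V)"
      by (intro indep_var_compose[of borel X borel V]) auto
    then have ind: "(\<integral>w. g (X w) * f (V w) \<partial>M) = (\<integral>w. g (X w) \<partial>M) * (\<integral>w. f (V w) \<partial>M)"
      using fb gb by (subst indep_var_lebesgue_integral[symmetric]) (auto simp: o_def intro!: int)
    have i1: "integrable M (\<lambda>w. g (X w) * f (U w + V w))"
      and i2: "integrable M (\<lambda>w. g (X w) * f (U w - V w))"
      and i3: "integrable M (\<lambda>w. g (X w) * f (V w))"
      using fb gb by (auto intro!: int prod1)
    have "(\<integral>w. g (X w) * R w \<partial>M)
        = (\<integral>w. (g (X w) * f (U w + V w) + g (X w) * f (U w - V w)) / 2 - g (X w) * f (V w) \<partial>M)"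
    proof (intro Bochner_Integration.integral_cong refl)
      fix w
      \<comment> \<open>The sign flip produces f (U - V), whereas the second difference is centred
        at V with step U; evenness of f reconciles them.\<close>
      have "f (V w - U w) = f (U w - V w)" using fe[of "U w - V w"] by simp
      then show "g (X w) * R w = (g (X w) * f (U w + V w) + g (X w) * f (U w - V w)) / 2 - g (X w) * f (V w)"
        by (simp add: R_def algebra_simps add_divide_distrib)
    qed
    also have "\<dots> = ((\<integral>w. g (X w) * f (U w + V w) \<partial>M) + (\<integral>w. g (X w) * f (U w - V w) \<partial>M)) / 2
        - (\<integral>w. g (X w) * f (V w) \<partial>M)"
      using i1 i2 i3 by simp
    finally show ?thesis using flip[OF g] ind by (simp add: Sy)
  qed
  have "(\<integral>w. f (S y w) \<partial>M) = (\<integral>w. R w \<partial>M) + (\<integral>w. f (V w) \<partial>M)"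
    using key[of "\<lambda>_. 1"] by (simp add: prob_space)
  then have "(\<integral>w. f (X w) * f (S y w) \<partial>M) - (\<integral>w. f (X w) \<partial>M) * (\<integral>w. f (S y w) \<partial>M)
      = (\<integral>w. f (X w) * R w \<partial>M) - (\<integral>w. f (X w) \<partial>M) * (\<integral>w. R w \<partial>M)"
    using key[of f] fb by (simp add: algebra_simps)
  moreover have "\<bar>\<integral>w. f (X w) * R w \<partial>M\<bar> \<le> 2 * (\<integral>w. \<bar>f (X w)\<bar> * min 1 ((norm (U w))\<^sup>2) \<partial>M)"
  proof -
    have "\<bar>\<integral>w. f (X w) * R w \<partial>M\<bar> \<le> (\<integral>w. \<bar>f (X w) * R w\<bar> \<partial>M)"
      by (rule integral_abs_bound)
    also have "\<dots> \<le> (\<integral>w. 2 * (\<bar>f (X w)\<bar> * min 1 ((norm (U w))\<^sup>2)) \<partial>M)"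
    proof (intro integral_mono)
      show "integrable M (\<lambda>w. \<bar>f (X w) * R w\<bar>)"
        using fb by (intro integrable_abs intR) auto
      show "integrable M (\<lambda>w. 2 * (\<bar>f (X w)\<bar> * min 1 ((norm (U w))\<^sup>2)))"
        using fb by (intro integrable_mult_right int prod1) auto
      show "\<bar>f (X w) * R w\<bar> \<le> 2 * (\<bar>f (X w)\<bar> * min 1 ((norm (U w))\<^sup>2))" for w
        using mult_left_mono[OF R, of "\<bar>f (X w)\<bar>" w] by (simp add: abs_mult mult_ac)
    qed
    finally show ?thesis by simp
  qed
  moreover have "\<bar>(\<integral>w. f (X w) \<partial>M) * (\<integral>w. R w \<partial>M)\<bar>
      \<le> 2 * ((\<integral>w. \<bar>f (X w)\<bar> \<partial>M) * (\<integral>w. min 1 ((norm (U w))\<^sup>2) \<partial>M))"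
  proof -
    have "\<bar>\<integral>w. R w \<partial>M\<bar> \<le> (\<integral>w. \<bar>R w\<bar> \<partial>M)" by (rule integral_abs_bound)
    also have "\<dots> \<le> (\<integral>w. 2 * min 1 ((norm (U w))\<^sup>2) \<partial>M)"
    proof (intro integral_mono R)
      show "integrable M (\<lambda>w. \<bar>R w\<bar>)" using intR[of "\<lambda>_. 1"] by simp
    qed (auto intro!: integrable_mult_right int)
    finally have "\<bar>\<integral>w. R w \<partial>M\<bar> \<le> 2 * (\<integral>w. min 1 ((norm (U w))\<^sup>2) \<partial>M)" by simp
    then have "\<bar>\<integral>w. f (X w) \<partial>M\<bar> * \<bar>\<integral>w. R w \<partial>M\<bar>
        \<le> (\<integral>w. \<bar>f (X w)\<bar> \<partial>M) * (2 * (\<integral>w. min 1 ((norm (U w))\<^sup>2) \<partial>M))"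
      by (intro mult_mono integral_abs_bound) auto
    then show ?thesis by (simp add: abs_mult mult_ac)
  qed
  ultimately show ?thesis by linarith
qed

text \<open>f is bounded and 1-Lipschitz, so the difference is at most min 2 |S (x - z)|. Variance
  and scale bounds of order e^2 become an error of order e through
  \<open>min_two_le\<close>.\<close>

lemma expectation_diff_le:
  fixes x z :: "'k \<Rightarrow> real ^ 'd"
  assumes f: "admissible f" and e: "0 < e" "e \<le> 1"
    and r: "gauss_var_le (\<lambda>n. x n - z n) (e\<^sup>2)" "stable_scale_le (\<lambda>n. x n - z n) (e\<^sup>2)"
  shows "(\<integral>w. \<bar>f (S x w) - f (S z w)\<bar> \<partial>M) \<le> (2 + 4 * moment_const (real CARD('d)) 1 + 32 * real CARD('d)) * e"
proof -
  let ?k = "2 * moment_const (real CARD('d)) 1 + 16 * real CARD('d)"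
  have [measurable]: "f \<in> borel_measurable borel" using f by (rule admissible_measurable)
  let ?r = "S (\<lambda>n. x n - z n)"
  have dif: "S x w - S z w = ?r w" for w
    by (simp add: lin_def scaleR_diff_right sum_subtractf)
  have int: "integrable M (\<lambda>w. min 1 ((norm (?r w))\<^sup>2))"
    by (intro integrable_const_bound[where B=1]) auto
  have "(\<integral>w. min 1 ((norm (?r w))\<^sup>2) \<partial>M) \<le> ?k * e\<^sup>2"
  proof -
    have "ennreal (\<integral>w. min 1 ((norm (?r w))\<^sup>2) \<partial>M) = (\<integral>\<^sup>+w. ennreal (min 1 ((norm (?r w))\<^sup>2)) \<partial>M)"
      using int by (intro nn_integral_eq_integral[symmetric]) auto
    also have "\<dots> \<le> ennreal (?k * e\<^sup>2)"
      using min_S_le[OF r] by (simp add: algebra_simps)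
    finally show ?thesis
      by (subst (asm) ennreal_le_iff) (auto simp: moment_const_nonneg)
  qed
  have pw: "\<bar>f (S x w) - f (S z w)\<bar> \<le> 2 * (e + min 1 ((norm (?r w))\<^sup>2) / e)" for w
  proof -
    have "\<bar>f (S x w)\<bar> \<le> 1" "\<bar>f (S z w)\<bar> \<le> 1" "\<bar>f (S x w) - f (S z w)\<bar> \<le> norm (?r w)"
      using f by (simp_all add: admissible_def flip: dif)
    then have "\<bar>f (S x w) - f (S z w)\<bar> \<le> min 2 (norm (?r w))" by simp
    also have "\<dots> \<le> 2 * (e + min 1 ((norm (?r w))\<^sup>2) / e)" using e by (intro min_two_le) auto
    finally show ?thesis .
  qed
  have "(\<integral>w. \<bar>f (S x w) - f (S z w)\<bar> \<partial>M) \<le> (\<integral>w. 2 * (e + min 1 ((norm (?r w))\<^sup>2) / e) \<partial>M)"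
  proof (intro integral_mono pw)
    show "integrable M (\<lambda>w. \<bar>f (S x w) - f (S z w)\<bar>)"
    proof (intro integrable_const_bound[where B=2] AE_I2)
      fix w
      have "\<bar>f (S x w)\<bar> \<le> 1" "\<bar>f (S z w)\<bar> \<le> 1" using f by (simp_all add: admissible_def)
      then show "norm \<bar>f (S x w) - f (S z w)\<bar> \<le> 2" by simp
    qed measurable
  qed (use int in auto)
  also have "\<dots> = 2 * (e + (\<integral>w. min 1 ((norm (?r w))\<^sup>2) \<partial>M) / e)"
    using int by (simp add: prob_space)
  also have "\<dots> \<le> 2 * (e + (?k * e\<^sup>2) / e)"
    using e \<open>_ \<le> ?k * e\<^sup>2\<close> by (intro mult_left_mono add_left_mono divide_right_mono) auto
  also have "\<dots> = (2 + 4 * moment_const (real CARD('d)) 1 + 32 * real CARD('d)) * e"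
  proof -
    have "?k * e\<^sup>2 / e = ?k * e" using e by (simp add: power2_eq_square)
    then show ?thesis by (simp only:) (simp add: algebra_simps)
  qed
  finally show ?thesis .
qed

end

text \<open>F H - F' H' = (F - F') H + F' (H - H') is used for the mean of the product and again for
  the product of the means, hence the two factors 2. It serves to remove the future part of X_s and
  to pass from step functions to X.\<close>

lemma (in prob_space) covariance_diff_le:
  fixes F F' H H' :: "'a \<Rightarrow> real"
  assumes meas: "F \<in> borel_measurable M" "F' \<in> borel_measurable M" "H \<in> borel_measurable M" "H' \<in> borel_measurable M"
    and b: "\<And>w. \<bar>F w\<bar> \<le> 1" "\<And>w. \<bar>F' w\<bar> \<le> 1" "\<And>w. \<bar>H w\<bar> \<le> 1" "\<And>w. \<bar>H' w\<bar> \<le> 1"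
    and d: "(\<integral>w. \<bar>F w - F' w\<bar> \<partial>M) \<le> e1" "(\<integral>w. \<bar>H w - H' w\<bar> \<partial>M) \<le> e2"
  shows "\<bar>((\<integral>w. F w * H w \<partial>M) - (\<integral>w. F w \<partial>M) * (\<integral>w. H w \<partial>M))
      - ((\<integral>w. F' w * H' w \<partial>M) - (\<integral>w. F' w \<partial>M) * (\<integral>w. H' w \<partial>M))\<bar> \<le> 2 * e1 + 2 * e2"
proof -
  note [measurable] = meas
  have int: "integrable M g" if "g \<in> borel_measurable M" "\<And>w. \<bar>g w\<bar> \<le> 1" for g :: "'a \<Rightarrow> real"
    using that by (intro integrable_const_bound[where B=1]) auto
  have prod1: "\<bar>p * q\<bar> \<le> 1" if "\<bar>p\<bar> \<le> 1" "\<bar>q\<bar> \<le> 1" for p q :: real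
    using mult_mono[OF that] by (simp add: abs_mult)
  have i: "integrable M F" "integrable M F'" "integrable M H" "integrable M H'"
    "integrable M (\<lambda>w. F w * H w)" "integrable M (\<lambda>w. F' w * H' w)"
    using b by (auto intro!: int prod1)
  have exp1: "\<bar>\<integral>w. g w \<partial>M\<bar> \<le> 1" if "g \<in> borel_measurable M" "\<And>w. \<bar>g w\<bar> \<le> 1" for g :: "'a \<Rightarrow> real"
  proof -
    have "\<bar>\<integral>w. g w \<partial>M\<bar> \<le> (\<integral>w. \<bar>g w\<bar> \<partial>M)" by (rule integral_abs_bound)
    also have "\<dots> \<le> (\<integral>w. 1 \<partial>M)" using that by (intro integral_mono int) auto
    finally show ?thesis by (simp add: prob_space)
  qed
  have dF: "\<bar>(\<integral>w. F w \<partial>M) - (\<integral>w. F' w \<partial>M)\<bar> \<le> e1"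
    using integral_abs_bound[of M "\<lambda>w. F w - F' w"] d i by simp
  have dH: "\<bar>(\<integral>w. H w \<partial>M) - (\<integral>w. H' w \<partial>M)\<bar> \<le> e2"
    using integral_abs_bound[of M "\<lambda>w. H w - H' w"] d i by simp
  have "\<bar>(\<integral>w. F w * H w \<partial>M) - (\<integral>w. F' w * H' w \<partial>M)\<bar> = \<bar>\<integral>w. F w * H w - F' w * H' w \<partial>M\<bar>"
    using i by simp
  also have "\<dots> \<le> (\<integral>w. \<bar>F w * H w - F' w * H' w\<bar> \<partial>M)" by (rule integral_abs_bound)
  also have "\<dots> \<le> (\<integral>w. \<bar>F w - F' w\<bar> + \<bar>H w - H' w\<bar> \<partial>M)"
  proof (intro integral_mono)
    fix w
    have "F w * H w - F' w * H' w = (F w - F' w) * H w + F' w * (H w - H' w)"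
      by (simp add: algebra_simps)
    also have "\<bar>\<dots>\<bar> \<le> \<bar>F w - F' w\<bar> * \<bar>H w\<bar> + \<bar>F' w\<bar> * \<bar>H w - H' w\<bar>"
      by (metis abs_mult abs_triangle_ineq)
    also have "\<dots> \<le> \<bar>F w - F' w\<bar> + \<bar>H w - H' w\<bar>"
      using b by (intro add_mono mult_left_le mult_left_le_one_le) auto
    finally show "\<bar>F w * H w - F' w * H' w\<bar> \<le> \<bar>F w - F' w\<bar> + \<bar>H w - H' w\<bar>" .
  qed (use i in auto)
  also have "\<dots> \<le> e1 + e2" using i d by simp
  finally have 1: "\<bar>(\<integral>w. F w * H w \<partial>M) - (\<integral>w. F' w * H' w \<partial>M)\<bar> \<le> e1 + e2" .
  have "(\<integral>w. F w \<partial>M) * (\<integral>w. H w \<partial>M) - (\<integral>w. F' w \<partial>M) * (\<integral>w. H' w \<partial>M)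
      = ((\<integral>w. F w \<partial>M) - (\<integral>w. F' w \<partial>M)) * (\<integral>w. H w \<partial>M) + (\<integral>w. F' w \<partial>M) * ((\<integral>w. H w \<partial>M) - (\<integral>w. H' w \<partial>M))"
    by (simp add: algebra_simps)
  also have "\<bar>\<dots>\<bar> \<le> \<bar>(\<integral>w. F w \<partial>M) - (\<integral>w. F' w \<partial>M)\<bar> * \<bar>\<integral>w. H w \<partial>M\<bar> + \<bar>\<integral>w. F' w \<partial>M\<bar> * \<bar>(\<integral>w. H w \<partial>M) - (\<integral>w. H' w \<partial>M)\<bar>"
    by (metis abs_mult abs_triangle_ineq)
  also have "\<dots> \<le> \<bar>(\<integral>w. F w \<partial>M) - (\<integral>w. F' w \<partial>M)\<bar> + \<bar>(\<integral>w. H w \<partial>M) - (\<integral>w. H' w \<partial>M)\<bar>"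
    using exp1[OF meas(2) b(2)] exp1[OF meas(3) b(3)] by (intro add_mono mult_left_le mult_left_le_one_le) auto
  finally have 2: "\<bar>(\<integral>w. F w \<partial>M) * (\<integral>w. H w \<partial>M) - (\<integral>w. F' w \<partial>M) * (\<integral>w. H' w \<partial>M)\<bar> \<le> e1 + e2"
    using dF dH by linarith
  show ?thesis using 1 2 by linarith
qed

section \<open>Covariance and second moment estimates in the finite model\<close>

context noise
begin

text \<open>P is the set of increments up to time s, and x and y are the coefficients of the
  approximations of X_s and X_t. Part of x may lie outside P; dropping it costs the term in e, after
  which \<open>covariance_past_le\<close> applies, with both of its terms controlled by
  \<open>product_estimate\<close>.\<close>

lemma covariance_estimate:
  fixes x y :: "'k \<Rightarrow> real ^ 'd" and f \<Phi> :: "real ^ 'd \<Rightarrow> real"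
  assumes f: "admissible f" and \<Phi>: "\<Phi> \<in> borel_measurable borel" "\<And>y. 0 \<le> \<Phi> y" and C0: "0 \<le> C0"
    and split: "\<And>y z. \<bar>f (y + z)\<bar> \<le> \<Phi> y + C0 * min 1 ((norm z)\<^sup>2)"
    and bounds: "gauss_var_le (past P y) (c * \<kappa> * A)" "stable_scale_le (past P x) (c * B)" "stable_scale_le (past P y) (c * \<kappa> * B)"
    and nonneg: "0 \<le> A" "A \<le> R" "0 \<le> B" "0 \<le> c" "0 \<le> \<kappa>" "0 \<le> T"
    and I1: "(\<integral>\<^sup>+w. ennreal (\<Phi> (G (past P x) w) * (norm (G (past P y) w))\<^sup>2) \<partial>M) \<le> ennreal (C1 * \<kappa> * T)"
    and I2: "(\<integral>\<^sup>+w. ennreal (\<Phi> (G (past P x) w)) \<partial>M) \<le> ennreal p" "0 \<le> p" "p \<le> C1" "p * A \<le> C1 * T"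
    and e: "0 < e" "e \<le> 1" "gauss_var_le (past (- P) x) (e\<^sup>2)" "stable_scale_le (past (- P) x) (e\<^sup>2)"
  shows "\<bar>(\<integral>w. f (S x w) * f (S y w) \<partial>M) - (\<integral>w. f (S x w) \<partial>M) * (\<integral>w. f (S y w) \<partial>M)\<bar>
    \<le> 4 * (product_const (real CARD('d)) c C0 C1 R * \<kappa> * (T + B))
      + 2 * (2 + 4 * moment_const (real CARD('d)) 1 + 32 * real CARD('d)) * e"
proof -
  let ?Q = "product_const (real CARD('d)) c C0 C1 R * \<kappa> * (T + B)"
  let ?e = "(2 + 4 * moment_const (real CARD('d)) 1 + 32 * real CARD('d)) * e"
  let ?X = "S (past P x)" and ?U = "S (past P y)"
  have [measurable]: "f \<in> borel_measurable borel" using f by (rule admissible_measurable)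
  have fb: "\<bar>f v\<bar> \<le> 1" for v using f by (simp add: admissible_def)
  have int: "integrable M g" if "g \<in> borel_measurable M" "\<And>w. \<bar>g w\<bar> \<le> 1" for g :: "'w \<Rightarrow> real"
    using that by (intro integrable_const_bound[where B=1]) auto
  have prod1: "\<bar>p * q\<bar> \<le> 1" if "\<bar>p\<bar> \<le> 1" "\<bar>q\<bar> \<le> 1" for p q :: real
    using mult_mono[OF that] by (simp add: abs_mult)
  have Q0: "0 \<le> ?Q"
    using nonneg C0 I2 by (simp add: product_const_def moment_const_nonneg)
  note prod = product_estimate[OF admissible_measurable[OF f] \<Phi> C0 split bounds nonneg I1 I2]
  have "ennreal (\<integral>w. \<bar>f (?X w)\<bar> * min 1 ((norm (?U w))\<^sup>2) \<partial>M) \<le> ennreal ?Q"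
    using prod(1) fb by (subst nn_integral_eq_integral[symmetric]) (auto intro!: int prod1)
  then have E1: "(\<integral>w. \<bar>f (?X w)\<bar> * min 1 ((norm (?U w))\<^sup>2) \<partial>M) \<le> ?Q"
    using Q0 by (simp add: ennreal_le_iff)
  have "ennreal ((\<integral>w. \<bar>f (?X w)\<bar> \<partial>M) * (\<integral>w. min 1 ((norm (?U w))\<^sup>2) \<partial>M)) \<le> ennreal ?Q"
    using prod(2) fb
    by (subst ennreal_mult, simp, simp, subst (1 2) nn_integral_eq_integral[symmetric]) (auto intro!: int)
  then have E2: "(\<integral>w. \<bar>f (?X w)\<bar> \<partial>M) * (\<integral>w. min 1 ((norm (?U w))\<^sup>2) \<partial>M) \<le> ?Q"
    using Q0 by (simp add: ennreal_le_iff)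
  have E: "\<bar>(\<integral>w. f (?X w) * f (S y w) \<partial>M) - (\<integral>w. f (?X w) \<partial>M) * (\<integral>w. f (S y w) \<partial>M)\<bar> \<le> 4 * ?Q"
    using covariance_past_le[OF f, of P x y] E1 E2 by linarith
  have "(\<lambda>n. x n - past P x n) = past (- P) x" by (auto simp: past_def)
  with expectation_diff_le[OF f e(1,2), of x "past P x"] e
  have D: "(\<integral>w. \<bar>f (S x w) - f (?X w)\<bar> \<partial>M) \<le> ?e" by simp
  have "\<bar>((\<integral>w. f (S x w) * f (S y w) \<partial>M) - (\<integral>w. f (S x w) \<partial>M) * (\<integral>w. f (S y w) \<partial>M))
      - ((\<integral>w. f (?X w) * f (S y w) \<partial>M) - (\<integral>w. f (?X w) \<partial>M) * (\<integral>w. f (S y w) \<partial>M))\<bar> \<le> 2 * ?e + 2 * 0"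
    using D fb by (intro covariance_diff_le) auto
  with E show ?thesis by linarith
qed

text \<open>Since |f (X)| <= min 1 |X|^2, the square of f (X) is at most |f (X)| min 1 |X|^2, and
  \<open>product_estimate\<close> applies with u = x and \<kappa> = 1.\<close>

lemma second_moment_estimate:
  fixes x :: "'k \<Rightarrow> real ^ 'd" and f \<Phi> :: "real ^ 'd \<Rightarrow> real"
  assumes f: "admissible f" and \<Phi>: "\<Phi> \<in> borel_measurable borel" "\<And>y. 0 \<le> \<Phi> y" and C0: "0 \<le> C0"
    and split: "\<And>y z. \<bar>f (y + z)\<bar> \<le> \<Phi> y + C0 * min 1 ((norm z)\<^sup>2)"
    and bounds: "gauss_var_le x (c * A)" "stable_scale_le x (c * B)"
    and nonneg: "0 \<le> A" "A \<le> R" "0 \<le> B" "0 \<le> c" "0 \<le> T"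
    and I1: "(\<integral>\<^sup>+w. ennreal (\<Phi> (G x w) * (norm (G x w))\<^sup>2) \<partial>M) \<le> ennreal (C1 * T)"
    and I2: "(\<integral>\<^sup>+w. ennreal (\<Phi> (G x w)) \<partial>M) \<le> ennreal p" "0 \<le> p" "p \<le> C1" "p * A \<le> C1 * T"
  shows "(\<integral>w. f (S x w) * f (S x w) \<partial>M) \<le> product_const (real CARD('d)) c C0 C1 R * (T + B)"
proof -
  let ?Q = "product_const (real CARD('d)) c C0 C1 R * (T + B)"
  have [measurable]: "f \<in> borel_measurable borel" using f by (rule admissible_measurable)
  have fb: "\<bar>f v\<bar> \<le> 1" for v using f by (simp add: admissible_def)
  have Q0: "0 \<le> ?Q"
    using nonneg C0 I2 by (simp add: product_const_def moment_const_nonneg)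
  have sq: "\<bar>f v * f v\<bar> \<le> 1" "f v * f v \<le> 1" for v
    using mult_mono[OF fb[of v] fb[of v]] by (simp_all add: abs_mult)
  have le: "f (S x w) * f (S x w) \<le> \<bar>f (S x w)\<bar> * min 1 ((norm (S x w))\<^sup>2)" for w
    using fb[of "S x w"] admissible_le_norm_sq[OF f, of "S x w"]
      mult_left_mono[of "\<bar>f (S x w)\<bar>" "min 1 ((norm (S x w))\<^sup>2)" "\<bar>f (S x w)\<bar>"] by simp
  have "(\<integral>\<^sup>+w. ennreal (\<bar>f (S x w)\<bar> * min 1 ((norm (S x w))\<^sup>2)) \<partial>M) \<le> ennreal ?Q"
    using product_estimate(1)[of f \<Phi> C0 x c 1 A x B R T C1 p] assms admissible_measurable[OF f] by simp
  moreover have "(\<integral>\<^sup>+w. ennreal (f (S x w) * f (S x w)) \<partial>M) \<le> (\<integral>\<^sup>+w. ennreal (\<bar>f (S x w)\<bar> * min 1 ((norm (S x w))\<^sup>2)) \<partial>M)"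
    by (intro nn_integral_mono ennreal_leI le)
  ultimately have "ennreal (\<integral>w. f (S x w) * f (S x w) \<partial>M) \<le> ennreal ?Q"
    using sq by (subst nn_integral_eq_integral[symmetric]) (auto intro!: integrable_const_bound[where B=1])
  then show ?thesis using Q0 by (simp add: ennreal_le_iff)
qed

text \<open>G x and G u are dependent, so the product is separated by 2 a b <= \<kappa> a^2 + b^2 /
  \<kappa>. The fourth moment of G u is of order \<kappa>^2, so with these weights both terms are of
  order \<kappa> A^2.\<close>

lemma quadratic_weight:
  fixes x u :: "'k \<Rightarrow> real ^ 'd"
  assumes x: "gauss_var_le x (c * A)" and u: "gauss_var_le u (c * \<kappa> * A)"
    and nonneg: "0 < \<kappa>" "0 \<le> A" "0 \<le> c"
  shows "(\<integral>\<^sup>+w. ennreal (2 * (norm (G x w))\<^sup>2 * (norm (G u w))\<^sup>2) \<partial>M)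
      \<le> ennreal (2 * moment_const (real CARD('d)) 2 * c\<^sup>2 * \<kappa> * A\<^sup>2)" (is ?thesis1)
    and "(\<integral>\<^sup>+w. ennreal (2 * (norm (G x w))\<^sup>2) \<partial>M) \<le> ennreal (2 * moment_const (real CARD('d)) 1 * c * A)" (is ?thesis2)
proof -
  let ?K = "moment_const (real CARD('d)) 2"
  have K: "0 \<le> ?K" by (simp add: moment_const_nonneg)
  have "(\<integral>\<^sup>+w. ennreal (2 * (norm (G x w))\<^sup>2 * (norm (G u w))\<^sup>2) \<partial>M)
      \<le> (\<integral>\<^sup>+w. ennreal \<kappa> * ennreal (norm (G x w) ^ (2 * 2)) + ennreal (1 / \<kappa>) * ennreal (norm (G u w) ^ (2 * 2)) \<partial>M)"
  proof (intro nn_integral_mono)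
    fix w
    let ?a = "(norm (G x w))\<^sup>2" and ?b = "(norm (G u w))\<^sup>2"
    have "0 \<le> (\<kappa> * ?a - ?b)\<^sup>2 / \<kappa>" using nonneg by simp
    also have "(\<kappa> * ?a - ?b)\<^sup>2 / \<kappa> = \<kappa> * ?a\<^sup>2 + 1 / \<kappa> * ?b\<^sup>2 - 2 * ?a * ?b"
      using nonneg by (simp add: power2_diff field_simps power2_eq_square)
    finally have "2 * ?a * ?b \<le> \<kappa> * norm (G x w) ^ (2 * 2) + 1 / \<kappa> * norm (G u w) ^ (2 * 2)"
      by (simp add: power_mult)
    then show "ennreal (2 * ?a * ?b) \<le> ennreal \<kappa> * ennreal (norm (G x w) ^ (2 * 2)) + ennreal (1 / \<kappa>) * ennreal (norm (G u w) ^ (2 * 2))"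
      using nonneg by (simp add: ennreal_leI flip: ennreal_mult ennreal_plus)
  qed
  also have "\<dots> = ennreal \<kappa> * (\<integral>\<^sup>+w. ennreal (norm (G x w) ^ (2 * 2)) \<partial>M) + ennreal (1 / \<kappa>) * (\<integral>\<^sup>+w. ennreal (norm (G u w) ^ (2 * 2)) \<partial>M)"
    by (simp add: nn_integral_add nn_integral_cmult)
  also have "\<dots> \<le> ennreal \<kappa> * ennreal (?K * (c * A) ^ 2) + ennreal (1 / \<kappa>) * ennreal (?K * (c * \<kappa> * A) ^ 2)"
    by (intro add_mono mult_left_mono moment_G_le x u) auto
  also have "\<dots> = ennreal (\<kappa> * (?K * (c * A) ^ 2) + 1 / \<kappa> * (?K * (c * \<kappa> * A) ^ 2))"
    using nonneg K by (simp flip: ennreal_mult ennreal_plus)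
  also have "\<kappa> * (?K * (c * A) ^ 2) + 1 / \<kappa> * (?K * (c * \<kappa> * A) ^ 2) = 2 * ?K * c\<^sup>2 * \<kappa> * A\<^sup>2"
    using nonneg by (simp add: field_simps power2_eq_square)
  finally show ?thesis1 .
  have "(\<integral>\<^sup>+w. ennreal (2 * (norm (G x w))\<^sup>2) \<partial>M) = (\<integral>\<^sup>+w. ennreal 2 * ennreal (norm (G x w) ^ (2 * 1)) \<partial>M)"
    by (intro nn_integral_cong) (simp flip: ennreal_mult del: ennreal_numeral)
  also have "\<dots> = ennreal 2 * (\<integral>\<^sup>+w. ennreal (norm (G x w) ^ (2 * 1)) \<partial>M)"
    by (intro nn_integral_cmult) auto
  also have "\<dots> \<le> ennreal 2 * ennreal (moment_const (real CARD('d)) 1 * (c * A) ^ 1)"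
    by (intro mult_left_mono moment_G_le x) auto
  also have "\<dots> = ennreal (2 * moment_const (real CARD('d)) 1 * c * A)"
    using nonneg by (simp add: moment_const_nonneg mult.assoc flip: ennreal_mult del: ennreal_numeral)
  finally show ?thesis2 .
qed

text \<open>Again the two Gaussian vectors are dependent. For i an indicator and w = |G u|^2 one has
  i w <= b i + w ^ m / b ^ (m - 1) at every level b > 0, a substitute for Hoelder's inequality with
  exponents m / (m - 1) and m. Large m makes the loss 1 - 1/m in the exponent as small as
  desired.\<close>

lemma tail_weight:
  fixes x u :: "'k \<Rightarrow> real ^ 'd"
  assumes tail: "emeasure M {w \<in> space M. r \<le> norm (G x w)} \<le> ennreal (2 * real CARD('d) * exp (- y))"
    and u: "gauss_var_le u (c * \<kappa> * A)"
    and nonneg: "0 \<le> \<kappa>" "0 \<le> A" "0 \<le> c" and m: "0 < m"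
  shows "(\<integral>\<^sup>+w. ennreal (indicator {v. r \<le> norm v} (G x w) * (norm (G u w))\<^sup>2) \<partial>M)
      \<le> ennreal (c * (2 * real CARD('d) + moment_const (real CARD('d)) m) * \<kappa> * (A * exp (- (y * (1 - 1 / real m)))))" (is ?thesis1)
    and "(\<integral>\<^sup>+w. ennreal (indicator {v. r \<le> norm v} (G x w)) \<partial>M) \<le> ennreal (2 * real CARD('d) * exp (- y))" (is ?thesis2)
proof -
  let ?d = "real CARD('d)" let ?K = "moment_const ?d m"
  have K: "0 \<le> ?K" by (simp add: moment_const_nonneg)
  have mset [measurable]: "{w \<in> space M. r \<le> norm (G x w)} \<in> sets M" by measurable
  have "(\<integral>\<^sup>+w. ennreal (indicator {v. r \<le> norm v} (G x w)) \<partial>M) = (\<integral>\<^sup>+w. indicator {w \<in> space M. r \<le> norm (G x w)} w \<partial>M)"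
    by (intro nn_integral_cong) (auto simp: indicator_def)
  also have "\<dots> = emeasure M {w \<in> space M. r \<le> norm (G x w)}" by (rule nn_integral_indicator) measurable
  finally show t2: ?thesis2 using tail by simp
  define s where "s = c * \<kappa> * A"
  have s0: "0 \<le> s" using nonneg by (simp add: s_def)
  show ?thesis1
  proof (cases "s = 0")
    \<comment> \<open>The level b chosen in the other case would be 0; here G u vanishes almost
      surely by its moment bound.\<close>
    case True
    have "(\<integral>\<^sup>+w. ennreal (indicator {v. r \<le> norm v} (G x w) * (norm (G u w))\<^sup>2) \<partial>M)
        \<le> (\<integral>\<^sup>+w. ennreal (norm (G u w) ^ (2 * 1)) \<partial>M)"
      by (intro nn_integral_mono ennreal_leI) (auto simp: indicator_def)
    also have "\<dots> \<le> ennreal (moment_const ?d 1 * s ^ 1)" unfolding s_def by (intro moment_G_le u) auto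
    finally show ?thesis using True by (simp add: order_trans)
  next
    case False
    then have s: "0 < s" using s0 by simp
    \<comment> \<open>Balances the two terms: both b exp (- y) and s ^ m / b ^ (m - 1) equal s exp
      (- y (1 - 1/m)).\<close>
    define b where "b = s * exp (y / m)"
    have b: "0 < b" using s by (simp add: b_def)
    have "(\<integral>\<^sup>+w. ennreal (indicator {v. r \<le> norm v} (G x w) * (norm (G u w))\<^sup>2) \<partial>M)
        \<le> (\<integral>\<^sup>+w. ennreal b * ennreal (indicator {v. r \<le> norm v} (G x w)) + ennreal (1 / b ^ (m - 1)) * ennreal (norm (G u w) ^ (2 * m)) \<partial>M)"
    proof (intro nn_integral_mono)
      fix w
      let ?i = "indicator {v. r \<le> norm v} (G x w) :: real" and ?w = "(norm (G u w))\<^sup>2"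
      have "?i * ?w \<le> b * ?i + 1 / b ^ (m - 1) * ?w ^ m"
      proof (cases "?w \<le> b")
        case True
        then have "?i * ?w \<le> b * ?i" by (auto simp: indicator_def)
        then show ?thesis using b by (simp add: add_increasing2)
      next
        case False
        then have "b ^ (m - 1) * ?w \<le> ?w ^ (m - 1) * ?w" using b by (intro mult_right_mono power_mono) auto
        also have "\<dots> = ?w ^ m" using m by (simp flip: power_Suc2)
        finally have "?w \<le> 1 / b ^ (m - 1) * ?w ^ m" using b by (simp add: field_simps)
        moreover have "?i * ?w \<le> ?w" by (auto simp: indicator_def)
        ultimately have "?i * ?w \<le> 1 / b ^ (m - 1) * ?w ^ m" by linarith
        then show ?thesis using b by (intro add_increasing) auto
      qed
      then show "ennreal (?i * ?w) \<le> ennreal b * ennreal ?i + ennreal (1 / b ^ (m - 1)) * ennreal (norm (G u w) ^ (2 * m))"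
        using b by (simp add: ennreal_leI power_mult flip: ennreal_mult ennreal_plus)
    qed
    also have "\<dots> = ennreal b * (\<integral>\<^sup>+w. ennreal (indicator {v. r \<le> norm v} (G x w)) \<partial>M)
        + ennreal (1 / b ^ (m - 1)) * (\<integral>\<^sup>+w. ennreal (norm (G u w) ^ (2 * m)) \<partial>M)"
      by (simp add: nn_integral_add nn_integral_cmult)
    also have "\<dots> \<le> ennreal b * ennreal (2 * ?d * exp (- y)) + ennreal (1 / b ^ (m - 1)) * ennreal (?K * s ^ m)"
      using m u by (intro add_mono mult_left_mono t2 moment_G_le) (auto simp: s_def)
    also have "\<dots> = ennreal (b * (2 * ?d * exp (- y)) + 1 / b ^ (m - 1) * (?K * s ^ m))"
      using b s K by (simp flip: ennreal_mult ennreal_plus)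
    also have "b * (2 * ?d * exp (- y)) + 1 / b ^ (m - 1) * (?K * s ^ m) = s * (2 * ?d + ?K) * exp (- (y * (1 - 1 / real m)))"
    proof -
      have e1: "exp (y / m) * exp (- y) = exp (- (y * (1 - 1 / real m)))"
        by (simp add: algebra_simps flip: exp_add)
      have "s ^ m / b ^ (m - 1) = s * exp (- (y * (1 - 1 / real m)))"
      proof -
        have "b ^ (m - 1) = s ^ (m - 1) * exp (real (m - 1) * (y / m))"
          by (simp only: b_def power_mult_distrib exp_of_nat_mult)
        also have "real (m - 1) * (y / m) = y * (1 - 1 / real m)"
          using m by (simp add: of_nat_diff field_simps)
        finally have "b ^ (m - 1) = s ^ (m - 1) * exp (y * (1 - 1 / real m))" .
        moreover have "s ^ m = s ^ (m - 1) * s" using m by (simp flip: power_Suc2)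
        ultimately have "s ^ m / b ^ (m - 1) = s / exp (y * (1 - 1 / real m))" using s by simp
        then show ?thesis by (simp only: exp_minus divide_inverse)
      qed
      then have e2: "1 / b ^ (m - 1) * (?K * s ^ m) = ?K * (s * exp (- (y * (1 - 1 / real m))))"
        by (metis mult.left_commute mult_1 times_divide_eq_left)
      have "b * (2 * ?d * exp (- y)) = 2 * ?d * s * (exp (y / m) * exp (- y))" by (simp add: b_def)
      then show ?thesis unfolding e1 e2 by (simp add: algebra_simps)
    qed
    finally show ?thesis by (simp add: s_def mult_ac)
  qed
qed

end

text \<open>Combines independence across the processes, as random elements of path space, with
  independence of the increments within each process.\<close>

lemma (in prob_space) indep_vars_Times:
  assumes V: "indep_vars N V I" and fin: "finite I" "finite J"
    and g: "\<And>p k. p \<in> I \<Longrightarrow> k \<in> J \<Longrightarrow> g p k \<in> measurable (N p) (L k)"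
    and ind: "\<And>p. p \<in> I \<Longrightarrow> indep_vars L (\<lambda>k w. g p k (V p w)) J"
  shows "indep_vars (\<lambda>(p, k). L k) (\<lambda>(p, k) w. g p k (V p w)) (I \<times> J)"
proof (cases "I \<times> J = {}")
  case False
  then have ne: "I \<noteq> {}" "J \<noteq> {}" by auto
  let ?L = "\<lambda>(p, k). L k" and ?X = "\<lambda>(p, k) w. g p k (V p w)"
  have rvV: "\<And>p. p \<in> I \<Longrightarrow> V p \<in> measurable M (N p)" using V by (auto simp: indep_vars_def)
  show ?thesis
  proof (subst indep_vars_finite[where E = "\<lambda>z. sets (?L z)"])
    show "\<And>z. z \<in> I \<times> J \<Longrightarrow> sets (?L z) = sigma_sets (space (?L z)) (sets (?L z))"
      by (auto simp: sets.sigma_sets_eq)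
    show "\<And>z. z \<in> I \<times> J \<Longrightarrow> ?X z \<in> measurable M (?L z)"
      using measurable_compose[OF rvV g] by auto
    show "\<And>z. z \<in> I \<times> J \<Longrightarrow> Int_stable (sets (?L z))" by (auto simp: Int_stable_def)
    show "\<And>z. z \<in> I \<times> J \<Longrightarrow> sets (?L z) \<subseteq> Pow (space (?L z))" using sets.space_closed by auto
    show "\<forall>A\<in>\<Pi> z\<in>I \<times> J. sets (?L z). prob (\<Inter>z\<in>I \<times> J. ?X z -` A z \<inter> space M) = (\<Prod>z\<in>I \<times> J. prob (?X z -` A z \<inter> space M))"
    proof
      fix A assume A: "A \<in> (\<Pi> z\<in>I \<times> J. sets (?L z))"
      then have A': "A (p, k) \<in> sets (L k)" if "p \<in> I" "k \<in> J" for p k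
        using Pi_mem[OF A, of "(p, k)"] that by simp
      \<comment> \<open>All conditions on process p are gathered into one event in its path space.
        Independence is applied first across p to these events and then across k inside each of
        them.\<close>
      define S where "S p = (\<Inter>k\<in>J. g p k -` A (p, k) \<inter> space (N p))" for p
      have S: "S p \<in> sets (N p)" if "p \<in> I" for p
        unfolding S_def using that fin ne by (intro sets.finite_INT measurable_sets[OF g] A') auto
      have pre: "V p -` S p \<inter> space M = (\<Inter>k\<in>J. (\<lambda>w. g p k (V p w)) -` A (p, k) \<inter> space M)" if "p \<in> I" for p
        unfolding S_def using measurable_space[OF rvV[OF that]] ne by auto
      have "(\<Inter>z\<in>I \<times> J. ?X z -` A z \<inter> space M) = (\<Inter>p\<in>I. V p -` S p \<inter> space M)"
        using ne pre by auto
      then have "prob (\<Inter>z\<in>I \<times> J. ?X z -` A z \<inter> space M) = (\<Prod>p\<in>I. prob (V p -` S p \<inter> space M))"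
        using indep_varsD_finite[OF V ne(1) fin(1), of S] S by simp
      also have "\<dots> = (\<Prod>p\<in>I. \<Prod>k\<in>J. prob ((\<lambda>w. g p k (V p w)) -` A (p, k) \<inter> space M))"
      proof (intro prod.cong refl)
        fix p assume p: "p \<in> I"
        show "prob (V p -` S p \<inter> space M) = (\<Prod>k\<in>J. prob ((\<lambda>w. g p k (V p w)) -` A (p, k) \<inter> space M))"
          unfolding pre[OF p] by (intro indep_varsD_finite[OF ind[OF p] ne(2) fin(2)] A' p)
      qed
      finally show "prob (\<Inter>z\<in>I \<times> J. ?X z -` A z \<inter> space M) = (\<Prod>z\<in>I \<times> J. prob (?X z -` A z \<inter> space M))"
        by (simp add: prod.cartesian_product split_beta)
    qed
  qed (use fin False in auto)
next
  case True
  show ?thesis unfolding True by (simp add: indep_vars_def indep_sets_def)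
qed

section \<open>Step function approximation of stochastic integrals\<close>

text \<open>The bound via the maximum also covers q < 1, where Minkowski's inequality fails; 4 = 2
  powr 2 serves all q at once.\<close>

lemma powr_add_le:
  fixes x y q :: real
  assumes "0 \<le> x" "0 \<le> y" "0 < q" "q \<le> 2"
  shows "(x + y) powr q \<le> 4 * x powr q + 4 * y powr q"
proof -
  have "(x + y) powr q \<le> (2 * max x y) powr q" using assms by (intro powr_mono2) auto
  also have "\<dots> = 2 powr q * max x y powr q" using assms by (simp add: powr_mult)
  also have "\<dots> \<le> 2 powr 2 * max x y powr q" using assms by (intro mult_right_mono powr_mono) auto
  also have "\<dots> \<le> 4 * x powr q + 4 * y powr q" by (auto simp: max_def)
  finally show ?thesis .
qed

text \<open>The factor of x^2 can be taken arbitrarily close to 1, unlike the 4 in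
  \<open>powr_add_le\<close>. This precision matters because \<sigma>^2 enters the exponent of the
  second claim.\<close>

lemma sq_add_le:
  fixes x y \<rho> :: real
  assumes "0 < \<rho>"
  shows "(x + y)\<^sup>2 \<le> (1 + \<rho>) * x\<^sup>2 + (1 + 1 / \<rho>) * y\<^sup>2"
proof -
  have "0 \<le> (\<rho> * x - y)\<^sup>2 / \<rho>" using assms by simp
  also have "\<dots> = \<rho> * x\<^sup>2 + 1 / \<rho> * y\<^sup>2 - 2 * x * y"
    using assms by (simp add: power2_diff field_simps power2_eq_square)
  finally show ?thesis by (simp add: power2_sum algebra_simps)
qed

section \<open>Integrals of step functions and shifted kernels\<close>

lemma step_function_measurable [measurable]:
  "step_function (\<xi> :: (real \<times> real \<times> 'b::euclidean_space) list) \<in> borel_measurable lebesgue"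
proof (induction \<xi>)
  case (Cons x \<xi>)
  obtain a b c where "x = (a, b, c)" by (cases x)
  then have "step_function (x # \<xi>) = (\<lambda>s. indicator {a<..b} s *\<^sub>R c + step_function \<xi> s)"
    by (simp add: step_function_def fun_eq_iff)
  then show ?case using Cons
    by (auto intro!: borel_measurable_add borel_measurable_scaleR borel_measurable_indicator)
qed (simp add: step_function_def)

lemma step_integral_measurable [measurable]:
  fixes \<xi> :: "(real \<times> real \<times> 'b::euclidean_space) list"
  assumes [measurable]: "\<And>t. Z t \<in> borel_measurable M"
  shows "step_integral Z \<xi> \<in> borel_measurable M"
proof (induction \<xi>)
  case (Cons x \<xi>)
  obtain a b c where "x = (a, b, c)" by (cases x)
  then have "step_integral Z (x # \<xi>) = (\<lambda>w. (Z b w - Z a w) *\<^sub>R c + step_integral Z \<xi> w)"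
    by (simp add: step_integral_def fun_eq_iff)
  then show ?case using Cons by simp
qed (simp add: step_integral_def)

lemma shift_measurable_lebesgue:
  fixes k :: "real \<Rightarrow> 'b::euclidean_space"
  assumes "k \<in> borel_measurable lebesgue"
  shows "(\<lambda>x. k (x - t)) \<in> borel_measurable lebesgue"
proof -
  have "(\<lambda>x. x - t) \<in> lebesgue \<rightarrow>\<^sub>M lebesgue"
    using lebesgue_affine_measurable[where c = "\<lambda>_::real. 1" and t = "- t"] by simp
  then show ?thesis using assms by (rule measurable_compose)
qed

lemma nn_integral_powr_left_tail:
  fixes e s t :: real
  assumes e: "e < - 1" and st: "s < t"
  shows "(\<integral>\<^sup>+x. ennreal ((t - x) powr e) * indicator {..s} x \<partial>lebesgue) = ennreal ((t - s) powr (e + 1) / (- e - 1))"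
proof -
  have "(\<integral>\<^sup>+x. ennreal ((t - x) powr e) * indicator {..s} x \<partial>lebesgue)
      = (\<integral>\<^sup>+x. ennreal ((t - x) powr e) * indicator {..s} x \<partial>lborel)"
    by (rule nn_integral_completion)
  also have "\<dots> = (\<integral>\<^sup>+y. ennreal (y powr e) * indicator {t - s..} y \<partial>lborel)"
    by (subst nn_integral_real_affine[where c = "- 1" and t = t])
      (auto intro!: nn_integral_cong simp: indicator_def)
  also have "\<dots> = ennreal (- ((t - s) powr (e + 1)) / (e + 1))"
    using has_integral_powr_to_inf[OF e, of "t - s"] st
    by (intro nn_integral_has_integral_lebesgue') auto
  also have "- ((t - s) powr (e + 1)) / (e + 1) = (t - s) powr (e + 1) / (- e - 1)"
    by (metis minus_add_distrib minus_divide_left minus_divide_right uminus_add_conv_diff add.commute)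
  finally show ?thesis .
qed

lemma nn_integral_shift_lebesgue:
  fixes k :: "real \<Rightarrow> 'b::euclidean_space"
  assumes "in_L q k"
  shows "(\<integral>\<^sup>+x. ennreal (norm (k (x - t)) powr q) \<partial>lebesgue) = ennreal (\<integral>x. norm (k x) powr q \<partial>lebesgue)"
proof -
  have [measurable]: "k \<in> borel_measurable lebesgue" using assms by (simp add: in_L_def)
  have "(\<integral>\<^sup>+x. ennreal (norm (k (x - t)) powr q) \<partial>lebesgue)
      = ennreal \<bar>1\<bar> * (\<integral>\<^sup>+x. ennreal (norm (k (t + 1 * x - t)) powr q) \<partial>lebesgue)"
    using shift_measurable_lebesgue[of k t] by (intro nn_integral_real_affine_lebesgue) auto
  also have "\<dots> = ennreal (\<integral>x. norm (k x) powr q \<partial>lebesgue)"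
    using assms by (simp add: in_L_def nn_integral_eq_integral)
  finally show ?thesis .
qed

text \<open>Source of the decay in t - s. To the left of s the distance to t is at least 1, so the
  exponent \<delta> q may be raised to e, which lets one exponent serve all processes. Integrating
  turns e into e + 1 < - 1; the factor 1 / (- e - 1) is below 1.\<close>

lemma nn_integral_kernel_left_tail:
  fixes k :: "real \<Rightarrow> 'b::euclidean_space"
  assumes k: "\<And>x. norm (k x) \<le> K * \<bar>x\<bar> powr \<delta>" and q: "0 < q" and e: "\<delta> * q \<le> e" "e < - 2"
    and st: "1 \<le> t - s"
  shows "(\<integral>\<^sup>+x. ennreal (norm (k (x - t)) powr q) * indicator {..s} x \<partial>lebesgue)
    \<le> ennreal (\<bar>K\<bar> powr q * (t - s) powr (e + 1))"
proof -
  have "(\<integral>\<^sup>+x. ennreal (norm (k (x - t)) powr q) * indicator {..s} x \<partial>lebesgue)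
      \<le> (\<integral>\<^sup>+x. ennreal (\<bar>K\<bar> powr q) * (ennreal ((t - x) powr e) * indicator {..s} x) \<partial>lebesgue)"
  proof (intro nn_integral_mono)
    fix x
    have "norm (k (x - t)) powr q \<le> \<bar>K\<bar> powr q * (t - x) powr e" if "x \<le> s"
    proof -
      have "norm (k (x - t)) \<le> \<bar>K\<bar> * \<bar>x - t\<bar> powr \<delta>"
        using k[of "x - t"] by (meson abs_ge_self mult_right_mono order_trans powr_ge_zero)
      then have "norm (k (x - t)) powr q \<le> (\<bar>K\<bar> * \<bar>x - t\<bar> powr \<delta>) powr q"
        using q by (intro powr_mono2) auto
      also have "\<dots> = \<bar>K\<bar> powr q * (t - x) powr (\<delta> * q)"
        using that st by (simp add: powr_mult powr_powr abs_if)
      also have "\<dots> \<le> \<bar>K\<bar> powr q * (t - x) powr e"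
        using that st e by (intro mult_left_mono powr_mono) auto
      finally show ?thesis .
    qed
    then show "ennreal (norm (k (x - t)) powr q) * indicator {..s} x
        \<le> ennreal (\<bar>K\<bar> powr q) * (ennreal ((t - x) powr e) * indicator {..s} x)"
      by (auto simp: indicator_def ennreal_leI simp flip: ennreal_mult)
  qed
  also have "\<dots> = ennreal (\<bar>K\<bar> powr q) * (\<integral>\<^sup>+x. ennreal ((t - x) powr e) * indicator {..s} x \<partial>lebesgue)"
    unfolding nn_integral_completion by (intro nn_integral_cmult) auto
  also have "\<dots> = ennreal (\<bar>K\<bar> powr q) * ennreal ((t - s) powr (e + 1) / (- e - 1))"
    using e st by (subst nn_integral_powr_left_tail) auto
  also have "\<dots> = ennreal (\<bar>K\<bar> powr q * ((t - s) powr (e + 1) / (- e - 1)))"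
    using e by (simp flip: ennreal_mult)
  also have "\<dots> \<le> ennreal (\<bar>K\<bar> powr q * (t - s) powr (e + 1))"
  proof (intro ennreal_leI mult_left_mono)
    have "(t - s) powr (e + 1) / (- e - 1) \<le> (t - s) powr (e + 1) / 1"
      using e by (intro divide_left_mono) auto
    then show "(t - s) powr (e + 1) / (- e - 1) \<le> (t - s) powr (e + 1)" by simp
  qed simp
  finally show ?thesis .
qed

lemma nn_integral_approx_powr_le:
  fixes \<phi> \<psi> :: "real \<Rightarrow> 'b::euclidean_space"
  assumes [measurable]: "\<phi> \<in> borel_measurable lebesgue" "\<psi> \<in> borel_measurable lebesgue" "S \<in> sets lebesgue"
    and q: "0 < q" "q \<le> 2"
    and \<psi>: "(\<integral>\<^sup>+x. ennreal (norm (\<psi> x) powr q) * indicator S x \<partial>lebesgue) \<le> ennreal v" "0 \<le> v"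
    and err: "(\<integral>\<^sup>+x. ennreal (norm (\<phi> x - \<psi> x) powr q) \<partial>lebesgue) \<le> ennreal \<epsilon>" "0 \<le> \<epsilon>"
  shows "(\<integral>\<^sup>+x. ennreal (norm (\<phi> x) powr q) * indicator S x \<partial>lebesgue) \<le> ennreal (4 * v + 4 * \<epsilon>)"
proof -
  have "(\<integral>\<^sup>+x. ennreal (norm (\<phi> x) powr q) * indicator S x \<partial>lebesgue)
      \<le> (\<integral>\<^sup>+x. ennreal 4 * (ennreal (norm (\<psi> x) powr q) * indicator S x) + ennreal 4 * ennreal (norm (\<phi> x - \<psi> x) powr q) \<partial>lebesgue)"
  proof (intro nn_integral_mono)
    fix x
    have "norm (\<phi> x) powr q \<le> (norm (\<psi> x) + norm (\<phi> x - \<psi> x)) powr q"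
      using q norm_triangle_ineq[of "\<psi> x" "\<phi> x - \<psi> x"] by (intro powr_mono2) auto
    also have "\<dots> \<le> 4 * norm (\<psi> x) powr q + 4 * norm (\<phi> x - \<psi> x) powr q"
      using q by (intro powr_add_le) auto
    finally show "ennreal (norm (\<phi> x) powr q) * indicator S x
        \<le> ennreal 4 * (ennreal (norm (\<psi> x) powr q) * indicator S x) + ennreal 4 * ennreal (norm (\<phi> x - \<psi> x) powr q)"
      by (auto simp: indicator_def ennreal_leI simp flip: ennreal_mult ennreal_plus simp del: ennreal_numeral)
  qed
  also have "\<dots> = ennreal 4 * (\<integral>\<^sup>+x. ennreal (norm (\<psi> x) powr q) * indicator S x \<partial>lebesgue)
      + ennreal 4 * (\<integral>\<^sup>+x. ennreal (norm (\<phi> x - \<psi> x) powr q) \<partial>lebesgue)"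
    by (subst nn_integral_add, measurable, subst (1 2) nn_integral_cmult) auto
  also have "\<dots> \<le> ennreal 4 * ennreal v + ennreal 4 * ennreal \<epsilon>"
    by (intro add_mono mult_left_mono \<psi> err) auto
  also have "\<dots> = ennreal (4 * v + 4 * \<epsilon>)"
    using \<psi>(2) err(2) by (simp flip: ennreal_mult ennreal_plus del: ennreal_numeral)
  finally show ?thesis .
qed

text \<open>The sharp counterpart of \<open>nn_integral_approx_powr_le\<close> for Gaussian kernels:
  v is multiplied by 1 + \<rho> only, at the price of 1 + 1 / \<rho> on the approximation
  error.\<close>

lemma nn_integral_approx_component_le:
  fixes \<phi> \<psi> :: "real \<Rightarrow> real ^ 'd"
  assumes [measurable]: "\<phi> \<in> borel_measurable lebesgue" "\<psi> \<in> borel_measurable lebesgue"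
    and \<rho>: "0 < \<rho>"
    and \<psi>: "(\<integral>\<^sup>+x. ennreal ((\<psi> x $ l)\<^sup>2) \<partial>lebesgue) \<le> ennreal v" "0 \<le> v"
    and err: "(\<integral>\<^sup>+x. ennreal (norm (\<phi> x - \<psi> x) powr 2) \<partial>lebesgue) \<le> ennreal \<epsilon>" "0 \<le> \<epsilon>"
  shows "(\<integral>\<^sup>+x. ennreal ((\<phi> x $ l)\<^sup>2) \<partial>lebesgue) \<le> ennreal ((1 + \<rho>) * v + (1 + 1 / \<rho>) * \<epsilon>)"
proof -
  have comp: "(\<lambda>x. \<psi> x $ l) \<in> borel_measurable lebesgue"
    by (rule measurable_compose[OF _ borel_measurable_continuous_onI]) (auto intro: continuous_intros)
  note [measurable] = comp
  have "(\<integral>\<^sup>+x. ennreal ((\<phi> x $ l)\<^sup>2) \<partial>lebesgue)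
      \<le> (\<integral>\<^sup>+x. ennreal (1 + \<rho>) * ennreal ((\<psi> x $ l)\<^sup>2) + ennreal (1 + 1 / \<rho>) * ennreal (norm (\<phi> x - \<psi> x) powr 2) \<partial>lebesgue)"
  proof (intro nn_integral_mono)
    fix x
    have "(\<phi> x $ l)\<^sup>2 = (\<psi> x $ l + (\<phi> x - \<psi> x) $ l)\<^sup>2" by simp
    also have "\<dots> \<le> (1 + \<rho>) * (\<psi> x $ l)\<^sup>2 + (1 + 1 / \<rho>) * ((\<phi> x - \<psi> x) $ l)\<^sup>2"
      using \<rho> by (rule sq_add_le)
    also have "((\<phi> x - \<psi> x) $ l)\<^sup>2 \<le> norm (\<phi> x - \<psi> x) powr 2"
      using power_mono[OF component_le_norm_cart[of "\<phi> x - \<psi> x" l], of 2] by simp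
    finally show "ennreal ((\<phi> x $ l)\<^sup>2)
        \<le> ennreal (1 + \<rho>) * ennreal ((\<psi> x $ l)\<^sup>2) + ennreal (1 + 1 / \<rho>) * ennreal (norm (\<phi> x - \<psi> x) powr 2)"
      using \<rho> by (simp add: ennreal_leI mult_left_mono flip: ennreal_mult ennreal_plus)
  qed
  also have "\<dots> = ennreal (1 + \<rho>) * (\<integral>\<^sup>+x. ennreal ((\<psi> x $ l)\<^sup>2) \<partial>lebesgue)
      + ennreal (1 + 1 / \<rho>) * (\<integral>\<^sup>+x. ennreal (norm (\<phi> x - \<psi> x) powr 2) \<partial>lebesgue)"
    by (subst nn_integral_add, measurable, subst (1 2) nn_integral_cmult) auto
  also have "\<dots> \<le> ennreal (1 + \<rho>) * ennreal v + ennreal (1 + 1 / \<rho>) * ennreal \<epsilon>"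
    by (intro add_mono mult_left_mono \<psi> err) auto
  also have "\<dots> = ennreal ((1 + \<rho>) * v + (1 + 1 / \<rho>) * \<epsilon>)"
    using \<psi>(2) err(2) \<rho> by (simp flip: ennreal_mult ennreal_plus)
  finally show ?thesis .
qed

section \<open>From convergence in probability to closeness in a truncated mean\<close>

context prob_space
begin

text \<open>The truncated distance is at most \<epsilon> off the exceptional event and at most 1 on
  it.\<close>

lemma tendsto_in_probability_imp_tendsto_min:
  fixes Y :: "'a \<Rightarrow> 'b::euclidean_space"
  assumes tip: "tendsto_in_probability M Ys Y"
    and [measurable]: "\<And>m. Ys m \<in> borel_measurable M" "Y \<in> borel_measurable M"
  shows "(\<lambda>m. \<integral>w. min 1 (norm (Ys m w - Y w)) \<partial>M) \<longlonglongrightarrow> 0"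
proof (rule LIMSEQ_I)
  fix r :: real assume r: "0 < r"
  define \<epsilon> where "\<epsilon> = r / 2"
  let ?A = "\<lambda>m. {w \<in> space M. norm (Ys m w - Y w) > \<epsilon>}"
  have "\<epsilon> > 0" using r by (simp add: \<epsilon>_def)
  then have "(\<lambda>m. prob (?A m)) \<longlonglongrightarrow> 0" using tip by (simp add: tendsto_in_probability_def)
  then obtain N where "\<forall>m\<ge>N. norm (prob (?A m) - 0) < \<epsilon>"
    using LIMSEQ_D \<open>\<epsilon> > 0\<close> by blast
  then have N: "prob (?A m) < \<epsilon>" if "m \<ge> N" for m
    using that by simp
  have "norm ((\<integral>w. min 1 (norm (Ys m w - Y w)) \<partial>M) - 0) < r" if "m \<ge> N" for m
  proof -
    have "(\<integral>w. min 1 (norm (Ys m w - Y w)) \<partial>M) \<le> (\<integral>w. \<epsilon> + indicator (?A m) w \<partial>M)"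
    proof (intro integral_mono)
      show "integrable M (\<lambda>w. min 1 (norm (Ys m w - Y w)))"
        by (intro integrable_const_bound[where B=1]) auto
      show "integrable M (\<lambda>w. \<epsilon> + indicator (?A m) w)"
        by (intro Bochner_Integration.integrable_add) (auto simp: less_top[symmetric])
      show "min 1 (norm (Ys m w - Y w)) \<le> \<epsilon> + indicator (?A m) w" if "w \<in> space M" for w
        using that \<open>\<epsilon> > 0\<close> by (auto simp: indicator_def)
    qed
    also have "\<dots> = \<epsilon> + prob (?A m)"
      by (subst Bochner_Integration.integral_add) (auto simp: prob_space less_top[symmetric])
    also have "\<dots> < r" using N[OF that] by (simp add: \<epsilon>_def)
    finally have "(\<integral>w. min 1 (norm (Ys m w - Y w)) \<partial>M) < r" .
    moreover have "0 \<le> (\<integral>w. min 1 (norm (Ys m w - Y w)) \<partial>M)" by (intro integral_nonneg_AE) auto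
    ultimately show ?thesis by simp
  qed
  then show "\<exists>N. \<forall>m\<ge>N. norm ((\<integral>w. min 1 (norm (Ys m w - Y w)) \<partial>M) - 0) < r" by blast
qed

text \<open>One step function has to be good in both senses: as an integrand, to control
  coefficients, and through its integral, to control X.\<close>

lemma stochastic_integral_approx:
  fixes k :: "real \<Rightarrow> 'b::euclidean_space"
  assumes int: "has_stochastic_integral M p Z S k Y" and Z: "\<And>t. Z t \<in> borel_measurable M" and \<epsilon>: "0 < \<epsilon>"
  shows "\<exists>\<xi>. (\<forall>(u, v, c) \<in> set \<xi>. u < v) \<and>
    (\<integral>\<^sup>+s. ennreal (norm (step_function \<xi> s - indicator S s *\<^sub>R k s) powr p) \<partial>lebesgue) \<le> ennreal \<epsilon> \<and>
    (\<integral>w. min 1 (norm (step_integral Z \<xi> w - Y w)) \<partial>M) \<le> \<epsilon>"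
proof -
  obtain \<xi> where \<xi>: "\<And>m. \<forall>(u, v, c) \<in> set (\<xi> m). u < v"
    and L: "(\<lambda>m. \<integral>\<^sup>+s. ennreal (norm (step_function (\<xi> m) s - indicator S s *\<^sub>R k s) powr p) \<partial>lebesgue) \<longlonglongrightarrow> 0"
    and P: "tendsto_in_probability M (\<lambda>m. step_integral Z (\<xi> m)) Y"
    and Y: "Y \<in> borel_measurable M"
    using int by (auto simp: has_stochastic_integral_def)
  have "\<forall>\<^sub>F m in sequentially. (\<integral>\<^sup>+s. ennreal (norm (step_function (\<xi> m) s - indicator S s *\<^sub>R k s) powr p) \<partial>lebesgue) < ennreal \<epsilon>"
    using L \<epsilon> by (intro order_tendstoD) auto
  moreover have "\<forall>\<^sub>F m in sequentially. (\<integral>w. min 1 (norm (step_integral Z (\<xi> m) w - Y w)) \<partial>M) < \<epsilon>"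
    using tendsto_in_probability_imp_tendsto_min[OF P step_integral_measurable[OF Z] Y] \<epsilon>
    by (intro order_tendstoD) auto
  ultimately have "\<forall>\<^sub>F m in sequentially.
      (\<integral>\<^sup>+s. ennreal (norm (step_function (\<xi> m) s - indicator S s *\<^sub>R k s) powr p) \<partial>lebesgue) < ennreal \<epsilon> \<and>
      (\<integral>w. min 1 (norm (step_integral Z (\<xi> m) w - Y w)) \<partial>M) < \<epsilon>"
    by (rule eventually_conj)
  then obtain m where "(\<integral>\<^sup>+s. ennreal (norm (step_function (\<xi> m) s - indicator S s *\<^sub>R k s) powr p) \<partial>lebesgue) < ennreal \<epsilon> \<and>
      (\<integral>w. min 1 (norm (step_integral Z (\<xi> m) w - Y w)) \<partial>M) < \<epsilon>"
    unfolding eventually_sequentially by blast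
  then show ?thesis using \<xi> by (intro exI[of _ "\<xi> m"]) (auto intro: less_imp_le)
qed

end

section \<open>The moving average array\<close>

lemma le_of_le_add_small:
  fixes x y C :: real
  assumes "0 \<le> C" and "\<And>e. 0 < e \<Longrightarrow> e \<le> 1 \<Longrightarrow> x \<le> y + C * e"
  shows "x \<le> y"
proof (rule field_le_epsilon)
  fix r :: real assume r: "0 < r"
  define e where "e = min 1 (r / (C + 1))"
  have e: "0 < e" "e \<le> 1" using r assms(1) by (auto simp: e_def)
  have "C * e \<le> C * (r / (C + 1))" using assms(1) by (intro mult_left_mono) (auto simp: e_def)
  also have "\<dots> \<le> r" using assms(1) r by (simp add: field_simps)
  finally show "x \<le> y + r" using assms(2)[OF e] by linarith
qed

text \<open>\<open>\<Phi>\<close> controls \<open>f\<close> in the Gaussian direction; the stable part only enters through its truncated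
  square.\<close>

definition dominated :: "(real ^ 'd \<Rightarrow> real) \<Rightarrow> (real ^ 'd \<Rightarrow> real) \<Rightarrow> real \<Rightarrow> bool" where
  "dominated f \<Phi> C0 \<longleftrightarrow> admissible f \<and> \<Phi> \<in> borel_measurable borel \<and> (\<forall>y. 0 \<le> \<Phi> y) \<and> 0 \<le> C0 \<and>
     (\<forall>y z. \<bar>f (y + z)\<bar> \<le> \<Phi> y + C0 * min 1 ((norm z)\<^sup>2))"

text \<open>Isolates the Gaussian estimates in which the two claims differ. It quantifies over all
  noise models because the grid changes with the accuracy while C1, T and p must not. Of the two
  variance bounds on x, the one with c is crude and matches the bound on u; the one with v is sharp,
  v being any number above \<sigma>^2, and governs the exponential rate.\<close>

definition weight_bound ::
  "'w measure \<Rightarrow> (real ^ 'd \<Rightarrow> real) \<Rightarrow> real \<Rightarrow> real \<Rightarrow> real \<Rightarrow> real \<Rightarrow> real \<Rightarrow> real \<Rightarrow> bool" where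
  "weight_bound M \<Phi> c v A C1 T p \<longleftrightarrow>
     0 \<le> p \<and> p \<le> C1 \<and> p * A \<le> C1 * T \<and>
     (\<forall>IG IL (D :: (nat + nat) \<times> nat \<Rightarrow> 'w \<Rightarrow> real) \<tau> \<beta> x (u :: _ \<Rightarrow> real ^ 'd) \<kappa>.
        noise M IG IL D \<tau> \<beta> \<longrightarrow> 0 < \<kappa> \<longrightarrow> noise.gauss_var_le IG \<tau> x (c * A) \<longrightarrow> noise.gauss_var_le IG \<tau> x (v * A) \<longrightarrow>
        noise.gauss_var_le IG \<tau> u (c * \<kappa> * A) \<longrightarrow>
        (\<integral>\<^sup>+w. ennreal (\<Phi> (noise.lin D IG x w) * (norm (noise.lin D IG u w))\<^sup>2) \<partial>M) \<le> ennreal (C1 * \<kappa> * T) \<and>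
        (\<integral>\<^sup>+w. ennreal (\<Phi> (noise.lin D IG x w)) \<partial>M) \<le> ennreal p)"

section \<open>The array and its approximation by step functions\<close>

locale moving_average = prob_space M
  for M :: "'w measure" +
  fixes q1 q2 :: nat
    and a b :: "nat \<Rightarrow> nat \<Rightarrow> real"
    and B Z :: "nat \<Rightarrow> real \<Rightarrow> 'w \<Rightarrow> real"
    and h g :: "nat \<Rightarrow> real \<Rightarrow> real ^ 'd"
    and \<beta> \<delta> :: "nat \<Rightarrow> real"
    and \<delta>0 \<sigma> K :: real
    and IB IZ :: "nat \<Rightarrow> nat \<Rightarrow> 'w \<Rightarrow> real ^ 'd"
    and X :: "nat \<Rightarrow> nat \<Rightarrow> 'w \<Rightarrow> real ^ 'd"
  assumes B: "\<And>i. i \<in> {1..q1} \<Longrightarrow> brownian_motion M (B i)"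
    and \<beta>: "\<And>j. j \<in> {1..q2} \<Longrightarrow> 0 < \<beta> j \<and> \<beta> j < 2"
    and Z: "\<And>j. j \<in> {1..q2} \<Longrightarrow> symmetric_stable_motion M (\<beta> j) (Z j)"
    and indep: "independent_processes M {1..q1} B {1..q2} Z"
    and h_L: "\<And>i. i \<in> {1..q1} \<Longrightarrow> in_L 2 (h i)"
    and h_le: "\<And>i x. i \<in> {1..q1} \<Longrightarrow> norm (h i x) \<le> K * \<bar>x\<bar> powr \<delta>0"
    and h_\<sigma>: "\<And>i l. i \<in> {1..q1} \<Longrightarrow> sqrt (\<integral>x. (h i x $ l)\<^sup>2 \<partial>lebesgue) \<le> \<sigma>"
    and g_L: "\<And>j. j \<in> {1..q2} \<Longrightarrow> in_L (\<beta> j) (g j)"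
    and g_le: "\<And>j x. j \<in> {1..q2} \<Longrightarrow> norm (g j x) \<le> K * \<bar>x\<bar> powr \<delta> j"
    and a: "\<And>n i. i \<in> {1..q1} \<Longrightarrow> 0 \<le> a n i"
    and b: "\<And>n j. j \<in> {1..q2} \<Longrightarrow> 0 \<le> b n j"
    and IB: "\<And>i t. i \<in> {1..q1} \<Longrightarrow>
           has_stochastic_integral M 2 (B i) {..real t} (\<lambda>s. h i (s - real t)) (IB i t)"
    and IZ: "\<And>j t. j \<in> {1..q2} \<Longrightarrow>
           has_stochastic_integral M (\<beta> j) (Z j) {..real t} (\<lambda>s. g j (s - real t)) (IZ j t)"
    and X: "\<And>t n w. w \<in> space M \<Longrightarrow>
           X t n w = (\<Sum>i = 1..q1. a n i *\<^sub>R IB i t w) + (\<Sum>j = 1..q2. b n j *\<^sub>R IZ j t w)"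
    and decay: "Max (insert (2 * \<delta>0) ((\<lambda>j. \<delta> j * \<beta> j) ` {1..q2})) < - 2"
begin

text \<open>Brownian and stable processes are merged into one family over a disjoint sum, with index
  2 for Brownian motion, so that kernel estimates in L_p treat both kinds together.\<close>

definition procs :: "(nat + nat) set" where "procs = Inl ` {1..q1} \<union> Inr ` {1..q2}"
definition W :: "nat + nat \<Rightarrow> real \<Rightarrow> 'w \<Rightarrow> real" where "W = case_sum B Z"
definition stab :: "nat + nat \<Rightarrow> real" where "stab = case_sum (\<lambda>_. 2) \<beta>"
definition ker :: "nat + nat \<Rightarrow> real \<Rightarrow> real ^ 'd" where "ker = case_sum h g"
definition Y :: "nat + nat \<Rightarrow> nat \<Rightarrow> 'w \<Rightarrow> real ^ 'd" where "Y = case_sum IB IZ"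
definition wt :: "nat \<Rightarrow> nat + nat \<Rightarrow> real" where "wt n = case_sum (a n) (b n)"
definition dmax :: real where "dmax = Max (insert (2 * \<delta>0) ((\<lambda>j. \<delta> j * \<beta> j) ` {1..q2}))"
definition asum :: "nat \<Rightarrow> real" where "asum n = (\<Sum>i = 1..q1. (a n i)\<^sup>2)"
definition bsum :: "nat \<Rightarrow> real" where "bsum n = (\<Sum>j = 1..q2. b n j powr \<beta> j)"
definition kernel_total :: real where "kernel_total = (\<Sum>p\<in>procs. \<integral>x. norm (ker p x) powr stab p \<partial>lebesgue)"
definition tail_const :: real where "tail_const = (\<Sum>p\<in>procs. \<bar>K\<bar> powr stab p)"
text \<open>The 4 is that of \<open>nn_integral_approx_powr_le\<close>; \<open>kernel_total\<close>
  bounds integrals over the whole line, \<open>tail_const\<close> those over the past, and 1 absorbs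
  the approximation error.\<close>

definition coef_const :: real where "coef_const = 4 * (kernel_total + tail_const + 1)"

lemma finite_procs: "finite procs" by (simp add: procs_def)

lemma nonneg: "0 \<le> asum n" "0 \<le> bsum n" "0 \<le> kernel_total" "0 \<le> tail_const" "0 \<le> coef_const"
proof -
  show 1: "0 \<le> asum n" "0 \<le> bsum n" "0 \<le> kernel_total" "0 \<le> tail_const"
    by (auto simp: asum_def bsum_def kernel_total_def tail_const_def intro!: sum_nonneg)
  then show "0 \<le> coef_const" by (simp add: coef_const_def)
qed

lemma stab: "p \<in> procs \<Longrightarrow> 0 < stab p" "p \<in> procs \<Longrightarrow> stab p \<le> 2"
  using \<beta> by (auto simp: procs_def stab_def less_imp_le)

lemma wt_nonneg: "p \<in> procs \<Longrightarrow> 0 \<le> wt n p"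
  using a b by (auto simp: procs_def wt_def)

lemma W_measurable [measurable]: "p \<in> procs \<Longrightarrow> W p t \<in> borel_measurable M"
  using B Z by (auto simp: procs_def W_def brownian_motion_def symmetric_stable_motion_def)

lemma ker_L: "p \<in> procs \<Longrightarrow> in_L (stab p) (ker p)"
  using h_L g_L by (auto simp: procs_def stab_def ker_def)

lemma ker_measurable: "p \<in> procs \<Longrightarrow> ker p \<in> borel_measurable lebesgue"
  using ker_L by (simp add: in_L_def)

lemma ker_le: "p \<in> procs \<Longrightarrow> \<exists>\<delta>'. (\<forall>x. norm (ker p x) \<le> K * \<bar>x\<bar> powr \<delta>') \<and> \<delta>' * stab p \<le> dmax"
proof -
  assume "p \<in> procs"
  then consider i where "i \<in> {1..q1}" "p = Inl i" | j where "j \<in> {1..q2}" "p = Inr j"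
    by (auto simp: procs_def)
  then show ?thesis
  proof cases
    case 1
    then have "\<forall>x. norm (ker p x) \<le> K * \<bar>x\<bar> powr \<delta>0" "\<delta>0 * stab p \<le> dmax"
      using h_le by (simp_all add: ker_def stab_def dmax_def mult.commute)
    then show ?thesis by blast
  next
    case 2
    then have "\<delta> j * stab p \<le> dmax"
      unfolding dmax_def by (intro Max_ge) (auto simp: stab_def)
    moreover have "\<forall>x. norm (ker p x) \<le> K * \<bar>x\<bar> powr \<delta> j"
      using 2 g_le by (simp add: ker_def)
    ultimately show ?thesis by blast
  qed
qed

lemma dmax: "dmax < - 2" using decay by (simp add: dmax_def)

lemma Y_integral: "p \<in> procs \<Longrightarrow>
    has_stochastic_integral M (stab p) (W p) {..real t} (\<lambda>s. ker p (s - real t)) (Y p t)"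
  using IB IZ by (auto simp: procs_def stab_def W_def ker_def Y_def)

lemma Y_measurable [measurable]: "p \<in> procs \<Longrightarrow> Y p t \<in> borel_measurable M"
  using Y_integral by (auto simp: has_stochastic_integral_def)

lemma X_eq: "w \<in> space M \<Longrightarrow> X t n w = (\<Sum>p\<in>procs. wt n p *\<^sub>R Y p t w)"
  unfolding X procs_def
  by (subst sum.union_disjoint) (auto simp: sum.reindex wt_def Y_def)

lemma X_measurable [measurable]: "X t n \<in> borel_measurable M"
  by (subst measurable_cong[OF X_eq]) (auto intro!: borel_measurable_sum borel_measurable_scaleR)

lemma kernel_total_ge: "p \<in> procs \<Longrightarrow> (\<integral>x. norm (ker p x) powr stab p \<partial>lebesgue) \<le> kernel_total"
  unfolding kernel_total_def using finite_procs by (intro member_le_sum) auto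

lemma tail_const_ge: "p \<in> procs \<Longrightarrow> \<bar>K\<bar> powr stab p \<le> tail_const"
  unfolding tail_const_def using finite_procs by (intro member_le_sum) auto

definition approximates :: "real \<Rightarrow> nat \<Rightarrow> (nat + nat \<Rightarrow> (real \<times> real \<times> (real ^ 'd)) list) \<Rightarrow> bool" where
  "approximates \<epsilon> t \<xi> \<longleftrightarrow> (\<forall>p\<in>procs. (\<forall>(u, v, c) \<in> set (\<xi> p). u < v) \<and>
    (\<integral>\<^sup>+x. ennreal (norm (step_function (\<xi> p) x - indicator {..real t} x *\<^sub>R ker p (x - real t)) powr stab p) \<partial>lebesgue) \<le> ennreal \<epsilon> \<and>
    (\<integral>w. min 1 (norm (step_integral (W p) (\<xi> p) w - Y p t w)) \<partial>M) \<le> \<epsilon>)"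

lemma ex_approximates: "0 < \<epsilon> \<Longrightarrow> \<exists>\<xi>. approximates \<epsilon> t \<xi>"
  unfolding approximates_def
  by (intro bchoice ballI stochastic_integral_approx[OF Y_integral]) auto

definition Xapp :: "nat \<Rightarrow> (nat + nat \<Rightarrow> (real \<times> real \<times> (real ^ 'd)) list) \<Rightarrow> 'w \<Rightarrow> real ^ 'd" where
  "Xapp n \<xi> w = (\<Sum>p\<in>procs. wt n p *\<^sub>R step_integral (W p) (\<xi> p) w)"

lemma Xapp_measurable [measurable]: "Xapp n \<xi> \<in> borel_measurable M"
  unfolding Xapp_def[abs_def]
  by (intro borel_measurable_sum borel_measurable_scaleR step_integral_measurable) auto

lemma Xapp_close:
  assumes f: "admissible f" and \<xi>: "approximates \<epsilon> t \<xi>"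
  shows "(\<integral>w. \<bar>f (X t n w) - f (Xapp n \<xi> w)\<bar> \<partial>M) \<le> 2 * (\<Sum>p\<in>procs. 1 + wt n p) * \<epsilon>"
proof -
  have [measurable]: "f \<in> borel_measurable borel" using f by (rule admissible_measurable)
  let ?e = "\<lambda>p w. min 1 (norm (step_integral (W p) (\<xi> p) w - Y p t w))"
  have inte: "integrable M (?e p)" if "p \<in> procs" for p
    using that by (intro integrable_const_bound[where B=1]) (auto intro!: step_integral_measurable)
  have "(\<integral>w. \<bar>f (X t n w) - f (Xapp n \<xi> w)\<bar> \<partial>M) \<le> (\<integral>w. 2 * (\<Sum>p\<in>procs. (1 + wt n p) * ?e p w) \<partial>M)"
  proof (intro integral_mono)
    show "integrable M (\<lambda>w. \<bar>f (X t n w) - f (Xapp n \<xi> w)\<bar>)"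
    proof (intro integrable_const_bound[where B=2] AE_I2)
      fix w
      have "\<bar>f (X t n w)\<bar> \<le> 1" "\<bar>f (Xapp n \<xi> w)\<bar> \<le> 1" using f by (simp_all add: admissible_def)
      then show "norm \<bar>f (X t n w) - f (Xapp n \<xi> w)\<bar> \<le> 2" by simp
    qed measurable
    show "integrable M (\<lambda>w. 2 * (\<Sum>p\<in>procs. (1 + wt n p) * ?e p w))"
      by (intro integrable_mult_right Bochner_Integration.integrable_sum inte)
    fix w assume w: "w \<in> space M"
    let ?r = "norm (X t n w - Xapp n \<xi> w)"
    have "\<bar>f (X t n w)\<bar> \<le> 1" "\<bar>f (Xapp n \<xi> w)\<bar> \<le> 1" "\<bar>f (X t n w) - f (Xapp n \<xi> w)\<bar> \<le> ?r"
      using f by (simp_all add: admissible_def)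
    moreover have "\<bar>p\<bar> \<le> 1 \<Longrightarrow> \<bar>q\<bar> \<le> 1 \<Longrightarrow> \<bar>p - q\<bar> \<le> r \<Longrightarrow> \<bar>p - q\<bar> \<le> 2 * min 1 r" for p q r :: real
      by linarith
    ultimately have "\<bar>f (X t n w) - f (Xapp n \<xi> w)\<bar> \<le> 2 * min 1 ?r" by blast
    also have "min 1 ?r \<le> min 1 (\<Sum>p\<in>procs. wt n p * norm (step_integral (W p) (\<xi> p) w - Y p t w))"
    proof (intro min.mono order_refl)
      have "X t n w - Xapp n \<xi> w = (\<Sum>p\<in>procs. wt n p *\<^sub>R (Y p t w - step_integral (W p) (\<xi> p) w))"
        using w by (simp add: X_eq Xapp_def scaleR_diff_right sum_subtractf)
      then have "?r \<le> (\<Sum>p\<in>procs. norm (wt n p *\<^sub>R (Y p t w - step_integral (W p) (\<xi> p) w)))"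
        by (simp only: norm_sum)
      also have "\<dots> = (\<Sum>p\<in>procs. wt n p * norm (step_integral (W p) (\<xi> p) w - Y p t w))"
        using wt_nonneg by (intro sum.cong) (auto simp: norm_minus_commute)
      finally show "?r \<le> \<dots>" .
    qed
    also have "\<dots> \<le> (\<Sum>p\<in>procs. min 1 (wt n p * norm (step_integral (W p) (\<xi> p) w - Y p t w)))"
      using wt_nonneg finite_procs by (intro min_one_sum_le) auto
    also have "\<dots> \<le> (\<Sum>p\<in>procs. (1 + wt n p) * ?e p w)"
    proof (intro sum_mono)
      fix p assume p: "p \<in> procs"
      \<comment> \<open>The factor is 1 + w, since w alone fails when w < 1 and r is large.\<close>
      have "min 1 (w * r) \<le> (1 + w) * min 1 r" if "0 \<le> w" "0 \<le> r" for w r :: real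
        using that mult_nonneg_nonneg[of w r] by (auto simp: min_def algebra_simps)
      then show "min 1 (wt n p * norm (step_integral (W p) (\<xi> p) w - Y p t w)) \<le> (1 + wt n p) * ?e p w"
        using wt_nonneg[OF p] by simp
    qed
    finally show "\<bar>f (X t n w) - f (Xapp n \<xi> w)\<bar> \<le> 2 * (\<Sum>p\<in>procs. (1 + wt n p) * ?e p w)" by simp
  qed
  also have "\<dots> = 2 * (\<Sum>p\<in>procs. (1 + wt n p) * (\<integral>w. ?e p w \<partial>M))"
    using inte by (simp add: Bochner_Integration.integral_sum)
  also have "\<dots> \<le> 2 * (\<Sum>p\<in>procs. (1 + wt n p) * \<epsilon>)"
    using \<xi> wt_nonneg by (intro mult_left_mono sum_mono) (auto simp: approximates_def add_nonneg_nonneg)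
  finally show ?thesis by (simp only: sum_distrib_right mult.assoc)
qed

lemma step_norm_total:
  assumes \<xi>: "approximates \<epsilon> t \<xi>" and p: "p \<in> procs" and \<epsilon>: "0 \<le> \<epsilon>" "\<epsilon> \<le> 1" and S: "S \<in> sets lebesgue"
  shows "(\<integral>\<^sup>+x. ennreal (norm (step_function (\<xi> p) x) powr stab p) * indicator S x \<partial>lebesgue) \<le> ennreal coef_const"
proof -
  have [measurable]: "(\<lambda>x. ker p (x - real t)) \<in> borel_measurable lebesgue"
    by (intro shift_measurable_lebesgue ker_measurable p)
  have "(\<integral>\<^sup>+x. ennreal (norm (step_function (\<xi> p) x) powr stab p) * indicator S x \<partial>lebesgue) \<le> ennreal (4 * kernel_total + 4 * \<epsilon>)"
  proof (rule nn_integral_approx_powr_le[where \<psi> = "\<lambda>x. indicator {..real t} x *\<^sub>R ker p (x - real t)"])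
    show "(\<lambda>x. indicator {..real t} x *\<^sub>R ker p (x - real t)) \<in> borel_measurable lebesgue"
      by (intro borel_measurable_scaleR borel_measurable_indicator) auto
    have "(\<integral>\<^sup>+x. ennreal (norm (indicator {..real t} x *\<^sub>R ker p (x - real t)) powr stab p) * indicator S x \<partial>lebesgue)
        \<le> (\<integral>\<^sup>+x. ennreal (norm (ker p (x - real t)) powr stab p) \<partial>lebesgue)"
      using stab[OF p] by (intro nn_integral_mono) (auto simp: indicator_def)
    also have "\<dots> \<le> ennreal kernel_total"
      using kernel_total_ge[OF p] by (simp add: nn_integral_shift_lebesgue[OF ker_L[OF p]] ennreal_leI)
    finally show "(\<integral>\<^sup>+x. ennreal (norm (indicator {..real t} x *\<^sub>R ker p (x - real t)) powr stab p) * indicator S x \<partial>lebesgue) \<le> ennreal kernel_total" .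
  qed (use assms stab nonneg in \<open>auto simp: approximates_def\<close>)
  also have "\<dots> \<le> ennreal coef_const" using \<epsilon> nonneg by (intro ennreal_leI) (simp add: coef_const_def)
  finally show ?thesis .
qed

text \<open>The error \<epsilon> has to be of the order of the decaying factor itself, so the
  accuracy of the approximation depends on t - s.\<close>

lemma step_norm_past:
  assumes \<xi>: "approximates \<epsilon> t \<xi>" and p: "p \<in> procs" and st: "s < t"
    and \<epsilon>: "0 \<le> \<epsilon>" "\<epsilon> \<le> real (t - s) powr (dmax + 1)"
  shows "(\<integral>\<^sup>+x. ennreal (norm (step_function (\<xi> p) x) powr stab p) * indicator {..real s} x \<partial>lebesgue)
    \<le> ennreal (coef_const * real (t - s) powr (dmax + 1))"
proof -
  let ?k = "real (t - s) powr (dmax + 1)"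
  have [measurable]: "(\<lambda>x. ker p (x - real t)) \<in> borel_measurable lebesgue"
    by (intro shift_measurable_lebesgue ker_measurable p)
  obtain \<delta>' where \<delta>': "\<And>x. norm (ker p x) \<le> K * \<bar>x\<bar> powr \<delta>'" "\<delta>' * stab p \<le> dmax"
    using ker_le[OF p] by blast
  have "(\<integral>\<^sup>+x. ennreal (norm (step_function (\<xi> p) x) powr stab p) * indicator {..real s} x \<partial>lebesgue) \<le> ennreal (4 * (tail_const * ?k) + 4 * \<epsilon>)"
  proof (rule nn_integral_approx_powr_le[where \<psi> = "\<lambda>x. indicator {..real t} x *\<^sub>R ker p (x - real t)"])
    show "(\<lambda>x. indicator {..real t} x *\<^sub>R ker p (x - real t)) \<in> borel_measurable lebesgue"
      by (intro borel_measurable_scaleR borel_measurable_indicator) auto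
    have "(\<integral>\<^sup>+x. ennreal (norm (indicator {..real t} x *\<^sub>R ker p (x - real t)) powr stab p) * indicator {..real s} x \<partial>lebesgue)
        \<le> (\<integral>\<^sup>+x. ennreal (norm (ker p (x - real t)) powr stab p) * indicator {..real s} x \<partial>lebesgue)"
      using stab[OF p] by (intro nn_integral_mono) (auto simp: indicator_def)
    also have "\<dots> \<le> ennreal (\<bar>K\<bar> powr stab p * (real t - real s) powr (dmax + 1))"
      using st by (intro nn_integral_kernel_left_tail[OF \<delta>'(1) stab(1)[OF p] \<delta>'(2) dmax]) linarith
    also have "\<dots> \<le> ennreal (tail_const * ?k)"
      using tail_const_ge[OF p] st by (intro ennreal_leI mult_mono) (auto simp: of_nat_diff nonneg)
    finally show "(\<integral>\<^sup>+x. ennreal (norm (indicator {..real t} x *\<^sub>R ker p (x - real t)) powr stab p) * indicator {..real s} x \<partial>lebesgue)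
        \<le> ennreal (tail_const * ?k)" .
  qed (use assms stab nonneg in \<open>auto simp: approximates_def\<close>)
  also have "\<dots> \<le> ennreal (coef_const * ?k)"
  proof (intro ennreal_leI)
    have "0 \<le> 4 * kernel_total * ?k" using nonneg by simp
    with \<epsilon> show "4 * (tail_const * ?k) + 4 * \<epsilon> \<le> coef_const * ?k" by (simp add: coef_const_def algebra_simps)
  qed
  finally show ?thesis .
qed

text \<open>Beyond t the target integrand vanishes, so the step function there is pure approximation
  error.\<close>

lemma step_norm_future:
  assumes \<xi>: "approximates \<epsilon> t \<xi>" and p: "p \<in> procs"
  shows "(\<integral>\<^sup>+x. ennreal (norm (step_function (\<xi> p) x) powr stab p) * indicator {real t<..} x \<partial>lebesgue) \<le> ennreal \<epsilon>"
proof -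
  have "(\<integral>\<^sup>+x. ennreal (norm (step_function (\<xi> p) x) powr stab p) * indicator {real t<..} x \<partial>lebesgue)
      \<le> (\<integral>\<^sup>+x. ennreal (norm (step_function (\<xi> p) x - indicator {..real t} x *\<^sub>R ker p (x - real t)) powr stab p) \<partial>lebesgue)"
    by (intro nn_integral_mono) (auto simp: indicator_def)
  also have "\<dots> \<le> ennreal \<epsilon>" using assms by (auto simp: approximates_def)
  finally show ?thesis .
qed

text \<open>The bound by \<sigma> does not pass exactly to an approximating step function, but every
  v above \<sigma>^2 is reached at sufficient accuracy. Half of the gap v - \<sigma>^2 is allotted
  to the factor 1 + \<rho>, half to the error.\<close>

lemma step_component:
  assumes \<xi>: "approximates \<epsilon> t \<xi>" and i: "i \<in> {1..q1}" and v: "\<sigma>\<^sup>2 < v"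
    and \<epsilon>: "0 \<le> \<epsilon>" "\<epsilon> \<le> (v - \<sigma>\<^sup>2) / (2 + 4 * (1 + \<sigma>\<^sup>2) / (v - \<sigma>\<^sup>2))"
  shows "(\<integral>\<^sup>+x. ennreal ((step_function (\<xi> (Inl i)) x $ l)\<^sup>2) * indicator S x \<partial>lebesgue) \<le> ennreal v"
proof -
  have p: "Inl i \<in> procs" using i by (auto simp: procs_def)
  have [measurable]: "(\<lambda>x. h i (x - real t)) \<in> borel_measurable lebesgue"
    using shift_measurable_lebesgue[OF ker_measurable[OF p]] by (simp add: ker_def)
  \<comment> \<open>Chosen so that \<rho> \<sigma>^2 <= (v - \<sigma>^2) / 2; the 1 + \<sigma>^2
    avoids a division by zero when \<sigma> = 0.\<close>
  define \<rho> where "\<rho> = (v - \<sigma>\<^sup>2) / (2 * (1 + \<sigma>\<^sup>2))"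
  have pos: "0 < 1 + \<sigma>\<^sup>2" by (rule add_pos_nonneg) auto
  have \<rho>: "0 < \<rho>" using v pos by (simp add: \<rho>_def)
  have "(\<integral>\<^sup>+x. ennreal ((step_function (\<xi> (Inl i)) x $ l)\<^sup>2) * indicator S x \<partial>lebesgue)
      \<le> (\<integral>\<^sup>+x. ennreal ((step_function (\<xi> (Inl i)) x $ l)\<^sup>2) \<partial>lebesgue)"
    by (intro nn_integral_mono) (auto simp: indicator_def)
  also have "\<dots> \<le> ennreal ((1 + \<rho>) * \<sigma>\<^sup>2 + (1 + 1 / \<rho>) * \<epsilon>)"
  proof (rule nn_integral_approx_component_le[where \<psi> = "\<lambda>x. indicator {..real t} x *\<^sub>R h i (x - real t)"])
    show "(\<lambda>x. indicator {..real t} x *\<^sub>R h i (x - real t)) \<in> borel_measurable lebesgue"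
      by (intro borel_measurable_scaleR borel_measurable_indicator) auto
    have comp: "(\<lambda>x. h i x $ l) \<in> borel_measurable lebesgue"
      using ker_measurable[OF p] unfolding ker_def sum.case
      by (rule measurable_compose[OF _ borel_measurable_continuous_onI]) (auto intro: continuous_intros)
    have sq: "(\<lambda>x. ennreal ((h i x $ l)\<^sup>2)) \<in> borel_measurable lebesgue"
      using comp by measurable
    have "(\<integral>\<^sup>+x. ennreal ((h i (x - real t) $ l)\<^sup>2) \<partial>lebesgue) = (\<integral>\<^sup>+x. ennreal ((h i x $ l)\<^sup>2) \<partial>lebesgue)"
      using nn_integral_real_affine_lebesgue[OF sq, of 1 "- real t"] by simp
    also have "\<dots> = ennreal (\<integral>x. (h i x $ l)\<^sup>2 \<partial>lebesgue)"
    proof (rule nn_integral_eq_integral)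
      have "integrable lebesgue (\<lambda>x. norm (h i x) powr 2)" using h_L[OF i] by (simp add: in_L_def)
      then show "integrable lebesgue (\<lambda>x. (h i x $ l)\<^sup>2)"
      proof (rule Bochner_Integration.integrable_bound)
        show "(\<lambda>x. (h i x $ l)\<^sup>2) \<in> borel_measurable lebesgue" using comp by measurable
        show "AE x in lebesgue. norm ((h i x $ l)\<^sup>2) \<le> norm (norm (h i x) powr 2)"
        proof (rule AE_I2)
          fix x show "norm ((h i x $ l)\<^sup>2) \<le> norm (norm (h i x) powr 2)"
            using power_mono[OF component_le_norm_cart[of "h i x" l], of 2] by simp
        qed
      qed
    qed auto
    also have "\<dots> \<le> ennreal (\<sigma>\<^sup>2)"
    proof (intro ennreal_leI)
      have "0 \<le> (\<integral>x. (h i x $ l)\<^sup>2 \<partial>lebesgue)" by (intro integral_nonneg_AE) auto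
      then show "(\<integral>x. (h i x $ l)\<^sup>2 \<partial>lebesgue) \<le> \<sigma>\<^sup>2"
        using h_\<sigma>[OF i, of l] by (metis real_sqrt_le_iff real_sqrt_pow2_iff power_mono real_sqrt_ge_zero)
    qed
    finally have "(\<integral>\<^sup>+x. ennreal ((h i (x - real t) $ l)\<^sup>2) \<partial>lebesgue) \<le> ennreal (\<sigma>\<^sup>2)" .
    moreover have "(\<integral>\<^sup>+x. ennreal (((indicator {..real t} x *\<^sub>R h i (x - real t)) $ l)\<^sup>2) \<partial>lebesgue)
        \<le> (\<integral>\<^sup>+x. ennreal ((h i (x - real t) $ l)\<^sup>2) \<partial>lebesgue)"
      by (intro nn_integral_mono) (auto simp: indicator_def)
    ultimately show "(\<integral>\<^sup>+x. ennreal (((indicator {..real t} x *\<^sub>R h i (x - real t)) $ l)\<^sup>2) \<partial>lebesgue) \<le> ennreal (\<sigma>\<^sup>2)"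
      by (rule order_trans[rotated])
    show "(\<integral>\<^sup>+x. ennreal (norm (step_function (\<xi> (Inl i)) x - indicator {..real t} x *\<^sub>R h i (x - real t)) powr 2) \<partial>lebesgue) \<le> ennreal \<epsilon>"
      using \<xi> p by (auto simp: approximates_def stab_def ker_def)
  qed (use \<rho> \<epsilon> in auto)
  also have "\<dots> \<le> ennreal v"
  proof (intro ennreal_leI)
    have "\<rho> * \<sigma>\<^sup>2 \<le> \<rho> * (1 + \<sigma>\<^sup>2)" using \<rho> by (intro mult_left_mono) auto
    also have "\<dots> = (v - \<sigma>\<^sup>2) / 2"
    proof -
      have "x / (2 * w) * w = x / 2" if "0 < w" for x w :: real using that by simp
      then show ?thesis using pos unfolding \<rho>_def by blast
    qed
    finally have 1: "\<rho> * \<sigma>\<^sup>2 \<le> (v - \<sigma>\<^sup>2) / 2" .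
    \<comment> \<open>This identity is the origin of the threshold for \<epsilon> in the hypothesis:
      it says (1 + 1 / \<rho>) \<epsilon> <= (v - \<sigma>^2) / 2.\<close>
    have "1 + 1 / \<rho> = (2 + 4 * (1 + \<sigma>\<^sup>2) / (v - \<sigma>\<^sup>2)) / 2"
    proof -
      have "1 + 1 / (x / (2 * w)) = (2 + 4 * w / x) / 2" if "0 < w" "0 < x" for x w :: real
        using that by (simp add: field_simps)
      then show ?thesis using pos v unfolding \<rho>_def by (simp only: diff_gt_0_iff_gt)
    qed
    moreover have "0 < 2 + 4 * (1 + \<sigma>\<^sup>2) / (v - \<sigma>\<^sup>2)" using v by (intro add_pos_nonneg) auto
    moreover have "q / 2 * \<epsilon> \<le> x / 2" if "0 < q" "\<epsilon> \<le> x / q" for q x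
      using that by (simp add: field_simps)
    ultimately have "(1 + 1 / \<rho>) * \<epsilon> \<le> (v - \<sigma>\<^sup>2) / 2" using \<epsilon>(2) by presburger
    moreover have "(1 + \<rho>) * \<sigma>\<^sup>2 = \<sigma>\<^sup>2 + \<rho> * \<sigma>\<^sup>2" by (simp add: distrib_right)
    moreover have "Q + P \<le> v" if "P \<le> (v - s) / 2" "Q = s + R" "R \<le> (v - s) / 2" for P Q R s
      using that by (simp add: field_simps)
    ultimately show "(1 + \<rho>) * \<sigma>\<^sup>2 + (1 + 1 / \<rho>) * \<epsilon> \<le> v" using 1 by blast
  qed
  finally show ?thesis .
qed

end

section \<open>Transfer to a common grid and passage to the limit\<close>

lemma finite_positive_lower_bound:
  fixes A :: "real set"
  assumes "finite A" "\<And>x. x \<in> A \<Longrightarrow> 0 < x"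
  shows "\<exists>e>0. \<forall>x\<in>A. e \<le> x"
  using assms by (intro exI[of _ "Min (insert 1 A)"]) auto

lemma sum_image_Times:
  assumes "inj f"
  shows "(\<Sum>z\<in>f ` A \<times> B. F z) = (\<Sum>a\<in>A. \<Sum>b\<in>B. F (f a, b))"
proof -
  have "(\<Sum>z\<in>f ` A \<times> B. F z) = (\<Sum>x\<in>f ` A. \<Sum>y\<in>B. F (x, y))"
    by (simp add: sum.cartesian_product case_prod_unfold)
  also have "\<dots> = (\<Sum>a\<in>A. \<Sum>b\<in>B. F (f a, b))"
    using assms by (subst sum.reindex) (auto intro: inj_on_subset)
  finally show ?thesis .
qed

context moving_average
begin

definition gidx :: "nat \<Rightarrow> ((nat + nat) \<times> nat) set" where "gidx m = Inl ` {1..q1} \<times> {..<m}"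
definition lidx :: "nat \<Rightarrow> ((nat + nat) \<times> nat) set" where "lidx m = Inr ` {1..q2} \<times> {..<m}"
definition incr :: "(nat \<Rightarrow> real) \<Rightarrow> (nat + nat) \<times> nat \<Rightarrow> 'w \<Rightarrow> real" where
  "incr u z w = W (fst z) (u (Suc (snd z))) w - W (fst z) (u (snd z)) w"
definition gap :: "(nat \<Rightarrow> real) \<Rightarrow> (nat + nat) \<times> nat \<Rightarrow> real" where
  "gap u z = u (Suc (snd z)) - u (snd z)"
definition coef :: "nat \<Rightarrow> (nat \<Rightarrow> real) \<Rightarrow> (nat + nat \<Rightarrow> (real \<times> real \<times> (real ^ 'd)) list) \<Rightarrow> (nat + nat) \<times> nat \<Rightarrow> real ^ 'd" where
  "coef n u \<xi> z = wt n (fst z) *\<^sub>R step_function (\<xi> (fst z)) (u (Suc (snd z)))"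

lemma idx_Un: "gidx m \<union> lidx m = procs \<times> {..<m}"
  by (auto simp: gidx_def lidx_def procs_def)

text \<open>The disjoint increments of each process are independent by definition, and
  \<open>indep_vars_Times\<close> joins them over all processes.\<close>

lemma noise_grid:
  assumes u: "strict_mono_on {..m} u"
  shows "noise M (gidx m) (lidx m) (incr u) (gap u) (\<lambda>z. stab (fst z))"
proof
  have less: "u k < u (Suc k)" if "k < m" for k
    using strict_mono_onD[OF u, of k "Suc k"] that by simp
  show "finite (gidx m)" "finite (lidx m)" "gidx m \<inter> lidx m = {}"
    by (auto simp: gidx_def lidx_def)
  show "indep_vars (\<lambda>_. borel) (incr u) (gidx m \<union> lidx m)"
  proof -
    have V: "indep_vars (\<lambda>_. \<Pi>\<^sub>M t\<in>(UNIV :: real set). (borel :: real measure)) (\<lambda>p w t. W p t w) procs"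
    proof -
      have "indep_vars (\<lambda>_. \<Pi>\<^sub>M t\<in>(UNIV :: real set). (borel :: real measure))
          (case_sum (\<lambda>i w t. B i t w) (\<lambda>j w t. Z j t w)) ({1..q1} <+> {1..q2})"
        using indep by (simp add: independent_processes_def)
      moreover have "case_sum (\<lambda>i w t. B i t w) (\<lambda>j w t. Z j t w) = (\<lambda>p w t. W p t w)"
        by (auto simp: W_def fun_eq_iff split: sum.split)
      moreover have "{1..q1} <+> {1..q2} = procs" by (auto simp: procs_def)
      ultimately show ?thesis by simp
    qed
    have "indep_vars (\<lambda>(p, k). borel) (\<lambda>(p, k) w. (\<lambda>w. w (u (Suc k)) - w (u k)) (\<lambda>t. W p t w)) (procs \<times> {..<m})"
    proof (rule indep_vars_Times[OF V finite_procs])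
      show "indep_vars (\<lambda>k. borel) (\<lambda>k w. W p (u (Suc k)) w - W p (u k) w) {..<m}" if "p \<in> procs" for p
      proof -
        have "independent_increments M (W p)"
          using that B Z by (auto simp: procs_def W_def brownian_motion_def symmetric_stable_motion_def)
        then show ?thesis using u by (simp add: independent_increments_def)
      qed
      show "(\<lambda>w. w (u (Suc k)) - w (u k)) \<in> borel_measurable (\<Pi>\<^sub>M t\<in>(UNIV :: real set). (borel :: real measure))" for k
        by (intro borel_measurable_diff measurable_component_singleton) auto
    qed simp
    moreover have "(\<lambda>(p, k) w. (\<lambda>w. w (u (Suc k)) - w (u k)) (\<lambda>t. W p t w)) = incr u"
      by (auto simp: incr_def fun_eq_iff)
    ultimately show ?thesis by (simp add: idx_Un case_prod_unfold)
  qed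
  fix z assume z: "z \<in> gidx m \<union> lidx m"
  then show "0 < gap u z" using less by (auto simp: gap_def gidx_def lidx_def)
next
  have less: "u k < u (Suc k)" if "k < m" for k
    using strict_mono_onD[OF u, of k "Suc k"] that by simp
  fix z assume "z \<in> gidx m"
  then obtain i k where ik: "z = (Inl i, k)" "i \<in> {1..q1}" "k < m" by (auto simp: gidx_def)
  then show "distributed M lborel (incr u z) (normal_density 0 (sqrt (gap u z)))"
    using B[of i] less[of k] by (simp add: brownian_motion_def incr_def[abs_def] gap_def W_def)
next
  have less: "u k < u (Suc k)" if "k < m" for k
    using strict_mono_onD[OF u, of k "Suc k"] that by simp
  fix z \<theta> assume "z \<in> lidx m"
  then obtain j k where jk: "z = (Inr j, k)" "j \<in> {1..q2}" "k < m" by (auto simp: lidx_def)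
  then show "char (distr M borel (incr u z)) \<theta> = complex_of_real (exp (- (gap u z * \<bar>\<theta>\<bar> powr stab (fst z))))"
    using Z[of j] less[of k] by (simp add: symmetric_stable_motion_def incr_def[abs_def] gap_def W_def stab_def)
next
  fix z assume "z \<in> lidx m"
  then show "0 < stab (fst z) \<and> stab (fst z) < 2" using \<beta> by (auto simp: lidx_def stab_def)
qed

lemma S_grid:
  assumes u: "strict_mono_on {..m} u"
    and \<xi>: "\<forall>p\<in>procs. \<forall>(a, b, c) \<in> set (\<xi> p). a < b \<and> a \<in> u ` {..m} \<and> b \<in> u ` {..m}"
  shows "noise.lin (incr u) (gidx m \<union> lidx m) (coef n u \<xi>) w = Xapp n \<xi> w"
proof -
  interpret N: noise M "gidx m" "lidx m" "incr u" "gap u" "\<lambda>z. stab (fst z)" by (rule noise_grid[OF u])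
  have "N.S (coef n u \<xi>) w = (\<Sum>p\<in>procs. \<Sum>k<m. incr u (p, k) w *\<^sub>R coef n u \<xi> (p, k))"
    unfolding N.lin_def idx_Un by (simp add: sum.cartesian_product case_prod_unfold)
  also have "\<dots> = (\<Sum>p\<in>procs. wt n p *\<^sub>R step_integral (W p) (\<xi> p) w)"
  proof (intro sum.cong refl)
    fix p assume p: "p \<in> procs"
    show "(\<Sum>k<m. incr u (p, k) w *\<^sub>R coef n u \<xi> (p, k)) = wt n p *\<^sub>R step_integral (W p) (\<xi> p) w"
      using \<xi> p by (subst step_integral_grid[OF u]) (auto simp: incr_def coef_def scaleR_sum_right mult.commute)
  qed
  finally show ?thesis by (simp add: Xapp_def)
qed

lemma grid_sum_le:
  assumes u: "strict_mono_on {..m} u"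
    and \<xi>: "\<forall>(a, b, c) \<in> set \<xi>. a < b \<and> a \<in> u ` {..m} \<and> b \<in> u ` {..m}"
    and F: "\<And>y. 0 \<le> F y" and S: "\<And>k. k < m \<Longrightarrow> k \<in> Ks \<Longrightarrow> {u k<..u (Suc k)} \<subseteq> S"
    and v: "(\<integral>\<^sup>+x. ennreal (F (step_function \<xi> x)) * indicator S x \<partial>lebesgue) \<le> ennreal v" "0 \<le> v"
  shows "(\<Sum>k\<in>{..<m} \<inter> Ks. (u (Suc k) - u k) * F (step_function \<xi> (u (Suc k)))) \<le> v"
proof -
  have "ennreal (\<Sum>k\<in>{..<m} \<inter> Ks. (u (Suc k) - u k) * F (step_function \<xi> (u (Suc k))))
      \<le> (\<integral>\<^sup>+x. ennreal (F (step_function \<xi> x)) * indicator S x \<partial>lebesgue)"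
    using \<xi> S by (intro sum_grid_le_nn_integral[OF u _ F]) auto
  also note v(1)
  finally show ?thesis using v(2) by (simp add: ennreal_le_iff)
qed

text \<open>Ks selects cells and S is a set of times containing them. S will be the past {..s}, the
  whole line, or the future {s<..}.\<close>

lemma gauss_var_le_grid:
  assumes u: "strict_mono_on {..m} u"
    and \<xi>: "\<forall>p\<in>procs. \<forall>(a, b, c) \<in> set (\<xi> p). a < b \<and> a \<in> u ` {..m} \<and> b \<in> u ` {..m}"
    and S: "\<And>k. k < m \<Longrightarrow> k \<in> Ks \<Longrightarrow> {u k<..u (Suc k)} \<subseteq> S"
    and v: "\<And>i l. i \<in> {1..q1} \<Longrightarrow>
      (\<integral>\<^sup>+x. ennreal ((step_function (\<xi> (Inl i)) x $ l)\<^sup>2) * indicator S x \<partial>lebesgue) \<le> ennreal v" "0 \<le> v"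
  shows "noise.gauss_var_le (gidx m) (gap u) (noise.past (UNIV \<times> Ks) (coef n u \<xi>)) (v * asum n)"
proof -
  interpret N: noise M "gidx m" "lidx m" "incr u" "gap u" "\<lambda>z. stab (fst z)" by (rule noise_grid[OF u])
  show ?thesis unfolding N.gauss_var_le_def
  proof
    fix l
    have "(\<Sum>z\<in>gidx m. gap u z * (N.past (UNIV \<times> Ks) (coef n u \<xi>) z $ l)\<^sup>2)
        = (\<Sum>i=1..q1. \<Sum>k<m. gap u (Inl i, k) * (N.past (UNIV \<times> Ks) (coef n u \<xi>) (Inl i, k) $ l)\<^sup>2)"
      unfolding gidx_def by (rule sum_image_Times) simp
    also have "\<dots> = (\<Sum>i=1..q1. (a n i)\<^sup>2 * (\<Sum>k\<in>{..<m} \<inter> Ks. (u (Suc k) - u k) * (step_function (\<xi> (Inl i)) (u (Suc k)) $ l)\<^sup>2))"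
      by (intro sum.cong refl)
        (auto simp: sum.inter_restrict sum_distrib_left N.past_def coef_def gap_def wt_def power_mult_distrib intro!: sum.cong)
    also have "\<dots> \<le> (\<Sum>i=1..q1. (a n i)\<^sup>2 * v)"
    proof (intro sum_mono mult_left_mono)
      fix i assume i: "i \<in> {1..q1}"
      then have "Inl i \<in> procs" by (simp add: procs_def)
      then show "(\<Sum>k\<in>{..<m} \<inter> Ks. (u (Suc k) - u k) * (step_function (\<xi> (Inl i)) (u (Suc k)) $ l)\<^sup>2) \<le> v"
        using \<xi> v i S by (intro grid_sum_le[OF u, where F = "\<lambda>y. (y $ l)\<^sup>2" and S = S]) auto
    qed simp
    finally show "(\<Sum>z\<in>gidx m. gap u z * (N.past (UNIV \<times> Ks) (coef n u \<xi>) z $ l)\<^sup>2) \<le> v * asum n"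
      by (simp add: asum_def sum_distrib_left mult.commute)
  qed
qed

lemma gauss_var_le_grid_norm:
  assumes "strict_mono_on {..m} u"
    and "\<forall>p\<in>procs. \<forall>(a, b, c) \<in> set (\<xi> p). a < b \<and> a \<in> u ` {..m} \<and> b \<in> u ` {..m}"
    and "\<And>k. k < m \<Longrightarrow> k \<in> Ks \<Longrightarrow> {u k<..u (Suc k)} \<subseteq> S"
    and v: "\<And>p. p \<in> procs \<Longrightarrow>
      (\<integral>\<^sup>+x. ennreal (norm (step_function (\<xi> p) x) powr stab p) * indicator S x \<partial>lebesgue) \<le> ennreal v" "0 \<le> v"
  shows "noise.gauss_var_le (gidx m) (gap u) (noise.past (UNIV \<times> Ks) (coef n u \<xi>)) (v * asum n)"
proof (rule gauss_var_le_grid[OF assms(1-3) _ v(2)])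
  fix i l assume "i \<in> {1..q1}"
  then have p: "Inl i \<in> procs" by (simp add: procs_def)
  have "(\<integral>\<^sup>+x. ennreal ((step_function (\<xi> (Inl i)) x $ l)\<^sup>2) * indicator S x \<partial>lebesgue)
      \<le> (\<integral>\<^sup>+x. ennreal (norm (step_function (\<xi> (Inl i)) x) powr stab (Inl i)) * indicator S x \<partial>lebesgue)"
  proof (intro nn_integral_mono mult_right_mono ennreal_leI)
    fix x show "(step_function (\<xi> (Inl i)) x $ l)\<^sup>2 \<le> norm (step_function (\<xi> (Inl i)) x) powr stab (Inl i)"
      using power_mono[OF component_le_norm_cart[of "step_function (\<xi> (Inl i)) x" l], of 2] by (simp add: stab_def)
  qed simp
  also have "\<dots> \<le> ennreal v" by (rule v(1)[OF p])
  finally show "(\<integral>\<^sup>+x. ennreal ((step_function (\<xi> (Inl i)) x $ l)\<^sup>2) * indicator S x \<partial>lebesgue) \<le> ennreal v" .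
qed

lemma stable_scale_le_grid:
  assumes u: "strict_mono_on {..m} u"
    and \<xi>: "\<forall>p\<in>procs. \<forall>(a, b, c) \<in> set (\<xi> p). a < b \<and> a \<in> u ` {..m} \<and> b \<in> u ` {..m}"
    and S: "\<And>k. k < m \<Longrightarrow> k \<in> Ks \<Longrightarrow> {u k<..u (Suc k)} \<subseteq> S"
    and v: "\<And>p. p \<in> procs \<Longrightarrow>
      (\<integral>\<^sup>+x. ennreal (norm (step_function (\<xi> p) x) powr stab p) * indicator S x \<partial>lebesgue) \<le> ennreal v" "0 \<le> v"
  shows "noise.stable_scale_le (lidx m) (gap u) (\<lambda>z. stab (fst z)) (noise.past (UNIV \<times> Ks) (coef n u \<xi>)) (v * bsum n)"
proof -
  interpret N: noise M "gidx m" "lidx m" "incr u" "gap u" "\<lambda>z. stab (fst z)" by (rule noise_grid[OF u])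
  have "(\<Sum>z\<in>lidx m. gap u z * norm (N.past (UNIV \<times> Ks) (coef n u \<xi>) z) powr stab (fst z))
      = (\<Sum>j=1..q2. \<Sum>k<m. gap u (Inr j, k) * norm (N.past (UNIV \<times> Ks) (coef n u \<xi>) (Inr j, k)) powr \<beta> j)"
    unfolding lidx_def by (subst sum_image_Times) (simp_all add: stab_def)
  also have "\<dots> = (\<Sum>j=1..q2. b n j powr \<beta> j * (\<Sum>k\<in>{..<m} \<inter> Ks. (u (Suc k) - u k) * norm (step_function (\<xi> (Inr j)) (u (Suc k))) powr \<beta> j))"
    using b \<beta> by (intro sum.cong refl)
      (auto simp: sum.inter_restrict sum_distrib_left N.past_def coef_def gap_def wt_def powr_mult intro!: sum.cong)
  also have "\<dots> \<le> (\<Sum>j=1..q2. b n j powr \<beta> j * v)"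
  proof (intro sum_mono mult_left_mono)
    fix j assume j: "j \<in> {1..q2}"
    then have p: "Inr j \<in> procs" by (simp add: procs_def)
    then show "(\<Sum>k\<in>{..<m} \<inter> Ks. (u (Suc k) - u k) * norm (step_function (\<xi> (Inr j)) (u (Suc k))) powr \<beta> j) \<le> v"
      using \<xi> v(1)[OF p] v(2) S
      by (intro grid_sum_le[OF u, where F = "\<lambda>y. norm y powr \<beta> j" and S = S]) (auto simp: stab_def)
  qed simp
  finally show ?thesis
    unfolding N.stable_scale_le_def by (simp add: bsum_def sum_distrib_left mult.commute)
qed

text \<open>One grid must serve the approximations at both times, so that they become combinations
  of the same increments. The prescribed point r will be the time s, so that no cell straddles
  it.\<close>

lemma common_grid:
  fixes \<xi> \<xi>' :: "nat + nat \<Rightarrow> (real \<times> real \<times> (real ^ 'd)) list"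
  obtains u :: "nat \<Rightarrow> real" and m :: nat where "strict_mono_on {..m} u" "r \<in> u ` {..m}"
    "\<forall>p\<in>procs. \<forall>(a, b, c) \<in> set (\<xi> p) \<union> set (\<xi>' p). a \<in> u ` {..m} \<and> b \<in> u ` {..m}"
proof -
  define E where "E = (\<Union>p\<in>procs. set (\<xi> p) \<union> set (\<xi>' p))"
  define P where "P = insert r (fst ` E \<union> (\<lambda>z. fst (snd z)) ` E)"
  have "finite E" unfolding E_def using finite_procs by blast
  then have "finite P" "P \<noteq> {}" by (auto simp: P_def)
  then obtain u :: "nat \<Rightarrow> real" and m where u: "strict_mono_on {..m} u" and P: "P = u ` {..m}"
    by (rule finite_set_grid)
  have "\<forall>(a, b, c) \<in> set (\<xi> p) \<union> set (\<xi>' p). a \<in> u ` {..m} \<and> b \<in> u ` {..m}" if "p \<in> procs" for p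
  proof clarify
    fix a b c assume "(a, b, c) \<in> set (\<xi> p) \<union> set (\<xi>' p)"
    with that have E: "(a, b, c) \<in> E" unfolding E_def by blast
    have "a \<in> P" "b \<in> P" unfolding P_def using imageI[OF E, of fst] imageI[OF E, of "\<lambda>z. fst (snd z)"] by simp_all
    then show "a \<in> u ` {..m} \<and> b \<in> u ` {..m}" by (simp only: P)
  qed
  moreover have "r \<in> u ` {..m}" unfolding P[symmetric] by (simp add: P_def)
  ultimately show thesis by (intro that[OF u] ballI) blast+
qed

lemma grid_endpoints:
  assumes "approximates \<epsilon> t \<xi>" and "\<forall>p\<in>procs. \<forall>(a, b, c) \<in> E p. a \<in> U \<and> b \<in> U" and "\<And>p. set (\<xi> p) \<subseteq> E p"
  shows "\<forall>p\<in>procs. \<forall>(a, b, c) \<in> set (\<xi> p). a < b \<and> a \<in> U \<and> b \<in> U"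
proof (intro ballI)
  fix p z assume p: "p \<in> procs" and z: "z \<in> set (\<xi> p)"
  obtain a b c where abc: "z = (a, b, c)" by (cases z)
  have "a < b" using assms(1) p z unfolding approximates_def abc by blast
  moreover have "z \<in> E p" using assms(3) z by blast
  then have "a \<in> U \<and> b \<in> U" using assms(2) p unfolding abc by blast
  ultimately show "case z of (a, b, c) \<Rightarrow> a < b \<and> a \<in> U \<and> b \<in> U" by (simp add: abc)
qed

text \<open>For each e the estimate is proved with an extra multiple of e, from approximations whose
  accuracy depends on e, s, t and n. The main term involves neither the grid nor e, so e can tend to
  0.\<close>

lemma covariance_bound:
  assumes dom: "dominated f \<Phi> C0" and wb: "weight_bound M \<Phi> coef_const v (asum n) C1 T p"
    and st: "s < t" and R: "asum n \<le> R" and T: "0 \<le> T" and v: "\<sigma>\<^sup>2 < v"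
  shows "\<bar>(\<integral>w. f (X s n w) * f (X t n w) \<partial>M) - (\<integral>w. f (X s n w) \<partial>M) * (\<integral>w. f (X t n w) \<partial>M)\<bar>
    \<le> 4 * (product_const (real CARD('d)) coef_const C0 C1 R * real (t - s) powr (dmax + 1) * (T + bsum n))"
proof (rule le_of_le_add_small)
  let ?k = "2 * (2 + 4 * moment_const (real CARD('d)) 1 + 32 * real CARD('d))"
  show "0 \<le> ?k + 4" by (simp add: moment_const_nonneg)
  fix e :: real assume e: "0 < e" "e \<le> 1"
  have f: "admissible f" using dom by (simp add: dominated_def)
  have [measurable]: "f \<in> borel_measurable borel" using f by (rule admissible_measurable)
  have fb: "\<bar>f y\<bar> \<le> 1" for y using f by (simp add: admissible_def)
  define \<kappa> where "\<kappa> = real (t - s) powr (dmax + 1)"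
  have \<kappa>: "0 < \<kappa>" using st by (simp add: \<kappa>_def)
  define w where "w = (\<Sum>p\<in>procs. 1 + wt n p)"
  have w: "0 \<le> w" unfolding w_def using wt_nonneg by (intro sum_nonneg) (auto simp: add_nonneg_nonneg)
  have "0 < (v - \<sigma>\<^sup>2) / (2 + 4 * (1 + \<sigma>\<^sup>2) / (v - \<sigma>\<^sup>2))"
    using v by (intro divide_pos_pos add_pos_nonneg) auto
  moreover have "0 < e\<^sup>2 / (1 + asum n)" "0 < e\<^sup>2 / (1 + bsum n)" "0 < e / (1 + 2 * w)"
    using e w nonneg by (auto intro!: divide_pos_pos add_pos_nonneg)
  \<comment> \<open>The six demands on the accuracy: 1 for the total coefficients, \<kappa> for the
    decay of the past, the third for the sharp variance v, the two with e^2 for the part of X_s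
    after time s, and the last for the distance between X and its approximations.\<close>
  ultimately have "\<exists>\<epsilon>>0. \<forall>x\<in>{1, \<kappa>, (v - \<sigma>\<^sup>2) / (2 + 4 * (1 + \<sigma>\<^sup>2) / (v - \<sigma>\<^sup>2)),
      e\<^sup>2 / (1 + asum n), e\<^sup>2 / (1 + bsum n), e / (1 + 2 * w)}. \<epsilon> \<le> x"
    using \<kappa> zero_less_one by (intro finite_positive_lower_bound) blast+
  then obtain \<epsilon> where \<epsilon>: "0 < \<epsilon>" "\<epsilon> \<le> 1" "\<epsilon> \<le> \<kappa>"
      "\<epsilon> \<le> (v - \<sigma>\<^sup>2) / (2 + 4 * (1 + \<sigma>\<^sup>2) / (v - \<sigma>\<^sup>2))"
      "\<epsilon> \<le> e\<^sup>2 / (1 + asum n)" "\<epsilon> \<le> e\<^sup>2 / (1 + bsum n)" "\<epsilon> \<le> e / (1 + 2 * w)"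
    by blast
  have small: "\<epsilon> * y \<le> x" if "\<epsilon> \<le> x / (1 + y)" "0 \<le> y" for x y
  proof -
    have "\<epsilon> * (1 + y) \<le> x" using that by (simp add: pos_le_divide_eq)
    then show ?thesis using \<epsilon>(1) by (simp add: distrib_left)
  qed
  obtain \<xi> \<xi>' where \<xi>: "approximates \<epsilon> s \<xi>" and \<xi>': "approximates \<epsilon> t \<xi>'"
    using ex_approximates[OF \<epsilon>(1)] by blast
  obtain u :: "nat \<Rightarrow> real" and m where u: "strict_mono_on {..m} u" and su: "real s \<in> u ` {..m}"
    and grid: "\<forall>p\<in>procs. \<forall>(a, b, c) \<in> set (\<xi> p) \<union> set (\<xi>' p). a \<in> u ` {..m} \<and> b \<in> u ` {..m}"
    by (rule common_grid)
  have g: "\<forall>p\<in>procs. \<forall>(a, b, c) \<in> set (\<xi> p). a < b \<and> a \<in> u ` {..m} \<and> b \<in> u ` {..m}"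
    and g': "\<forall>p\<in>procs. \<forall>(a, b, c) \<in> set (\<xi>' p). a < b \<and> a \<in> u ` {..m} \<and> b \<in> u ` {..m}"
    by (rule grid_endpoints[OF \<xi> grid], blast) (rule grid_endpoints[OF \<xi>' grid], blast)
  interpret N: noise M "gidx m" "lidx m" "incr u" "gap u" "\<lambda>z. stab (fst z)" by (rule noise_grid[OF u])
  \<comment> \<open>The cells that end no later than s; they carry the past.\<close>
  define Ks where "Ks = {k. u (Suc k) \<le> real s}"
  let ?P = "UNIV \<times> Ks :: ((nat + nat) \<times> nat) set"
  let ?x = "coef n u \<xi>" and ?y = "coef n u \<xi>'"
  have compl: "- ?P = UNIV \<times> - Ks" by auto
  have past_sub: "{u k<..u (Suc k)} \<subseteq> {..real s}" if "k < m" "k \<in> Ks" for k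
    using that by (auto simp: Ks_def)
  have future_sub: "{u k<..u (Suc k)} \<subseteq> {real s<..}" if "k < m" "k \<in> - Ks" for k
  proof -
    \<comment> \<open>Because s is a grid point, a cell that does not end by time s cannot begin
      before s.\<close>
    obtain l where l: "l \<le> m" "real s = u l" using su by auto
    have "u l < u (Suc k)" using that l by (simp add: Ks_def)
    then have "l < Suc k" using strict_mono_on_less[OF u, of l "Suc k"] that l by auto
    then have "u l \<le> u k" using strict_mono_on_less_eq[OF u, of l k] that l by auto
    then show ?thesis using l by auto
  qed
  have py: "N.gauss_var_le (N.past ?P ?y) (coef_const * \<kappa> * asum n)"
    using \<epsilon> nonneg past_sub st unfolding \<kappa>_def
    by (intro gauss_var_le_grid_norm[OF u g', where S = "{..real s}"] step_norm_past[OF \<xi>']) (auto simp: mult_nonneg_nonneg)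
  have sy: "N.stable_scale_le (N.past ?P ?y) (coef_const * \<kappa> * bsum n)"
    using \<epsilon> nonneg past_sub st unfolding \<kappa>_def
    by (intro stable_scale_le_grid[OF u g', where S = "{..real s}"] step_norm_past[OF \<xi>']) (auto simp: mult_nonneg_nonneg)
  have px: "N.gauss_var_le (N.past ?P ?x) (coef_const * asum n)"
    using \<epsilon> nonneg by (intro gauss_var_le_grid_norm[OF u g, where S = UNIV] step_norm_total[OF \<xi>]) auto
  have sx: "N.stable_scale_le (N.past ?P ?x) (coef_const * bsum n)"
    using \<epsilon> nonneg by (intro stable_scale_le_grid[OF u g, where S = UNIV] step_norm_total[OF \<xi>]) auto
  have v0: "0 \<le> v" using v zero_le_power2[of \<sigma>] by linarith
  have vx: "N.gauss_var_le (N.past ?P ?x) (v * asum n)"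
    using \<epsilon> v v0 by (intro gauss_var_le_grid[OF u g, where S = UNIV] step_component[OF \<xi>]) auto
  have "N.gauss_var_le (N.past (- ?P) ?x) (\<epsilon> * asum n)"
    unfolding compl using \<epsilon> future_sub
    by (intro gauss_var_le_grid_norm[OF u g, where S = "{real s<..}"] step_norm_future[OF \<xi>]) auto
  then have ex: "N.gauss_var_le (N.past (- ?P) ?x) (e\<^sup>2)"
    by (rule N.gauss_var_le_mono) (intro small[OF \<epsilon>(5)] nonneg)
  have "N.stable_scale_le (N.past (- ?P) ?x) (\<epsilon> * bsum n)"
    unfolding compl using \<epsilon> future_sub
    by (intro stable_scale_le_grid[OF u g, where S = "{real s<..}"] step_norm_future[OF \<xi>]) auto
  then have esx: "N.stable_scale_le (N.past (- ?P) ?x) (e\<^sup>2)"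
    by (rule N.stable_scale_le_mono) (intro small[OF \<epsilon>(6)] nonneg)
  have I: "(\<integral>\<^sup>+w. ennreal (\<Phi> (N.G (N.past ?P ?x) w) * (norm (N.G (N.past ?P ?y) w))\<^sup>2) \<partial>M) \<le> ennreal (C1 * \<kappa> * T)"
    "(\<integral>\<^sup>+w. ennreal (\<Phi> (N.G (N.past ?P ?x) w)) \<partial>M) \<le> ennreal p"
    and p: "0 \<le> p" "p \<le> C1" "p * asum n \<le> C1 * T"
    using wb N.noise_axioms \<kappa> px vx py unfolding weight_bound_def by blast+
  have "\<bar>(\<integral>w. f (N.S ?x w) * f (N.S ?y w) \<partial>M) - (\<integral>w. f (N.S ?x w) \<partial>M) * (\<integral>w. f (N.S ?y w) \<partial>M)\<bar>
      \<le> 4 * (product_const (real CARD('d)) coef_const C0 C1 R * \<kappa> * (T + bsum n)) + ?k * e"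
    using dom \<kappa> by (intro N.covariance_estimate[where \<Phi> = \<Phi> and ?C0.0 = C0 and ?C1.0 = C1, OF f _ _ _ _ py sx sy _ R _ _ _ T I p e ex esx])
      (auto simp: dominated_def nonneg less_imp_le)
  then have grid_le: "\<bar>(\<integral>w. f (Xapp n \<xi> w) * f (Xapp n \<xi>' w) \<partial>M) - (\<integral>w. f (Xapp n \<xi> w) \<partial>M) * (\<integral>w. f (Xapp n \<xi>' w) \<partial>M)\<bar>
      \<le> 4 * (product_const (real CARD('d)) coef_const C0 C1 R * \<kappa> * (T + bsum n)) + ?k * e"
    by (simp only: S_grid[OF u g] S_grid[OF u g'])
  have close: "2 * w * \<epsilon> \<le> e" using small[OF \<epsilon>(7)] w by (simp add: mult_ac)
  have "\<bar>((\<integral>w. f (X s n w) * f (X t n w) \<partial>M) - (\<integral>w. f (X s n w) \<partial>M) * (\<integral>w. f (X t n w) \<partial>M))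
      - ((\<integral>w. f (Xapp n \<xi> w) * f (Xapp n \<xi>' w) \<partial>M) - (\<integral>w. f (Xapp n \<xi> w) \<partial>M) * (\<integral>w. f (Xapp n \<xi>' w) \<partial>M))\<bar>
      \<le> 2 * e + 2 * e"
    using Xapp_close[OF f \<xi>, of n] Xapp_close[OF f \<xi>', of n] close fb unfolding w_def
    by (intro covariance_diff_le) auto
  with grid_le show "\<bar>(\<integral>w. f (X s n w) * f (X t n w) \<partial>M) - (\<integral>w. f (X s n w) \<partial>M) * (\<integral>w. f (X t n w) \<partial>M)\<bar>
      \<le> 4 * (product_const (real CARD('d)) coef_const C0 C1 R * real (t - s) powr (dmax + 1) * (T + bsum n)) + (?k + 4) * e"
    unfolding \<kappa>_def distrib_right by linarith
qed

lemma second_moment_bound: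
  assumes dom: "dominated f \<Phi> C0" and wb: "weight_bound M \<Phi> coef_const v (asum n) C1 T p"
    and R: "asum n \<le> R" and T: "0 \<le> T" and v: "\<sigma>\<^sup>2 < v"
  shows "(\<integral>w. f (X t n w) * f (X t n w) \<partial>M)
    \<le> product_const (real CARD('d)) coef_const C0 C1 R * (T + bsum n)"
proof (rule le_of_le_add_small)
  show "(0 :: real) \<le> 2" by simp
  fix e :: real assume e: "0 < e" "e \<le> 1"
  have f: "admissible f" using dom by (simp add: dominated_def)
  have [measurable]: "f \<in> borel_measurable borel" using f by (rule admissible_measurable)
  have fb: "\<bar>f y\<bar> \<le> 1" for y using f by (simp add: admissible_def)
  define w where "w = (\<Sum>p\<in>procs. 1 + wt n p)"
  have w: "0 \<le> w" unfolding w_def using wt_nonneg by (intro sum_nonneg) (auto simp: add_nonneg_nonneg)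
  have "0 < (v - \<sigma>\<^sup>2) / (2 + 4 * (1 + \<sigma>\<^sup>2) / (v - \<sigma>\<^sup>2))"
    using v by (intro divide_pos_pos add_pos_nonneg) auto
  moreover have "0 < e / (1 + 2 * w)"
    using e w by (auto intro!: divide_pos_pos add_pos_nonneg)
  ultimately have "\<exists>\<epsilon>>0. \<forall>x\<in>{1, (v - \<sigma>\<^sup>2) / (2 + 4 * (1 + \<sigma>\<^sup>2) / (v - \<sigma>\<^sup>2)), e / (1 + 2 * w)}. \<epsilon> \<le> x"
    using zero_less_one by (intro finite_positive_lower_bound) blast+
  then obtain \<epsilon> where \<epsilon>: "0 < \<epsilon>" "\<epsilon> \<le> 1"
      "\<epsilon> \<le> (v - \<sigma>\<^sup>2) / (2 + 4 * (1 + \<sigma>\<^sup>2) / (v - \<sigma>\<^sup>2))" "\<epsilon> \<le> e / (1 + 2 * w)"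
    by blast
  obtain \<xi> where \<xi>: "approximates \<epsilon> t \<xi>"
    using ex_approximates[OF \<epsilon>(1)] by blast
  obtain u :: "nat \<Rightarrow> real" and m where u: "strict_mono_on {..m} u"
    and grid: "\<forall>p\<in>procs. \<forall>(a, b, c) \<in> set (\<xi> p) \<union> set (\<xi> p). a \<in> u ` {..m} \<and> b \<in> u ` {..m}"
    by (rule common_grid)
  have g: "\<forall>p\<in>procs. \<forall>(a, b, c) \<in> set (\<xi> p). a < b \<and> a \<in> u ` {..m} \<and> b \<in> u ` {..m}"
    by (rule grid_endpoints[OF \<xi> grid]) blast
  interpret N: noise M "gidx m" "lidx m" "incr u" "gap u" "\<lambda>z. stab (fst z)" by (rule noise_grid[OF u])
  let ?x = "coef n u \<xi>"
  have all: "N.past (UNIV \<times> UNIV) ?x = ?x" by (auto simp: N.past_def)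
  have px: "N.gauss_var_le ?x (coef_const * asum n)"
    using gauss_var_le_grid_norm[OF u g, where Ks = UNIV and S = UNIV and v = coef_const and n = n] step_norm_total[OF \<xi>, where S = UNIV] \<epsilon> nonneg all by simp
  have sx: "N.stable_scale_le ?x (coef_const * bsum n)"
    using stable_scale_le_grid[OF u g, where Ks = UNIV and S = UNIV and v = coef_const and n = n] step_norm_total[OF \<xi>, where S = UNIV] \<epsilon> nonneg all by simp
  have v0: "0 \<le> v" using v zero_le_power2[of \<sigma>] by linarith
  have vx: "N.gauss_var_le ?x (v * asum n)"
    using gauss_var_le_grid[OF u g, where Ks = UNIV and S = UNIV and v = v and n = n]
      step_component[OF \<xi> _ v, where S = UNIV] \<epsilon> v0 all by simp
  have I: "(\<integral>\<^sup>+w. ennreal (\<Phi> (N.G ?x w) * (norm (N.G ?x w))\<^sup>2) \<partial>M) \<le> ennreal (C1 * 1 * T)"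
    "(\<integral>\<^sup>+w. ennreal (\<Phi> (N.G ?x w)) \<partial>M) \<le> ennreal p"
    and p: "0 \<le> p" "p \<le> C1" "p * asum n \<le> C1 * T"
  proof -
    have "N.gauss_var_le ?x (coef_const * 1 * asum n)" using px by simp
    then show "(\<integral>\<^sup>+w. ennreal (\<Phi> (N.G ?x w) * (norm (N.G ?x w))\<^sup>2) \<partial>M) \<le> ennreal (C1 * 1 * T)"
      "(\<integral>\<^sup>+w. ennreal (\<Phi> (N.G ?x w)) \<partial>M) \<le> ennreal p"
      "0 \<le> p" "p \<le> C1" "p * asum n \<le> C1 * T"
      using wb N.noise_axioms px vx zero_less_one unfolding weight_bound_def by blast+
  qed
  have "(\<integral>w. f (N.S ?x w) * f (N.S ?x w) \<partial>M) \<le> product_const (real CARD('d)) coef_const C0 C1 R * (T + bsum n)"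
    using dom I by (intro N.second_moment_estimate[where \<Phi> = \<Phi> and ?C0.0 = C0 and ?C1.0 = C1, OF f _ _ _ _ px sx _ R _ _ T _ _ p])
      (auto simp: dominated_def nonneg)
  then have le: "(\<integral>w. f (Xapp n \<xi> w) * f (Xapp n \<xi> w) \<partial>M) \<le> product_const (real CARD('d)) coef_const C0 C1 R * (T + bsum n)"
    by (simp only: S_grid[OF u g])
  have close: "2 * w * \<epsilon> \<le> e"
  proof -
    have "\<epsilon> * (1 + 2 * w) \<le> e" using \<epsilon>(4) w by (simp add: pos_le_divide_eq)
    then show ?thesis using \<epsilon>(1) by (simp add: algebra_simps)
  qed
  have int: "integrable M (\<lambda>w. f (Z w))" "integrable M (\<lambda>w. f (Z w) * f (Z w))"
    if [measurable]: "Z \<in> borel_measurable M" for Z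
  proof -
    have "\<bar>f y * f y\<bar> \<le> 1" for y using mult_mono[OF fb[of y] fb[of y]] by (simp add: abs_mult)
    then show "integrable M (\<lambda>w. f (Z w))" "integrable M (\<lambda>w. f (Z w) * f (Z w))"
      using fb by (auto intro!: integrable_const_bound[where B=1])
  qed
  have "(\<integral>w. f (X t n w) * f (X t n w) \<partial>M) - (\<integral>w. f (Xapp n \<xi> w) * f (Xapp n \<xi> w) \<partial>M)
      = (\<integral>w. f (X t n w) * f (X t n w) - f (Xapp n \<xi> w) * f (Xapp n \<xi> w) \<partial>M)"
    by (intro Bochner_Integration.integral_diff[symmetric] int) auto
  also have "\<dots> \<le> (\<integral>w. 2 * \<bar>f (X t n w) - f (Xapp n \<xi> w)\<bar> \<partial>M)"
  proof (intro integral_mono Bochner_Integration.integrable_diff integrable_mult_right integrable_abs int)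
    fix w
    have "f (X t n w) * f (X t n w) - f (Xapp n \<xi> w) * f (Xapp n \<xi> w)
        = (f (X t n w) + f (Xapp n \<xi> w)) * (f (X t n w) - f (Xapp n \<xi> w))"
      by (simp add: algebra_simps)
    also have "\<dots> \<le> \<bar>f (X t n w) + f (Xapp n \<xi> w)\<bar> * \<bar>f (X t n w) - f (Xapp n \<xi> w)\<bar>"
      by (metis abs_ge_self abs_mult)
    also have "\<dots> \<le> 2 * \<bar>f (X t n w) - f (Xapp n \<xi> w)\<bar>"
      using fb[of "X t n w"] fb[of "Xapp n \<xi> w"] by (intro mult_right_mono) auto
    finally show "f (X t n w) * f (X t n w) - f (Xapp n \<xi> w) * f (Xapp n \<xi> w)
        \<le> 2 * \<bar>f (X t n w) - f (Xapp n \<xi> w)\<bar>" .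
  qed auto
  also have "\<dots> \<le> 2 * e" using Xapp_close[OF f \<xi>, of n] close by (simp add: w_def)
  finally show "(\<integral>w. f (X t n w) * f (X t n w) \<partial>M)
    \<le> product_const (real CARD('d)) coef_const C0 C1 R * (T + bsum n) + 2 * e" using le by linarith
qed

end

section \<open>From covariances to the variance\<close>

text \<open>Each row of the covariance matrix sums to at most V (1 + 2 suminf r): V for the diagonal
  and V suminf r for each side of it. There are n rows, and the squared prefactor is 1 / n^2, which
  leaves 1 / n.\<close>

lemma (in prob_space) variance_centered_mean_le:
  fixes X :: "nat \<Rightarrow> nat \<Rightarrow> 'a \<Rightarrow> 'b::euclidean_space" and f :: "'b \<Rightarrow> real" and r :: "nat \<Rightarrow> real"
  assumes [measurable]: "f \<in> borel_measurable borel" "\<And>t. X t n \<in> borel_measurable M"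
    and fb: "\<And>y. \<bar>f y\<bar> \<le> 1"
    and second: "\<And>t. (\<integral>w. f (X t n w) * f (X t n w) \<partial>M) \<le> V"
    and cov: "\<And>s t. s < t \<Longrightarrow> \<bar>(\<integral>w. f (X s n w) * f (X t n w) \<partial>M)
      - (\<integral>w. f (X s n w) \<partial>M) * (\<integral>w. f (X t n w) \<partial>M)\<bar> \<le> V * r (t - s)"
    and r: "\<And>k. 0 \<le> r k" "summable r" and n: "1 \<le> n"
  shows "variance (centered_mean M X n f) \<le> V / real n * (1 + 2 * suminf r)"
proof -
  define F where "F t w = f (X t n w) - (\<integral>w'. f (X t n w') \<partial>M)" for t w
  have prod1: "\<bar>p * q\<bar> \<le> 1" if "\<bar>p\<bar> \<le> 1" "\<bar>q\<bar> \<le> 1" for p q :: real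
    using mult_mono[OF that] by (simp add: abs_mult)
  have int: "integrable M (\<lambda>w. f (X t n w))" "integrable M (\<lambda>w. f (X s n w) * f (X t n w))" for s t
  proof -
    have "\<bar>f y * f z\<bar> \<le> 1" for y z by (intro prod1 fb)
    then show "integrable M (\<lambda>w. f (X t n w))" "integrable M (\<lambda>w. f (X s n w) * f (X t n w))"
      using fb by (auto intro!: integrable_const_bound[where B=1])
  qed
  have intF: "integrable M (F t)" for t
    unfolding F_def[abs_def] using int by simp
  have FF: "F s w * F t w = f (X s n w) * f (X t n w) - f (X s n w) * (\<integral>w'. f (X t n w') \<partial>M)
      - f (X t n w) * (\<integral>w'. f (X s n w') \<partial>M) + (\<integral>w'. f (X s n w') \<partial>M) * (\<integral>w'. f (X t n w') \<partial>M)" for s t w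
    unfolding F_def by (simp add: algebra_simps)
  have intFF: "integrable M (\<lambda>w. F s w * F t w)" for s t
    unfolding FF using int by simp
  have EF: "(\<integral>w. F t w \<partial>M) = 0" for t
    unfolding F_def using int by (simp add: prob_space)
  have EFF: "(\<integral>w. F s w * F t w \<partial>M) = (\<integral>w. f (X s n w) * f (X t n w) \<partial>M)
      - (\<integral>w. f (X s n w) \<partial>M) * (\<integral>w. f (X t n w) \<partial>M)" for s t
    unfolding FF using int by (simp add: prob_space)
  have V: "0 \<le> V"
    using order_trans[OF integral_nonneg_AE second[of 0]] by simp
  have row: "(\<Sum>t=1..n. \<integral>w. F s w * F t w \<partial>M) \<le> V * (1 + 2 * suminf r)" if s: "s \<in> {1..n}" for s
  proof -
    have le: "(\<integral>w. F s w * F t w \<partial>M) \<le> V * r (t - s)" if "s < t" for s t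
      using cov[OF that] unfolding EFF by linarith
    have split: "{1..n} = {1..<s} \<union> ({s} \<union> {s<..n})" using s by auto
    have "(\<Sum>t=1..n. \<integral>w. F s w * F t w \<partial>M)
        = (\<Sum>t\<in>{1..<s}. \<integral>w. F s w * F t w \<partial>M) + ((\<integral>w. F s w * F s w \<partial>M) + (\<Sum>t\<in>{s<..n}. \<integral>w. F s w * F t w \<partial>M))"
      unfolding split by (subst sum.union_disjoint, simp, simp, fastforce, subst sum.union_disjoint) auto
    also have "(\<Sum>t\<in>{1..<s}. \<integral>w. F s w * F t w \<partial>M) \<le> V * suminf r"
    proof -
      have "(\<Sum>t\<in>{1..<s}. \<integral>w. F s w * F t w \<partial>M) \<le> (\<Sum>t\<in>{1..<s}. V * r (s - t))"
        using le by (intro sum_mono) (auto simp: mult.commute)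
      also have "\<dots> = V * (\<Sum>k\<in>(\<lambda>t. s - t) ` {1..<s}. r k)"
        by (subst sum.reindex) (auto simp: sum_distrib_left inj_on_def)
      also have "\<dots> \<le> V * suminf r"
        using V r by (intro mult_left_mono sum_le_suminf) auto
      finally show ?thesis .
    qed
    also have "(\<Sum>t\<in>{s<..n}. \<integral>w. F s w * F t w \<partial>M) \<le> V * suminf r"
    proof -
      have "(\<Sum>t\<in>{s<..n}. \<integral>w. F s w * F t w \<partial>M) \<le> (\<Sum>t\<in>{s<..n}. V * r (t - s))"
        using le by (intro sum_mono) auto
      also have "\<dots> = V * (\<Sum>k\<in>(\<lambda>t. t - s) ` {s<..n}. r k)"
        by (subst sum.reindex) (auto simp: sum_distrib_left inj_on_def)
      also have "\<dots> \<le> V * suminf r"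
        using V r by (intro mult_left_mono sum_le_suminf) auto
      finally show ?thesis .
    qed
    also have "(\<integral>w. F s w * F s w \<partial>M) \<le> V"
      using second[of s] zero_le_square[of "\<integral>w. f (X s n w) \<partial>M"] unfolding EFF by linarith
    finally show ?thesis by (simp add: algebra_simps)
  qed
  have cm: "centered_mean M X n f w = (1 / real n) * (\<Sum>t=1..n. F t w)" for w
    by (simp add: centered_mean_def F_def)
  have "expectation (centered_mean M X n f) = 0"
    unfolding cm using intF EF by (simp add: Bochner_Integration.integral_sum)
  then have "variance (centered_mean M X n f) = (\<integral>w. (1 / real n)\<^sup>2 * (\<Sum>s=1..n. \<Sum>t=1..n. F s w * F t w) \<partial>M)"
    by (subst variance_mean_zero) (simp_all add: cm power_mult_distrib power_divide sum_product power2_eq_square)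
  also have "\<dots> = (1 / real n)\<^sup>2 * (\<Sum>s=1..n. \<Sum>t=1..n. \<integral>w. F s w * F t w \<partial>M)"
    using intFF by (simp add: Bochner_Integration.integral_sum)
  also have "\<dots> \<le> (1 / real n)\<^sup>2 * (\<Sum>s=1..n. V * (1 + 2 * suminf r))"
    using row by (intro mult_left_mono sum_mono) auto
  also have "\<dots> = V / real n * (1 + 2 * suminf r)"
    using n by (simp add: power2_eq_square field_simps)
  finally show ?thesis .
qed

section \<open>The two Gaussian weights: the quadratic one and the tail indicator\<close>

lemma dominated_quadratic: "admissible f \<Longrightarrow> dominated f (\<lambda>y. 2 * (norm y)\<^sup>2) 2"
  for f :: "real ^ 'd \<Rightarrow> real"
proof -
  assume f: "admissible f"
  have "\<bar>f (y + z)\<bar> \<le> 2 * (norm y)\<^sup>2 + 2 * min 1 ((norm z)\<^sup>2)" for y z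
  proof -
    have "\<bar>f (y + z)\<bar> \<le> min 1 ((norm (y + z))\<^sup>2)"
      using f admissible_le_norm_sq[OF f] by (simp add: admissible_def)
    also have "\<dots> \<le> 2 * (norm y)\<^sup>2 + 2 * min 1 ((norm z)\<^sup>2)" by (rule min_one_norm_add_le)
    finally show ?thesis .
  qed
  then show ?thesis using f by (simp add: dominated_def)
qed

text \<open>If the Gaussian part y has norm below r but f (y + z) is nonzero, then |y + z| >= \<eta>
  and z has norm at least \<eta> - r. Such z are charged to the truncated square, which is bounded
  below there; this fixes the constant.\<close>

lemma dominated_tail:
  fixes f :: "real ^ 'd \<Rightarrow> real"
  assumes f: "f \<in> F0_class \<eta>" and r: "0 \<le> r" "r < \<eta>"
  shows "dominated f (indicator {y. r \<le> norm y}) (1 / min 1 ((\<eta> - r)\<^sup>2))"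
proof -
  have adm: "admissible f" using f F_class_admissible by (auto simp: F0_class_def)
  have q: "0 < min 1 ((\<eta> - r)\<^sup>2)" using r by simp
  have "\<bar>f (y + z)\<bar> \<le> indicator {y. r \<le> norm y} y + 1 / min 1 ((\<eta> - r)\<^sup>2) * min 1 ((norm z)\<^sup>2)" for y z
  proof (cases "r \<le> norm y")
    case True
    have "\<bar>f (y + z)\<bar> \<le> 1" using adm by (simp add: admissible_def)
    moreover have "0 \<le> 1 / min 1 ((\<eta> - r)\<^sup>2) * min 1 ((norm z)\<^sup>2)" using q by simp
    moreover have "indicator {y. r \<le> norm y} y = (1 :: real)" using True by simp
    ultimately show ?thesis by linarith
  next
    case False
    show ?thesis
    proof (cases "norm (y + z) < \<eta>")
      case True
      then have "f (y + z) = 0" using f by (simp add: F0_class_def)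
      then show ?thesis using q by simp
    next
      case far: False
      have "\<eta> - r \<le> norm z" using far False norm_triangle_ineq[of y z] by linarith
      then have "(\<eta> - r)\<^sup>2 \<le> (norm z)\<^sup>2" using r by (intro power_mono) auto
      then have "min 1 ((\<eta> - r)\<^sup>2) \<le> min 1 ((norm z)\<^sup>2)" by simp
      then have "1 \<le> 1 / min 1 ((\<eta> - r)\<^sup>2) * min 1 ((norm z)\<^sup>2)" using q by (simp add: pos_le_divide_eq)
      moreover have "\<bar>f (y + z)\<bar> \<le> 1" using adm by (simp add: admissible_def)
      ultimately show ?thesis using False by simp
    qed
  qed
  moreover have "indicator {y :: real ^ 'd. r \<le> norm y} \<in> borel_measurable borel"
    by (intro borel_measurable_indicator) measurable
  ultimately show ?thesis using adm q by (simp add: dominated_def)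
qed

text \<open>The three summands secure, in this order, p <= C1, p A <= C1 A^2 and the bound on the
  Gaussian-Gaussian term.\<close>

definition quadratic_const :: "real \<Rightarrow> real \<Rightarrow> real \<Rightarrow> real" where
  "quadratic_const d c R = 2 * moment_const d 1 * c * R + 2 * moment_const d 1 * c + 2 * moment_const d 2 * c\<^sup>2"

lemma weight_bound_quadratic:
  assumes c: "0 \<le> c" and A: "0 \<le> A" "A \<le> R"
  shows "weight_bound M (\<lambda>y :: real ^ 'd. 2 * (norm y)\<^sup>2) c v A
    (quadratic_const (real CARD('d)) c R) (A\<^sup>2) (2 * moment_const (real CARD('d)) 1 * c * A)"
  unfolding weight_bound_def
proof (intro conjI allI impI)
  let ?d = "real CARD('d)"
  let ?C = "quadratic_const ?d c R"
  have K: "0 \<le> moment_const ?d m" for m by (simp add: moment_const_nonneg)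
  have terms: "0 \<le> 2 * moment_const ?d 1 * c * R" "0 \<le> 2 * moment_const ?d 1 * c" "0 \<le> 2 * moment_const ?d 2 * c\<^sup>2"
    using K A c by simp_all
  show "0 \<le> 2 * moment_const ?d 1 * c * A" using K A c by simp
  have "2 * moment_const ?d 1 * c * A \<le> 2 * moment_const ?d 1 * c * R"
    using K A c by (intro mult_left_mono) auto
  then show "2 * moment_const ?d 1 * c * A \<le> ?C" using terms unfolding quadratic_const_def by linarith
  have "2 * moment_const ?d 1 * c * (A * A) \<le> ?C * (A * A)"
    using terms unfolding quadratic_const_def by (intro mult_right_mono) auto
  then show "2 * moment_const ?d 1 * c * A * A \<le> ?C * A\<^sup>2" by (simp add: power2_eq_square mult.assoc)
  fix IG IL and D :: "(nat + nat) \<times> nat \<Rightarrow> 'a \<Rightarrow> real" and \<tau> \<beta> and x u :: "_ \<Rightarrow> real ^ 'd" and \<kappa>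
  assume "noise M IG IL D \<tau> \<beta>" and \<kappa>: "0 < \<kappa>"
    and x: "noise.gauss_var_le IG \<tau> x (c * A)" and u: "noise.gauss_var_le IG \<tau> u (c * \<kappa> * A)"
  then interpret noise M IG IL D \<tau> \<beta> by simp
  have "(\<integral>\<^sup>+w. ennreal (2 * (norm (G x w))\<^sup>2 * (norm (G u w))\<^sup>2) \<partial>M) \<le> ennreal (2 * moment_const ?d 2 * c\<^sup>2 * \<kappa> * A\<^sup>2)"
    by (rule quadratic_weight(1)[OF x u \<kappa> A(1) c])
  also have "\<dots> \<le> ennreal (?C * \<kappa> * A\<^sup>2)"
    using terms \<kappa> unfolding quadratic_const_def by (intro ennreal_leI mult_right_mono) auto
  finally show "(\<integral>\<^sup>+w. ennreal (2 * (norm (G x w))\<^sup>2 * (norm (G u w))\<^sup>2) \<partial>M) \<le> ennreal (?C * \<kappa> * A\<^sup>2)" .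
  show "(\<integral>\<^sup>+w. ennreal (2 * (norm (G x w))\<^sup>2) \<partial>M) \<le> ennreal (2 * moment_const ?d 1 * c * A)"
    by (rule quadratic_weight(2)[OF x u \<kappa> A(1) c])
qed

text \<open>The tail probability supplies p and \<open>tail_weight\<close> the mixed moment, with
  exponent reduced by 1 - 1/m. T is only required to dominate the result, so that the exponential of
  the final statement can be inserted for it.\<close>

lemma weight_bound_tail:
  fixes r v A T c :: real and m :: nat
  assumes nonneg: "0 \<le> c" "0 \<le> A" "0 \<le> v" "0 \<le> r" and m: "0 < m"
    and T: "A * exp (- (r\<^sup>2 / (2 * real CARD('d) * (v * A)) * (1 - 1 / real m))) \<le> T"
  shows "weight_bound M (indicator {y :: real ^ 'd. r \<le> norm y}) c v A
    (c * (2 * real CARD('d) + moment_const (real CARD('d)) m) + 2 * real CARD('d)) T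
    (2 * real CARD('d) * exp (- (r\<^sup>2 / (2 * real CARD('d) * (v * A)))))"
  unfolding weight_bound_def
proof (intro conjI allI impI)
  let ?d = "real CARD('d)" let ?y = "r\<^sup>2 / (2 * ?d * (v * A))"
  let ?K = "c * (2 * ?d + moment_const ?d m)" let ?C = "?K + 2 * ?d"
  have K: "0 \<le> ?K" using nonneg by (simp add: moment_const_nonneg)
  have y: "0 \<le> ?y" using nonneg by simp
  show "0 \<le> 2 * ?d * exp (- ?y)" by simp
  have "2 * ?d * exp (- ?y) \<le> 2 * ?d * 1" using y by (intro mult_left_mono) auto
  then show "2 * ?d * exp (- ?y) \<le> ?C" using K by linarith
  have "?y * (1 - 1 / real m) \<le> ?y * 1" using y by (intro mult_left_mono) auto
  then have "A * exp (- ?y) \<le> A * exp (- (?y * (1 - 1 / real m)))"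
    using nonneg by (intro mult_left_mono) auto
  also note T
  finally have AT: "A * exp (- ?y) \<le> T" .
  then have T0: "0 \<le> T" using nonneg by (meson exp_ge_zero mult_nonneg_nonneg order_trans)
  have "2 * ?d * (A * exp (- ?y)) \<le> 2 * ?d * T" using AT by (intro mult_left_mono) auto
  also have "\<dots> \<le> ?C * T" using K T0 by (intro mult_right_mono) auto
  finally show "2 * ?d * exp (- ?y) * A \<le> ?C * T" by (simp only: mult_ac)
  fix IG IL and D :: "(nat + nat) \<times> nat \<Rightarrow> 'a \<Rightarrow> real" and \<tau> \<beta> and x u :: "_ \<Rightarrow> real ^ 'd" and \<kappa>
  assume "noise M IG IL D \<tau> \<beta>" and \<kappa>: "0 < \<kappa>"
    and vx: "noise.gauss_var_le IG \<tau> x (v * A)" and u: "noise.gauss_var_le IG \<tau> u (c * \<kappa> * A)"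
  then interpret noise M IG IL D \<tau> \<beta> by simp
  have tail: "emeasure M {w \<in> space M. r \<le> norm (G x w)} \<le> ennreal (2 * ?d * exp (- ?y))"
    by (rule tail_G_le[OF vx nonneg(4)])
  note w = tail_weight[OF tail u less_imp_le[OF \<kappa>] nonneg(2,1) m]
  note w(1)
  also have "ennreal (?K * \<kappa> * (A * exp (- (?y * (1 - 1 / real m))))) \<le> ennreal (?C * \<kappa> * T)"
    using K \<kappa> T T0 nonneg by (intro ennreal_leI mult_mono) auto
  finally show "(\<integral>\<^sup>+w. ennreal (indicator {y. r \<le> norm y} (G x w) * (norm (G u w))\<^sup>2) \<partial>M) \<le> ennreal (?C * \<kappa> * T)" .
  show "(\<integral>\<^sup>+w. ennreal (indicator {y. r \<le> norm y} (G x w)) \<partial>M) \<le> ennreal (2 * ?d * exp (- ?y))"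
    by (rule w(2))
qed

section \<open>Variance bounds for the array\<close>

context moving_average
begin

text \<open>The 4 is the factor in \<open>covariance_bound\<close>. The index k = 0 contributes
  nothing since 0 powr x = 0; the diagonal is accounted for by the leading 1. The series converges
  because dmax + 1 < - 1.\<close>

definition mix_const :: real where
  "mix_const = 1 + 2 * (\<Sum>k. 4 * real k powr (dmax + 1))"

lemma mix_summable: "summable (\<lambda>k. 4 * real k powr (dmax + 1))"
  using dmax by (intro summable_mult) (simp add: summable_real_powr_iff)

lemma mix_const_pos: "0 < mix_const"
  using mix_summable by (auto simp: mix_const_def intro!: add_pos_nonneg suminf_nonneg)

lemma variance_bound:
  assumes dom: "dominated f \<Phi> C0" and wb: "weight_bound M \<Phi> coef_const v (asum n) C1 T p"
    and R: "asum n \<le> R" and T: "0 \<le> T" and v: "\<sigma>\<^sup>2 < v" and n: "1 \<le> n"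
  shows "variance (centered_mean M X n f)
    \<le> mix_const * product_const (real CARD('d)) coef_const C0 C1 R / real n * (T + bsum n)"
proof -
  let ?Q = "product_const (real CARD('d)) coef_const C0 C1 R"
  have f: "admissible f" using dom by (simp add: dominated_def)
  have "variance (centered_mean M X n f) \<le> (?Q * (T + bsum n)) / real n * mix_const"
    unfolding mix_const_def
  proof (rule variance_centered_mean_le)
    show "f \<in> borel_measurable borel" using f by (rule admissible_measurable)
    show "\<bar>f y\<bar> \<le> 1" for y using f by (simp add: admissible_def)
    show "(\<integral>w. f (X t n w) * f (X t n w) \<partial>M) \<le> ?Q * (T + bsum n)" for t
      by (rule second_moment_bound[OF dom wb R T v])
    show "\<bar>(\<integral>w. f (X s n w) * f (X t n w) \<partial>M) - (\<integral>w. f (X s n w) \<partial>M) * (\<integral>w. f (X t n w) \<partial>M)\<bar>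
        \<le> ?Q * (T + bsum n) * (4 * real (t - s) powr (dmax + 1))" if "s < t" for s t
      using covariance_bound[OF dom wb that R T v] by (simp add: mult_ac)
  qed (use n mix_summable in auto)
  then show ?thesis by (simp add: mult_ac)
qed

lemma product_const_nonneg: "0 \<le> C0 \<Longrightarrow> 0 \<le> C1 \<Longrightarrow> 0 \<le> R \<Longrightarrow> 0 \<le> product_const (real CARD('d)) coef_const C0 C1 R"
  by (simp add: product_const_def moment_const_nonneg nonneg)

lemma asum_bounded:
  assumes "\<And>i. i \<in> {1..q1} \<Longrightarrow> bounded (range (\<lambda>n. a n i))"
  shows "\<exists>R\<ge>0. \<forall>n. asum n \<le> R"
proof -
  have "\<forall>i\<in>{1..q1}. \<exists>c. \<forall>n. \<bar>a n i\<bar> \<le> c"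
    using assms unfolding bounded_iff by fastforce
  then obtain c where c: "\<And>i n. i \<in> {1..q1} \<Longrightarrow> \<bar>a n i\<bar> \<le> c i" by metis
  have "asum n \<le> (\<Sum>i=1..q1. (c i)\<^sup>2)" for n
    unfolding asum_def using c by (intro sum_mono) (metis abs_ge_zero power2_abs power_mono)
  then show ?thesis by (intro exI[of _ "\<Sum>i=1..q1. (c i)\<^sup>2"]) (auto intro: sum_nonneg)
qed

text \<open>Cauchy-Schwarz. It passes from (\<Sum> a^2)^2, which the quadratic weight yields, to the
  fourth powers of the statement.\<close>

lemma asum_sq_le: "(asum n)\<^sup>2 \<le> real q1 * (\<Sum>i=1..q1. a n i ^ 4)"
proof -
  have "(asum n)\<^sup>2 \<le> real (card {1..q1}) * (\<Sum>i=1..q1. ((a n i)\<^sup>2)\<^sup>2)"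
    using sum_squared_le_sum_of_squares[of "\<lambda>i. (a n i)\<^sup>2" "{1..q1}"] by (simp add: asum_def mult.commute)
  then show ?thesis by (simp flip: power_mult)
qed

lemma variance_bound_smooth:
  assumes bdd: "\<And>i. i \<in> {1..q1} \<Longrightarrow> bounded (range (\<lambda>n. a n i))"
  shows "\<exists>C>0. \<forall>n\<ge>1. \<forall>f\<in>F_class 0. variance (centered_mean M X n f)
    \<le> C / real n * ((\<Sum>i = 1..q1. a n i ^ 4) + (\<Sum>j = 1..q2. b n j powr \<beta> j))"
proof -
  obtain R where R: "0 \<le> R" "\<And>n. asum n \<le> R" using asum_bounded[OF bdd] by blast
  define C1 where "C1 = quadratic_const (real CARD('d)) coef_const R"
  have C1: "0 \<le> C1" using R nonneg by (simp add: C1_def quadratic_const_def moment_const_nonneg)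
  define Q where "Q = mix_const * product_const (real CARD('d)) coef_const 2 C1 R"
  have Q: "0 \<le> Q" using product_const_nonneg[of 2 C1 R] C1 R mix_const_pos by (simp add: Q_def)
  \<comment> \<open>The summand 1 in Q + 1 makes C positive even if Q = 0; q1 + 1 dominates both the
    q1 from \<open>asum_sq_le\<close> and the coefficient 1 of the stable term.\<close>
  define C where "C = (Q + 1) * (real q1 + 1)"
  have "variance (centered_mean M X n f)
      \<le> C / real n * ((\<Sum>i = 1..q1. a n i ^ 4) + (\<Sum>j = 1..q2. b n j powr \<beta> j))"
    if n: "1 \<le> n" and f: "f \<in> F_class 0" for n f
  proof -
    let ?a4 = "\<Sum>i = 1..q1. a n i ^ 4"
    have a4: "0 \<le> ?a4" using a by (intro sum_nonneg) auto
    have "variance (centered_mean M X n f) \<le> Q / real n * ((asum n)\<^sup>2 + bsum n)"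
      unfolding Q_def C1_def
    proof (rule variance_bound[OF dominated_quadratic[OF F_class_admissible[OF f]]])
      \<comment> \<open>With no exponential rate at stake, any number above \<sigma>^2 serves as
        v.\<close>
      show "weight_bound M (\<lambda>y :: real ^ 'd. 2 * (norm y)\<^sup>2) coef_const (\<sigma>\<^sup>2 + 1) (asum n) (quadratic_const (real CARD('d)) coef_const R)
          ((asum n)\<^sup>2) (2 * moment_const (real CARD('d)) 1 * coef_const * asum n)"
        by (rule weight_bound_quadratic[OF nonneg(5,1) R(2)])
    qed (use R n in auto)
    also have "\<dots> \<le> Q / real n * ((real q1 + 1) * (?a4 + bsum n))"
    proof (intro mult_left_mono)
      have "0 \<le> ?a4 + real q1 * bsum n" using a4 nonneg by simp
      then show "(asum n)\<^sup>2 + bsum n \<le> (real q1 + 1) * (?a4 + bsum n)"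
        using asum_sq_le[of n] by (simp add: algebra_simps)
    qed (use Q in simp)
    also have "\<dots> = Q * ((real q1 + 1) * (?a4 + bsum n)) / real n" by simp
    also have "\<dots> \<le> (Q + 1) * ((real q1 + 1) * (?a4 + bsum n)) / real n"
      using a4 nonneg by (intro divide_right_mono mult_right_mono) auto
    finally show ?thesis by (simp add: C_def bsum_def mult.assoc)
  qed
  moreover have "0 < C" using Q by (simp add: C_def)
  ultimately show ?thesis by blast
qed

lemma variance_bound_vanishing:
  assumes bdd: "\<And>i. i \<in> {1..q1} \<Longrightarrow> bounded (range (\<lambda>n. a n i))"
    and \<eta>: "0 < \<eta>" and \<mu>: "0 < \<mu>" "\<mu> < 1"
  shows "\<exists>C>0. \<forall>n\<ge>1. \<forall>f\<in>F0_class \<eta>. variance (centered_mean M X n f)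
    \<le> C / real n * ((\<Sum>i = 1..q1. (a n i)\<^sup>2)
        * exp (- (\<eta>\<^sup>2 * \<mu>\<^sup>2) / (2 * real CARD('d) * \<sigma>\<^sup>2 * (\<Sum>i = 1..q1. (a n i)\<^sup>2)))
      + (\<Sum>j = 1..q2. b n j powr \<beta> j))"
proof -
  let ?d = "real CARD('d)"
  obtain R where R: "0 \<le> R" "\<And>n. asum n \<le> R" using asum_bounded[OF bdd] by blast
  \<comment> \<open>The loss \<mu>^2 = \<nu>^4 is shared out: \<nu>^2 to r = \<nu> \<eta>, one \<nu>
    to v = \<sigma>^2 / \<nu>, and one \<nu> to 1 - 1/m.\<close>
  define \<nu> where "\<nu> = sqrt \<mu>"
  have \<nu>: "0 < \<nu>" "\<nu> < 1" "\<nu> * \<nu> = \<mu>" using \<mu> by (auto simp: \<nu>_def)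
  \<comment> \<open>Large enough for 1 - 1/m >= \<nu>.\<close>
  define m where "m = nat \<lceil>1 / (1 - \<nu>)\<rceil>"
  have m_ge: "1 / (1 - \<nu>) \<le> real m" unfolding m_def by (rule real_nat_ceiling_ge)
  have m: "0 < m" using m_ge \<nu> by (metis diff_gt_0_iff_gt divide_pos_pos gr0I not_less of_nat_0 zero_less_one)
  have m\<nu>: "\<nu> \<le> 1 - 1 / real m"
    using m_ge m \<nu> by (simp add: field_simps)
  \<comment> \<open>For \<sigma> = 0 the value \<sigma>^2 / \<nu> would not exceed \<sigma>^2, so an
    arbitrary positive number replaces it.\<close>
  define v where "v = (if \<sigma> = 0 then 1 else \<sigma>\<^sup>2 / \<nu>)"
  have v: "\<sigma>\<^sup>2 < v" "0 \<le> v" using \<nu> by (auto simp: v_def pos_less_divide_eq)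
  define r where "r = \<nu> * \<eta>"
  have r: "0 \<le> r" "r < \<eta>" using \<nu> \<eta> by (auto simp: r_def)
  define C0 where "C0 = 1 / min 1 ((\<eta> - r)\<^sup>2)"
  have C0: "0 \<le> C0" by (simp add: C0_def)
  define C1 where "C1 = coef_const * (2 * ?d + moment_const ?d m) + 2 * ?d"
  have C1: "0 \<le> C1" using nonneg by (simp add: C1_def moment_const_nonneg)
  define Q where "Q = mix_const * product_const ?d coef_const C0 C1 R"
  have Q: "0 \<le> Q" using product_const_nonneg[OF C0 C1 R(1)] mix_const_pos by (simp add: Q_def)
  have "variance (centered_mean M X n f)
      \<le> (Q + 1) / real n * (asum n * exp (- (\<eta>\<^sup>2 * \<mu>\<^sup>2) / (2 * ?d * \<sigma>\<^sup>2 * asum n)) + bsum n)"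
    if n: "1 \<le> n" and f: "f \<in> F0_class \<eta>" for n f
  proof -
    let ?A = "asum n"
    let ?T = "?A * exp (- (\<eta>\<^sup>2 * \<mu>\<^sup>2) / (2 * ?d * \<sigma>\<^sup>2 * ?A))"
    have T0: "0 \<le> ?T" using nonneg by simp
    have T: "?A * exp (- (r\<^sup>2 / (2 * ?d * (v * ?A)) * (1 - 1 / real m))) \<le> ?T"
    proof (intro mult_left_mono nonneg)
      let ?y = "r\<^sup>2 / (2 * ?d * (v * ?A))"
      have "(\<eta>\<^sup>2 * \<mu>\<^sup>2) / (2 * ?d * \<sigma>\<^sup>2 * ?A) \<le> ?y * \<nu>"
      \<comment> \<open>In these degenerate cases the target quotient is 0 by the convention on
        division, and only nonnegativity of the right side is needed.\<close>
      proof (cases "\<sigma> = 0 \<or> ?A = 0")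
        case True
        then show ?thesis using nonneg v \<nu> by auto
      next
        case False
        then have "?y * \<nu> = (\<eta>\<^sup>2 * (\<nu> * \<nu>)\<^sup>2) / (2 * ?d * \<sigma>\<^sup>2 * ?A)"
          using \<nu> by (simp add: v_def r_def field_simps power2_eq_square)
        then show ?thesis using \<nu> by simp
      qed
      also have "\<dots> \<le> ?y * (1 - 1 / real m)"
        using m\<nu> nonneg v by (intro mult_left_mono) auto
      finally show "exp (- (?y * (1 - 1 / real m))) \<le> exp (- (\<eta>\<^sup>2 * \<mu>\<^sup>2) / (2 * ?d * \<sigma>\<^sup>2 * ?A))" by simp
    qed
    have "variance (centered_mean M X n f) \<le> Q / real n * (?T + bsum n)"
      unfolding Q_def C0_def C1_def
      by (rule variance_bound[OF dominated_tail[OF f r] weight_bound_tail[OF nonneg(5,1) v(2) r(1) m T] R(2) T0 v(1) n])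
    also have "\<dots> \<le> (Q + 1) / real n * (?T + bsum n)"
      using T0 nonneg by (intro mult_right_mono divide_right_mono) auto
    finally show ?thesis .
  qed
  moreover have "0 < Q + 1" using Q by simp
  ultimately show ?thesis unfolding asum_def bsum_def by blast
qed

end

theorem theorem2p2:
  fixes M :: "'w measure"
    and q1 q2 :: nat
    and a b :: "nat \<Rightarrow> nat \<Rightarrow> real"
    and B Z :: "nat \<Rightarrow> real \<Rightarrow> 'w \<Rightarrow> real"
    and h g :: "nat \<Rightarrow> real \<Rightarrow> real ^ 'd"
    and \<beta> \<delta> :: "nat \<Rightarrow> real"
    and \<delta>0 \<sigma> K :: real
    and IB IZ :: "nat \<Rightarrow> nat \<Rightarrow> 'w \<Rightarrow> real ^ 'd"
    and X :: "nat \<Rightarrow> nat \<Rightarrow> 'w \<Rightarrow> real ^ 'd"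
  assumes "prob_space M"
    and "\<And>i. i \<in> {1..q1} \<Longrightarrow> brownian_motion M (B i)"
    and "\<And>j. j \<in> {1..q2} \<Longrightarrow> 0 < \<beta> j \<and> \<beta> j < 2"
    and "\<And>j. j \<in> {1..q2} \<Longrightarrow> symmetric_stable_motion M (\<beta> j) (Z j)"
    and "independent_processes M {1..q1} B {1..q2} Z"
    and "\<And>i x. i \<in> {1..q1} \<Longrightarrow> 0 \<le> x \<Longrightarrow> h i x = 0"
    and "\<And>j x. j \<in> {1..q2} \<Longrightarrow> 0 \<le> x \<Longrightarrow> g j x = 0"
    and "\<And>i. i \<in> {1..q1} \<Longrightarrow> in_L 2 (h i)"
    and "\<And>i x. i \<in> {1..q1} \<Longrightarrow> norm (h i x) \<le> K * \<bar>x\<bar> powr \<delta>0"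
    and "\<And>i l. i \<in> {1..q1} \<Longrightarrow> sqrt (\<integral>x. (h i x $ l)\<^sup>2 \<partial>lebesgue) \<le> \<sigma>"
    and "\<And>j. j \<in> {1..q2} \<Longrightarrow> in_L (\<beta> j) (g j)"
    and "\<And>j x. j \<in> {1..q2} \<Longrightarrow> norm (g j x) \<le> K * \<bar>x\<bar> powr \<delta> j"
    and "\<And>j. j \<in> {1..q2} \<Longrightarrow> \<delta> j < - 1 / \<beta> j"
    and "\<And>n i. i \<in> {1..q1} \<Longrightarrow> 0 \<le> a n i"
    and "\<And>n j. j \<in> {1..q2} \<Longrightarrow> 0 \<le> b n j"
    and "\<And>i t. i \<in> {1..q1} \<Longrightarrow>
           has_stochastic_integral M 2 (B i) {..real t} (\<lambda>s. h i (s - real t)) (IB i t)"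
    and "\<And>j t. j \<in> {1..q2} \<Longrightarrow>
           has_stochastic_integral M (\<beta> j) (Z j) {..real t} (\<lambda>s. g j (s - real t)) (IZ j t)"
    and "\<And>t n \<omega>. \<omega> \<in> space M \<Longrightarrow>
           X t n \<omega> = (\<Sum>i = 1..q1. a n i *\<^sub>R IB i t \<omega>) + (\<Sum>j = 1..q2. b n j *\<^sub>R IZ j t \<omega>)"
    and "Max (insert (2 * \<delta>0) ((\<lambda>j. \<delta> j * \<beta> j) ` {1..q2})) < - 2"
    and "\<And>i. i \<in> {1..q1} \<Longrightarrow> bounded (range (\<lambda>n. a n i))"
    and "\<And>j. j \<in> {1..q2} \<Longrightarrow> bounded (range (\<lambda>n. b n j))"
  shows
    "(\<exists>C>0. \<forall>n\<ge>1. \<forall>f\<in>F_class 0.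
        prob_space.variance M (centered_mean M X n f)
          \<le> C / real n * ((\<Sum>i = 1..q1. a n i ^ 4) + (\<Sum>j = 1..q2. b n j powr \<beta> j))) \<and>
     (\<forall>\<eta>>0. \<forall>\<mu>\<in>{0<..<1}. \<exists>C>0. \<forall>n\<ge>1. \<forall>f\<in>F0_class \<eta>.
        prob_space.variance M (centered_mean M X n f)
          \<le> C / real n *
             ((\<Sum>i = 1..q1. (a n i)\<^sup>2)
                * exp (- (\<eta>\<^sup>2 * \<mu>\<^sup>2) / (2 * real CARD('d) * \<sigma>\<^sup>2 * (\<Sum>i = 1..q1. (a n i)\<^sup>2)))
              + (\<Sum>j = 1..q2. b n j powr \<beta> j)))"
proof -
  have "moving_average M q1 q2 a b B Z h g \<beta> \<delta> \<delta>0 \<sigma> K IB IZ X"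
    using assms by (intro moving_average.intro moving_average_axioms.intro) auto
  then interpret moving_average M q1 q2 a b B Z h g \<beta> \<delta> \<delta>0 \<sigma> K IB IZ X .
  show ?thesis
    using variance_bound_smooth variance_bound_vanishing assms(20) by auto
qed

end
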